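(* Let $G$ be a reductive group over an algebraically closed field. Let $H$ be a subgroup of $G$ that is Zariski-dense in $G$ and contains no non-trivial unipotent elements. Let $(B,N)$ be a split spherical $BN$-pair of $H$ of type $(W,S)$ such that $(W,S)$ has no direct rank $1$ factors (i.e. every irreducible component of $(W,S)$ has rank at least $2$; equivalently, the Coxeter diagram of $(W,S)$ has no isolated nodes). Then $(B,N)$ is trivial, i.e. $B=H$.
   Context: Reductive groups are connected by definition; algebraic groups over an algebraically closed field are linear algebraic groups, identified with their groups of points. A $BN$-pair of a group $H$ is a pair of subgroups $(B,N)$ generating $H$ such that $T:=B\cap N$ is normal in $N$ and $W:=N/T$ admits a generating set $S$ with, for all $s\in S$, $w\in W$: (BN1) $sBw\subseteq BswB\cup BwB$, and (BN2) $sBs^{-1}\not\leq B$. (Then $(W,S)$ is a Coxeter system, called the type of the $BN$-pair.) The $BN$-pair is spherical if $W$ is finite. It is saturated if $B\cap N=\bigcap_{w\in W}wBw^{-1}$. It is split if it is saturated and $B=U\rtimes T$ for some nilpotent subgroup $U$ (normal in $B$). It is trivial if $B=H$. *)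

theory Defs
  imports "HOL-Analysis.Analysis" "HOL-Algebra.Algebra"
begin

primrec lower_central :: "('a, 'm) monoid_scheme \<Rightarrow> nat \<Rightarrow> 'a set" where
  "lower_central G 0 = carrier G"
| "lower_central G (Suc n) = generate G
     {g \<otimes>\<^bsub>G\<^esub> h \<otimes>\<^bsub>G\<^esub> inv\<^bsub>G\<^esub> g \<otimes>\<^bsub>G\<^esub> inv\<^bsub>G\<^esub> h | g h. g \<in> carrier G \<and> h \<in> lower_central G n}"

definition nilpotent_group :: "('a, 'm) monoid_scheme \<Rightarrow> bool" where
  "nilpotent_group G \<longleftrightarrow> group G \<and> (\<exists>n. lower_central G n = {\<one>\<^bsub>G\<^esub>})"

definition weyl_group :: "('a, 'm) monoid_scheme \<Rightarrow> 'a set \<Rightarrow> 'a set \<Rightarrow> 'a set monoid" where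
  "weyl_group H B N = (H\<lparr>carrier := N\<rparr>) Mod (B \<inter> N)"

text \<open>Elements of the Weyl group are cosets of \<open>T = B \<inter> N\<close> in \<open>N\<close>, hence subsets of \<open>H\<close>, and
  \<open>s B w\<close>, \<open>B s w B\<close>, \<open>s B s\<^sup>-\<^sup>1\<close> are products of subsets. As \<open>T\<close> is contained in \<open>B\<close> and normal
  in \<open>N\<close>, conditions (BN1) and (BN2) are equivalent to those for arbitrary coset representatives.\<close>

definition BN_pair ::
  "('a, 'm) monoid_scheme \<Rightarrow> 'a set \<Rightarrow> 'a set \<Rightarrow> 'a set set \<Rightarrow> bool" where
  "BN_pair H B N S \<longleftrightarrow>
     (let W = weyl_group H B N in
      group H \<and> subgroup B H \<and> subgroup N H \<and> generate H (B \<union> N) = carrier H \<and>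
      B \<inter> N \<lhd> H\<lparr>carrier := N\<rparr> \<and>
      S \<subseteq> carrier W \<and> generate W S = carrier W \<and>
      (\<forall>s\<in>S. \<forall>w\<in>carrier W.
         s <#>\<^bsub>H\<^esub> B <#>\<^bsub>H\<^esub> w \<subseteq>
           (B <#>\<^bsub>H\<^esub> (s \<otimes>\<^bsub>W\<^esub> w) <#>\<^bsub>H\<^esub> B) \<union> (B <#>\<^bsub>H\<^esub> w <#>\<^bsub>H\<^esub> B)) \<and>
      (\<forall>s\<in>S. \<not> s <#>\<^bsub>H\<^esub> B <#>\<^bsub>H\<^esub> inv\<^bsub>W\<^esub> s \<subseteq> B))"

definition BN_spherical :: "('a, 'm) monoid_scheme \<Rightarrow> 'a set \<Rightarrow> 'a set \<Rightarrow> bool" where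
  "BN_spherical H B N \<longleftrightarrow> finite (carrier (weyl_group H B N))"

definition BN_saturated :: "('a, 'm) monoid_scheme \<Rightarrow> 'a set \<Rightarrow> 'a set \<Rightarrow> bool" where
  "BN_saturated H B N \<longleftrightarrow>
     B \<inter> N = (\<Inter>w\<in>carrier (weyl_group H B N). w <#>\<^bsub>H\<^esub> B <#>\<^bsub>H\<^esub> inv\<^bsub>weyl_group H B N\<^esub> w)"

definition BN_split :: "('a, 'm) monoid_scheme \<Rightarrow> 'a set \<Rightarrow> 'a set \<Rightarrow> bool" where
  "BN_split H B N \<longleftrightarrow> BN_saturated H B N \<and>
     (\<exists>U. U \<lhd> H\<lparr>carrier := B\<rparr> \<and> nilpotent_group (H\<lparr>carrier := U\<rparr>) \<and>
          U \<inter> (B \<inter> N) = {\<one>\<^bsub>H\<^esub>} \<and> U <#>\<^bsub>H\<^esub> (B \<inter> N) = B)"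

text \<open>The edges of the Coxeter diagram join \<open>s\<close> and \<open>t\<close> with \<open>m(s,t) \<ge> 3\<close>; here \<open>group.ord\<close> is \<open>0\<close>
  on elements of infinite order.\<close>

definition coxeter_edges :: "('w, 'm) monoid_scheme \<Rightarrow> 'w set \<Rightarrow> ('w \<times> 'w) set" where
  "coxeter_edges W S = {(s, t). s \<in> S \<and> t \<in> S \<and> s \<noteq> t \<and>
     (group.ord W (s \<otimes>\<^bsub>W\<^esub> t) = 0 \<or> 3 \<le> group.ord W (s \<otimes>\<^bsub>W\<^esub> t))}"

definition irreducible_components :: "('w, 'm) monoid_scheme \<Rightarrow> 'w set \<Rightarrow> 'w set set" where
  "irreducible_components W S = S // (coxeter_edges W S)\<^sup>*"

text \<open>Components are nonempty, and \<open>card\<close> is \<open>0\<close> on infinite sets, so \<open>card J \<noteq> 1\<close> says that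
  \<open>J\<close> has rank at least \<open>2\<close>, possibly infinite.\<close>

definition no_rank_one_factors :: "('w, 'm) monoid_scheme \<Rightarrow> 'w set \<Rightarrow> bool" where
  "no_rank_one_factors W S \<longleftrightarrow> (\<forall>J\<in>irreducible_components W S. card J \<noteq> 1)"

definition GL :: "('k::field ^ 'n ^ 'n) monoid" where
  "GL = \<lparr>carrier = {A. invertible A}, mult = (**), one = mat 1\<rparr>"

lemma group_GL: "group (GL :: ('k::field ^ 'n ^ 'n) monoid)"
proof (rule groupI)
  fix A :: "'k ^ 'n ^ 'n" assume "A \<in> carrier GL"
  then obtain A' where "A ** A' = mat 1" "A' ** A = mat 1"
    by (auto simp: GL_def invertible_def)
  then show "\<exists>y\<in>carrier GL. y \<otimes>\<^bsub>GL\<^esub> A = \<one>\<^bsub>GL\<^esub>"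
    by (auto simp: GL_def invertible_def)
qed (auto simp: GL_def invertible_mult matrix_mul_assoc invertible_def[of "mat 1"])

inductive_set polynomial_maps :: "('k::field ^ 'n ^ 'n \<Rightarrow> 'k) set" where
  const: "(\<lambda>_. c) \<in> polynomial_maps"
| entry: "(\<lambda>A. A $ i $ j) \<in> polynomial_maps"
| add: "p \<in> polynomial_maps \<Longrightarrow> q \<in> polynomial_maps \<Longrightarrow> (\<lambda>A. p A + q A) \<in> polynomial_maps"
| mult: "p \<in> polynomial_maps \<Longrightarrow> q \<in> polynomial_maps \<Longrightarrow> (\<lambda>A. p A * q A) \<in> polynomial_maps"

definition zero_locus :: "('k::field ^ 'n ^ 'n \<Rightarrow> 'k) set \<Rightarrow> ('k ^ 'n ^ 'n) set" where
  "zero_locus P = {A. \<forall>p\<in>P. p A = 0}"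

definition zariski :: "('k::field ^ 'n ^ 'n) topology" where
  "zariski = topology (\<lambda>V. \<exists>P\<subseteq>polynomial_maps. - V = zero_locus P)"

lemma openin_zariski:
  fixes V :: "('k::field ^ 'n ^ 'n) set"
  shows "openin zariski V \<longleftrightarrow> (\<exists>P\<subseteq>polynomial_maps. - V = zero_locus P)"
proof -
  have "istopology (\<lambda>V::('k ^ 'n ^ 'n) set. \<exists>P\<subseteq>polynomial_maps. - V = zero_locus P)"
    unfolding istopology_def
  proof (intro conjI allI impI)
    fix V V' :: "('k ^ 'n ^ 'n) set"
    assume "\<exists>P\<subseteq>polynomial_maps. - V = zero_locus P" "\<exists>P\<subseteq>polynomial_maps. - V' = zero_locus P"
    then obtain P Q where PQ: "P \<subseteq> polynomial_maps" "- V = zero_locus P"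
      "Q \<subseteq> polynomial_maps" "- V' = zero_locus Q" by blast
    let ?R = "{\<lambda>A. p A * q A | p q. p \<in> P \<and> q \<in> Q}"
    have "?R \<subseteq> polynomial_maps"
      using PQ by (auto intro!: polynomial_maps.mult)
    moreover have "zero_locus ?R = zero_locus P \<union> zero_locus Q"
      unfolding zero_locus_def by (auto, metis mult_eq_0_iff)
    then have "- (V \<inter> V') = zero_locus ?R"
      using PQ by (simp add: Compl_Int)
    ultimately show "\<exists>P\<subseteq>polynomial_maps. - (V \<inter> V') = zero_locus P" by blast
  next
    fix \<K> :: "('k ^ 'n ^ 'n) set set"
    assume "\<forall>V\<in>\<K>. \<exists>P\<subseteq>polynomial_maps. - V = zero_locus P"
    then obtain P where P: "\<And>V. V \<in> \<K> \<Longrightarrow> P V \<subseteq> polynomial_maps \<and> - V = zero_locus (P V)"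
      by metis
    have "- \<Union>\<K> = (\<Inter>V\<in>\<K>. - V)" by blast
    also have "\<dots> = (\<Inter>V\<in>\<K>. zero_locus (P V))" using P by auto
    also have "\<dots> = zero_locus (\<Union>V\<in>\<K>. P V)" by (auto simp: zero_locus_def)
    finally have "- \<Union>\<K> = zero_locus (\<Union>V\<in>\<K>. P V)" .
    moreover have "(\<Union>V\<in>\<K>. P V) \<subseteq> polynomial_maps" using P by blast
    ultimately show "\<exists>P\<subseteq>polynomial_maps. - \<Union>\<K> = zero_locus P" by blast
  qed
  then show ?thesis
    by (simp add: zariski_def)
qed

lemma topspace_zariski [simp]: "topspace zariski = UNIV"
proof -
  have "openin zariski (UNIV :: ('k::field ^ 'n ^ 'n) set)"
    unfolding openin_zariski
    by (rule exI[of _ "{\<lambda>_. 1}"]) (auto simp: zero_locus_def intro: polynomial_maps.const)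
  then show ?thesis
    using openin_subset by blast
qed

lemma closedin_zariski: "closedin zariski C \<longleftrightarrow> (\<exists>P\<subseteq>polynomial_maps. C = zero_locus P)"
  by (simp add: closedin_def openin_zariski Compl_eq_Diff_UNIV[symmetric])

definition linear_algebraic_group :: "('k::field ^ 'n ^ 'n) set \<Rightarrow> bool" where
  "linear_algebraic_group G \<longleftrightarrow>
     subgroup G GL \<and> closedin (subtopology zariski (carrier GL)) G"

text \<open>Iterated matrix multiplication is spelled out because \<open>^\<close> on \<open>'k ^ 'n ^ 'n\<close> is the entrywise
  power.\<close>

definition unipotent :: "'k::field ^ 'n ^ 'n \<Rightarrow> bool" where
  "unipotent A \<longleftrightarrow> (\<exists>m. (((**) (A - mat 1)) ^^ m) (mat 1) = 0)"

text \<open>A linear algebraic group is reductive if it is connected and its unipotent radical, i.e. its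
  largest closed connected normal unipotent subgroup, is trivial.\<close>

definition reductive_group :: "('k::alg_closed_field ^ 'n ^ 'n) set \<Rightarrow> bool" where
  "reductive_group G \<longleftrightarrow>
     linear_algebraic_group G \<and> connectedin zariski G \<and>
     (\<forall>R. linear_algebraic_group R \<and> connectedin zariski R \<and> R \<lhd> GL\<lparr>carrier := G\<rparr> \<and>
          (\<forall>A\<in>R. unipotent A) \<longrightarrow> R = {mat 1})"

definition zariski_dense :: "('k::field ^ 'n ^ 'n) set \<Rightarrow> ('k ^ 'n ^ 'n) set \<Rightarrow> bool" where
  "zariski_dense G H \<longleftrightarrow> subtopology zariski G closure_of H = G"

end

theory Submission
  imports Defs "HOL-Library.Function_Algebras"
begin

text \<open>Polynomials on \<open>H\<close> form an integral domain, because \<open>G\<close> is connected. A linear group without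
  unipotents has the property that the normalizer of an abelian subgroup \<open>A\<close> centralizes \<open>A\<close> up to
  finite index: it permutes the finitely many weights of \<open>A\<close>, and an element of \<open>A\<close> on which all
  weights are trivial is unipotent. It follows that \<open>U\<close> has an abelian subgroup \<open>V\<close> of finite index,
  normal in \<open>B\<close>, and \<open>T\<close> a subgroup \<open>T0\<close> of finite index, normal in \<open>N\<close> and centralizing \<open>V\<close>. By the
  Bruhat decomposition \<open>H\<close> is a finite union of translates of sets \<open>V T0 w V\<close>, so one of these is
  dense. This forces the simple subquotients of the part of the adjoint representation fixed by
  \<open>T0\<close> to be one-dimensional, and \<open>V\<close> is contained in that part. Hence some term of the derived series
  of \<open>H\<close> centralizes \<open>V\<close>, and the absence of unipotents makes \<open>V\<close> central. Then
  \<open>V \<subseteq> U \<inter> T = 1\<close>, so \<open>U\<close> is finite, \<open>T0\<close> is dense, \<open>U\<close> is central and thus trivial, and \<open>B = T\<close>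
  is normalized by \<open>N\<close>, against (BN2) unless \<open>S\<close> is empty.\<close>

section \<open>Common eigenvectors and eigenfunctionals\<close>

text \<open>An element whose centralizer has finite index in \<open>H\<close> is central, because
  centralizers are Zariski-closed and \<open>H\<close> is irreducible. Finite index in
  \<open>B\<close>, \<open>U\<close> or \<open>T\<close> allows no such conclusion, as these may be
  disconnected; hence the passage to \<open>V\<close> and \<open>T0\<close>. The point of
  \<open>T0\<close> being normalized by \<open>N\<close> and centralizing \<open>V\<close> is that
  every g in the cell V T0 w V satisfies t g = g s with s in \<open>T0\<close>. So \<open>T0\<close>
  acts trivially on an H-stable subspace containing \<open>V\<close>, where a cell element acts like
  v w v' with v, v' from a commutative group. A matrix coefficient between a weight vector and a
  weight functional is then constant on the cell up to characters, and multiplying by a suitable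
  coefficient at the inverse cancels the characters. One-dimensional subquotients make
  \<open>H\<close> act through a solvable group, which is where the derived series comes from.
  Density is used through polynomial identities, so inverses enter as adjugates, corrected by powers
  of the determinant. Quotient spaces are never formed: eigenvectors, functionals and scalars are
  taken modulo a subspace \<open>L\<close>.\<close>

locale alg_closed_vector_space = finite_dimensional_vector_space scale Basis
  for scale :: "'a::alg_closed_field \<Rightarrow> 'b::ab_group_add \<Rightarrow> 'b" (infixr "*\<^sub>k" 75)
    and Basis :: "'b set"
begin

abbreviation lin :: "('b \<Rightarrow> 'b) \<Rightarrow> bool" where
  "lin \<equiv> Vector_Spaces.linear scale scale"

lemma linD:
  assumes "lin f"
  shows "f (x + y) = f x + f y" "f (x - y) = f x - f y" "f (c *\<^sub>k x) = c *\<^sub>k f x" "f 0 = 0"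
proof -
  interpret f: Vector_Spaces.linear scale scale f by fact
  show "f (x + y) = f x + f y" "f (x - y) = f x - f y" "f (c *\<^sub>k x) = c *\<^sub>k f x" "f 0 = 0"
    by (simp_all add: f.add f.diff f.scale)
qed

lemma lin_sum: "lin f \<Longrightarrow> f (\<Sum>i\<in>I. g i) = (\<Sum>i\<in>I. f (g i))"
  by (induction I rule: infinite_finite_induct) (simp_all add: linD)

section \<open>Polynomials of an operator, evaluated at a vector\<close>

definition op_poly :: "('b \<Rightarrow> 'b) \<Rightarrow> 'a poly \<Rightarrow> 'b \<Rightarrow> 'b" where
  "op_poly f p y = (\<Sum>i\<le>Polynomial.degree p. Polynomial.coeff p i *\<^sub>k (f ^^ i) y)"

lemma op_poly_bound: "Polynomial.degree p \<le> m \<Longrightarrow> op_poly f p y = (\<Sum>i\<le>m. Polynomial.coeff p i *\<^sub>k (f ^^ i) y)"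
  unfolding op_poly_def by (intro sum.mono_neutral_left) (auto simp: coeff_eq_0)

lemma op_poly_add: "op_poly f (p + q) y = op_poly f p y + op_poly f q y"
proof -
  define m where "m = max (Polynomial.degree p) (Polynomial.degree q)"
  have "Polynomial.degree p \<le> m" "Polynomial.degree q \<le> m" "Polynomial.degree (p + q) \<le> m"
    by (auto simp: m_def degree_add_le)
  then show ?thesis
    by (simp add: op_poly_bound[of _ m] sum.distrib scale_left_distrib)
qed

lemma op_poly_smult: "op_poly f (Polynomial.smult c p) y = c *\<^sub>k op_poly f p y"
  by (cases "c = 0") (simp_all add: op_poly_def scale_sum_right)

lemma op_poly_pCons: "op_poly f (pCons a p) y = a *\<^sub>k y + op_poly f p (f y)"
proof -
  have "op_poly f (pCons a p) y = (\<Sum>i\<le>Suc (Polynomial.degree p). Polynomial.coeff (pCons a p) i *\<^sub>k (f ^^ i) y)"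
    by (rule op_poly_bound) simp
  also have "\<dots> = a *\<^sub>k y + op_poly f p (f y)"
    by (simp add: sum.atMost_Suc_shift op_poly_def funpow_swap1 del: sum.atMost_Suc)
  finally show ?thesis .
qed

lemma op_poly_apply: "lin f \<Longrightarrow> f (op_poly f p y) = op_poly f p (f y)"
  by (simp add: op_poly_def lin_sum linD funpow_swap1)

lemma op_poly_linear_factor:
  "lin f \<Longrightarrow> op_poly f ([:- c, 1:] * q) y = f (op_poly f q y) - c *\<^sub>k op_poly f q y"
proof -
  assume f: "lin f"
  have "[:- c, 1:] * q = Polynomial.smult (- c) q + pCons 0 q" by simp
  then show ?thesis
    by (simp only: op_poly_add op_poly_smult op_poly_pCons op_poly_apply[OF f] scale_minus_left) simp
qed

lemma op_poly_in_subspace: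
  assumes "subspace L" "f ` L \<subseteq> L" "y \<in> L"
  shows "op_poly f p y \<in> L"
proof -
  have "(f ^^ i) y \<in> L" for i
    by (induction i) (use assms in auto)
  then show ?thesis
    unfolding op_poly_def using assms(1) by (intro subspace_sum subspace_scale) auto
qed

text \<open>The \<open>dimension\<close> + 1 first iterates of \<open>y\<close> cannot be
  independent. Dependence is a property of sets, so a repetition among the iterates is a separate
  case, with annihilator X^j - X^i.\<close>

lemma op_poly_annihilator: "\<exists>p. p \<noteq> 0 \<and> op_poly f p y = 0"
proof -
  define g where "g i = (f ^^ i) y" for i
  show ?thesis
  proof (cases "inj_on g {..dimension}")
    case True
    then have "card (g ` {..dimension}) = Suc dimension" by (simp add: card_image)
    then have "dependent (g ` {..dimension})"
      using independent_bound_general[of "g ` {..dimension}"] dim_subset_UNIV[of "g ` {..dimension}"]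
      by (metis Suc_n_not_le_n order_trans)
    then obtain u v where uv: "v \<in> g ` {..dimension}" "u v \<noteq> 0" "(\<Sum>v\<in>g ` {..dimension}. u v *\<^sub>k v) = 0"
      by (auto simp: dependent_finite)
    then obtain j where j: "j \<le> dimension" "v = g j" by auto
    define p where "p = (\<Sum>i\<le>dimension. Polynomial.monom (u (g i)) i)"
    have cp: "Polynomial.coeff p i = (if i \<le> dimension then u (g i) else 0)" for i
      unfolding p_def by (simp add: coeff_sum)
    have "Polynomial.degree p \<le> dimension"
      by (rule degree_le) (simp add: cp)
    then have "op_poly f p y = (\<Sum>i\<le>dimension. u (g i) *\<^sub>k g i)"
      by (subst op_poly_bound[of _ dimension]) (auto simp: cp g_def)
    also have "\<dots> = 0"
      using uv(3) by (simp add: sum.reindex[OF True])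
    finally have "op_poly f p y = 0" .
    moreover have "p \<noteq> 0"
      using cp[of j] j uv(2) by auto
    ultimately show ?thesis by blast
  next
    case False
    then obtain i j where ij: "i < j" "g i = g j"
      unfolding inj_on_def by (metis linorder_neqE_nat)
    define p where "p = Polynomial.monom 1 j + Polynomial.smult (-1) (Polynomial.monom (1::'a) i)"
    have mon: "op_poly f (Polynomial.monom 1 k) y = g k" for k
    proof -
      have "op_poly f (Polynomial.monom 1 k) y = (\<Sum>i\<le>k. Polynomial.coeff (Polynomial.monom 1 k) i *\<^sub>k (f ^^ i) y)"
        by (rule op_poly_bound) (simp add: degree_monom_eq)
      also have "\<dots> = (\<Sum>i\<le>k. if i = k then g k else 0)"
        by (intro sum.cong) (auto simp: g_def)
      finally show ?thesis by simp
    qed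
    have "op_poly f p y = 0"
      unfolding p_def op_poly_add op_poly_smult mon using ij by simp
    moreover have "Polynomial.coeff p j \<noteq> 0"
      unfolding p_def using ij by simp
    ultimately show ?thesis by (metis coeff_0)
  qed
qed

text \<open>\<open>p\<close> is a minimal polynomial of \<open>y\<close> modulo \<open>L\<close>.
  Its degree is positive because a nonzero constant would put \<open>y\<close> into
  \<open>L\<close>.\<close>

lemma minimal_op_poly:
  assumes "subspace L" "y \<notin> L"
  obtains p where "p \<noteq> 0" "op_poly f p y \<in> L" "0 < Polynomial.degree p"
    "\<And>q. q \<noteq> 0 \<Longrightarrow> Polynomial.degree q < Polynomial.degree p \<Longrightarrow> op_poly f q y \<notin> L"
proof -
  let ?P = "\<lambda>p. p \<noteq> 0 \<and> op_poly f p y \<in> L"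
  have ex: "\<exists>p. ?P p"
    using op_poly_annihilator[of f y] subspace_0[OF assms(1)] by metis
  define p where "p = arg_min Polynomial.degree ?P"
  have p: "?P p" "\<And>q. ?P q \<Longrightarrow> Polynomial.degree p \<le> Polynomial.degree q"
    using arg_min_nat_lemma[of ?P _ Polynomial.degree] ex unfolding p_def by blast+
  have "0 < Polynomial.degree p"
  proof (rule ccontr)
    assume "\<not> 0 < Polynomial.degree p"
    then obtain c where c: "p = [:c:]" using degree_eq_zeroE by blast
    then have "c \<noteq> 0" "c *\<^sub>k y \<in> L" using p(1) by (auto simp: op_poly_def)
    then have "inverse c *\<^sub>k c *\<^sub>k y \<in> L" using subspace_scale[OF assms(1)] by blast
    with \<open>c \<noteq> 0\<close> assms(2) show False by simp
  qed
  with p that[of p] show thesis by (metis not_le)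
qed

text \<open>Split a root c off the minimal polynomial of \<open>y\<close> modulo \<open>L\<close>.
  The cofactor q has smaller degree, so q(f) y stays outside \<open>L\<close>, while f - c sends it
  into \<open>L\<close>.\<close>

lemma eigenvector_mod:
  assumes "lin f" "subspace L" "subspace M" "f ` M \<subseteq> M" "y \<in> M" "y \<notin> L"
  obtains c z where "z \<in> M" "z \<notin> L" "f z - c *\<^sub>k z \<in> L"
proof -
  obtain p where p: "p \<noteq> 0" "op_poly f p y \<in> L" "0 < Polynomial.degree p"
    "\<And>q. q \<noteq> 0 \<Longrightarrow> Polynomial.degree q < Polynomial.degree p \<Longrightarrow> op_poly f q y \<notin> L"
    using minimal_op_poly[OF assms(2,6)] by metis
  obtain c where "poly p c = 0" using alg_closed_imp_poly_has_root[OF p(3)] by blast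
  then obtain q where q: "p = [:- c, 1:] * q" by (auto simp: poly_eq_0_iff_dvd)
  then have "q \<noteq> 0" using p(1) by auto
  then have "Polynomial.degree q < Polynomial.degree p" unfolding q by (subst degree_mult_eq) auto
  then have "op_poly f q y \<notin> L" using p(4) \<open>q \<noteq> 0\<close> by blast
  moreover have "f (op_poly f q y) - c *\<^sub>k op_poly f q y \<in> L"
    using p(2) unfolding q by (simp only: op_poly_linear_factor[OF assms(1)])
  moreover have "op_poly f q y \<in> M"
    using op_poly_in_subspace assms(3-5) by blast
  ultimately show thesis using that by blast
qed

text \<open>Write the minimal polynomial of \<open>y\<close> modulo \<open>L\<close> as a + X q. By
  minimality q(f) y is outside \<open>L\<close>, by injectivity so is its image under
  \<open>f\<close>, which forces a to be nonzero; then \<open>y\<close> is a combination of elements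
  of \<open>L\<close> and of f(M). This replaces surjectivity of injective endomorphisms of
  M/L.\<close>

lemma injective_mod_imp_surjective_mod:
  assumes f: "lin f" and L: "subspace L" "f ` M \<subseteq> M" "subspace M"
    and inj: "\<And>y. y \<in> M \<Longrightarrow> f y \<in> L \<Longrightarrow> y \<in> L"
    and K: "subspace K" "L \<subseteq> K" "f ` M \<subseteq> K"
  shows "M \<subseteq> K"
proof
  fix y assume y: "y \<in> M"
  show "y \<in> K"
  proof (rule ccontr)
    assume yK: "y \<notin> K"
    then have "y \<notin> L" using K by blast
    from minimal_op_poly[OF L(1) this, of f] obtain p where p: "p \<noteq> 0" "op_poly f p y \<in> L" "0 < Polynomial.degree p"
      "\<And>q. q \<noteq> 0 \<Longrightarrow> Polynomial.degree q < Polynomial.degree p \<Longrightarrow> op_poly f q y \<notin> L" by metis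
    obtain a q where q: "p = pCons a q" by (cases p)
    with p have q0: "q \<noteq> 0" "Polynomial.degree q < Polynomial.degree p" by auto
    let ?z = "op_poly f q y"
    have z: "?z \<in> M" using op_poly_in_subspace L y by blast
    have e: "op_poly f p y = a *\<^sub>k y + f ?z"
      unfolding q by (simp add: op_poly_pCons op_poly_apply[OF f])
    have "f ?z \<notin> L" using inj[OF z] p(4)[OF q0] by blast
    then have "a \<noteq> 0" using e p(2) by auto
    have "a *\<^sub>k y = op_poly f p y - f ?z" using e by simp
    also have "\<dots> \<in> K" using K p(2) z by (intro subspace_diff) auto
    finally have "inverse a *\<^sub>k a *\<^sub>k y \<in> K" using subspace_scale[OF K(1)] by blast
    with \<open>a \<noteq> 0\<close> yK show False by simp
  qed
qed

section \<open>Invariant subspaces of a commuting family of operators\<close>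

definition invariant_subspace :: "('b \<Rightarrow> 'b) set \<Rightarrow> 'b set \<Rightarrow> bool" where
  "invariant_subspace \<Phi> L \<longleftrightarrow> subspace L \<and> (\<forall>f\<in>\<Phi>. f ` L \<subseteq> L)"

lemma ex_minimal_subspace:
  assumes "P L" "\<And>L. P L \<Longrightarrow> subspace L"
  obtains M where "P M" "M \<subseteq> L" "\<And>K. P K \<Longrightarrow> K \<subseteq> M \<Longrightarrow> K = M"
proof -
  let ?P = "\<lambda>K. P K \<and> K \<subseteq> L"
  define M where "M = arg_min dim ?P"
  have M: "?P M" "\<And>K. ?P K \<Longrightarrow> dim M \<le> dim K"
    using arg_min_nat_lemma[of ?P L dim] assms(1) unfolding M_def by blast+
  have "K = M" if "P K" "K \<subseteq> M" for K
    using M that assms(2) by (intro subspace_dim_equal) auto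
  with M that show thesis by blast
qed

lemma ex_maximal_subspace:
  assumes "P L" "\<And>L. P L \<Longrightarrow> subspace L"
  obtains M where "P M" "L \<subseteq> M" "\<And>K. P K \<Longrightarrow> M \<subseteq> K \<Longrightarrow> K = M"
proof -
  let ?P = "\<lambda>K. P K \<and> L \<subseteq> K"
  \<comment> \<open>Codimension turns the search for the largest dimension into an
    \<open>arg_min\<close>.\<close>
  define M where "M = arg_min (\<lambda>K. dimension - dim K) ?P"
  have M: "?P M" "\<And>K. ?P K \<Longrightarrow> dimension - dim M \<le> dimension - dim K"
    using arg_min_nat_lemma[of ?P L "\<lambda>K. dimension - dim K"] assms(1) unfolding M_def by blast+
  have "K = M" if K: "P K" "M \<subseteq> K" for K
  proof -
    have "dimension - dim M \<le> dimension - dim K" using M(1) M(2)[of K] K by blast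
    then have "dim K \<le> dim M"
      using dim_subset_UNIV[of K] by linarith
    then show ?thesis
      using subspace_dim_equal[of M K] M(1) K assms(2) by metis
  qed
  with M that show thesis by blast
qed

context
  fixes \<Phi> :: "('b \<Rightarrow> 'b) set"
  assumes lin_ops: "\<And>f. f \<in> \<Phi> \<Longrightarrow> lin f"
    and commuting: "\<And>f g y. f \<in> \<Phi> \<Longrightarrow> g \<in> \<Phi> \<Longrightarrow> f (g y) = g (f y)"
begin

text \<open>Each operator of the family commutes with f - c and preserves \<open>L\<close> and
  \<open>M\<close>, hence also the preimage of \<open>L\<close> in \<open>M\<close> under f -
  c.\<close>

lemma invariant_eigenspace_mod:
  assumes "invariant_subspace \<Phi> L" "invariant_subspace \<Phi> M" "f \<in> \<Phi>"
  shows "invariant_subspace \<Phi> {y \<in> M. f y - c *\<^sub>k y \<in> L}"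
proof -
  have L: "subspace L" and M: "subspace M" using assms by (auto simp: invariant_subspace_def)
  note f = lin_ops[OF assms(3)]
  have "subspace {y \<in> M. f y - c *\<^sub>k y \<in> L}"
    unfolding subspace_def
  proof (intro conjI ballI allI)
    show "0 \<in> {y \<in> M. f y - c *\<^sub>k y \<in> L}"
      using L M by (simp add: linD[OF f] subspace_0)
    fix x assume x: "x \<in> {y \<in> M. f y - c *\<^sub>k y \<in> L}"
    have "a *\<^sub>k (f x - c *\<^sub>k x) \<in> L" for a using x subspace_scale[OF L] by blast
    then show "a *\<^sub>k x \<in> {y \<in> M. f y - c *\<^sub>k y \<in> L}" for a
      using x subspace_scale[OF M] by (simp add: linD[OF f] scale_right_diff_distrib mult.commute)
    fix y assume y: "y \<in> {y \<in> M. f y - c *\<^sub>k y \<in> L}"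
    have "f (x + y) - c *\<^sub>k (x + y) = (f x - c *\<^sub>k x) + (f y - c *\<^sub>k y)"
      by (simp add: linD[OF f] scale_right_distrib)
    also have "\<dots> \<in> L" using x y by (intro subspace_add[OF L]) auto
    finally show "x + y \<in> {y \<in> M. f y - c *\<^sub>k y \<in> L}"
      using x y subspace_add[OF M] by simp
  qed
  moreover have "g y \<in> {y \<in> M. f y - c *\<^sub>k y \<in> L}" if "g \<in> \<Phi>" "y \<in> M" "f y - c *\<^sub>k y \<in> L" for g y
  proof -
    have "f (g y) - c *\<^sub>k g y = g (f y - c *\<^sub>k y)"
      using commuting[OF assms(3) that(1)] by (simp add: linD[OF lin_ops[OF that(1)]])
    also have "\<dots> \<in> L" using assms(1) that by (auto simp: invariant_subspace_def)
    finally show ?thesis using assms(2) that by (auto simp: invariant_subspace_def)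
  qed
  ultimately show ?thesis unfolding invariant_subspace_def by auto
qed

text \<open>In a minimal invariant subspace M' properly above \<open>L\<close>, each operator has an
  eigenspace modulo \<open>L\<close> that is invariant and larger than \<open>L\<close>, hence all
  of M'. So any vector of M' outside \<open>L\<close> serves the whole family, which may be
  infinite.\<close>

lemma common_eigenvector_mod:
  assumes L: "invariant_subspace \<Phi> L" and M: "invariant_subspace \<Phi> M" and LM: "L \<subset> M"
  obtains x \<mu> where "x \<in> M" "x \<notin> L" "\<And>f. f \<in> \<Phi> \<Longrightarrow> f x - \<mu> f *\<^sub>k x \<in> L"
proof -
  let ?P = "\<lambda>K. invariant_subspace \<Phi> K \<and> L \<subset> K"
  obtain M' where M': "?P M'" "M' \<subseteq> M" "\<And>K. ?P K \<Longrightarrow> K \<subseteq> M' \<Longrightarrow> K = M'"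
    using ex_minimal_subspace[of ?P M] M LM by (metis (no_types, lifting) invariant_subspace_def)
  have "\<exists>c. \<forall>y\<in>M'. f y - c *\<^sub>k y \<in> L" if f: "f \<in> \<Phi>" for f
  proof -
    obtain y where y: "y \<in> M'" "y \<notin> L" using M'(1) by blast
    have "subspace L" "subspace M'" "f ` M' \<subseteq> M'"
      using f L M'(1) by (auto simp: invariant_subspace_def)
    with eigenvector_mod[OF lin_ops[OF f] _ _ _ y]
    obtain c z where z: "z \<in> M'" "z \<notin> L" "f z - c *\<^sub>k z \<in> L" by blast
    let ?E = "{y \<in> M'. f y - c *\<^sub>k y \<in> L}"
    have inv: "invariant_subspace \<Phi> ?E" using invariant_eigenspace_mod L M'(1) f by blast
    have "L \<subseteq> ?E"
    proof
      fix y assume "y \<in> L"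
      with L f M'(1) show "y \<in> ?E"
        unfolding invariant_subspace_def by (auto intro!: subspace_diff subspace_scale)
    qed
    then have "?E = M'" using M'(3)[of ?E] inv z by blast
    then show ?thesis by blast
  qed
  then obtain \<mu> where "\<And>f y. f \<in> \<Phi> \<Longrightarrow> y \<in> M' \<Longrightarrow> f y - \<mu> f *\<^sub>k y \<in> L" by metis
  moreover obtain x where "x \<in> M'" "x \<notin> L" using M'(1) by blast
  ultimately show thesis using that M'(2) by blast
qed

text \<open>The functional lives on the quotient by a maximal invariant subspace containing a maximal
  invariant subspace that avoids \<open>x\<close>; modulo the latter, \<open>x\<close> generates the socle.\<close>

lemma eigenfunctional_of_eigenvector:
  assumes L: "invariant_subspace \<Phi> L" and M: "invariant_subspace \<Phi> M"
    and x: "x \<in> M" "x \<notin> L" "\<And>f. f \<in> \<Phi> \<Longrightarrow> f x - \<mu> f *\<^sub>k x \<in> L" and LM: "L \<subseteq> M"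
  obtains \<phi> where "Vector_Spaces.linear scale (*) \<phi>" "\<And>y. y \<in> L \<Longrightarrow> \<phi> y = 0"
    "\<exists>y\<in>M. \<phi> y \<noteq> 0" "\<And>f y. f \<in> \<Phi> \<Longrightarrow> y \<in> M \<Longrightarrow> \<phi> (f y) = \<mu> f * \<phi> y"
proof -
  let ?P = "\<lambda>K. invariant_subspace \<Phi> K \<and> K \<subseteq> M \<and> L \<subseteq> K \<and> x \<notin> K"
  obtain K where K: "?P K" "\<And>K'. ?P K' \<Longrightarrow> K \<subseteq> K' \<Longrightarrow> K' = K"
    using ex_maximal_subspace[of ?P L] L x LM
    by (metis (no_types, lifting) invariant_subspace_def order_refl)
  let ?Q = "\<lambda>K. invariant_subspace \<Phi> K \<and> K \<subset> M"
  have "?Q K" using K x by blast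
  then obtain K2 where K2: "?Q K2" "K \<subseteq> K2" "\<And>K'. ?Q K' \<Longrightarrow> K2 \<subseteq> K' \<Longrightarrow> K' = K2"
    using ex_maximal_subspace[of ?Q K] by (metis (no_types, lifting) invariant_subspace_def)
  have sub: "subspace L" "subspace M" "subspace K" "subspace K2"
    using L M K(1) K2(1) by (auto simp: invariant_subspace_def)
  \<comment> \<open>By maximality of \<open>K2\<close> each \<open>f\<close> is a scalar c on M/K2,
    and c must be \<open>\<mu> f\<close>: otherwise f - c does not send \<open>x\<close> into
    \<open>K\<close>, so maximality of \<open>K\<close> makes it injective on M/K and hence
    surjective, although its image lies in \<open>K2\<close>.\<close>
  have eig: "f y - \<mu> f *\<^sub>k y \<in> K2" if f: "f \<in> \<Phi>" and y: "y \<in> M" for f y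
  proof -
    obtain y0 where y0: "y0 \<in> M" "y0 \<notin> K2" using K2(1) by blast
    have "f ` M \<subseteq> M" using f M by (auto simp: invariant_subspace_def)
    with eigenvector_mod[OF lin_ops[OF f] sub(4,2) _ y0]
    obtain c z where z: "z \<in> M" "z \<notin> K2" "f z - c *\<^sub>k z \<in> K2" by blast
    let ?E = "{y \<in> M. f y - c *\<^sub>k y \<in> K2}"
    have inv: "invariant_subspace \<Phi> ?E" using invariant_eigenspace_mod K2(1) M f by blast
    have "K2 \<subseteq> ?E"
    proof
      fix y assume "y \<in> K2"
      with K2(1) f show "y \<in> ?E"
        unfolding invariant_subspace_def by (auto intro!: subspace_diff subspace_scale)
    qed
    then have "?E = M" using K2(3)[of ?E] inv z by blast
    then have all: "f y - c *\<^sub>k y \<in> K2" if "y \<in> M" for y using that by blast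
    have "c = \<mu> f"
    proof (rule ccontr)
      assume neq: "c \<noteq> \<mu> f"
      let ?F = "{y \<in> M. f y - c *\<^sub>k y \<in> K}"
      have invF: "invariant_subspace \<Phi> ?F" using invariant_eigenspace_mod K(1) M f by blast
      have KF: "K \<subseteq> ?F"
      proof
        fix y assume "y \<in> K"
        with K(1) f show "y \<in> ?F"
          unfolding invariant_subspace_def by (auto intro!: subspace_diff subspace_scale)
      qed
      have "x \<notin> ?F"
      proof
        assume "x \<in> ?F"
        moreover have "f x - \<mu> f *\<^sub>k x \<in> K" using x(3)[OF f] K(1) by blast
        ultimately have "(f x - c *\<^sub>k x) - (f x - \<mu> f *\<^sub>k x) \<in> K" using subspace_diff[OF sub(3)] by blast
        then have "(\<mu> f - c) *\<^sub>k x \<in> K" by (simp add: scale_left_diff_distrib)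
        then have "inverse (\<mu> f - c) *\<^sub>k (\<mu> f - c) *\<^sub>k x \<in> K" using subspace_scale[OF sub(3)] by blast
        with neq K(1) show False by simp
      qed
      then have FK: "?F = K" using K(2)[of ?F] invF KF K(1) by blast
      have "M \<subseteq> K2"
      proof (rule injective_mod_imp_surjective_mod[of "\<lambda>y. f y - c *\<^sub>k y" K])
        show "lin (\<lambda>y. f y - c *\<^sub>k y)"
          unfolding Vector_Spaces.linear_iff
          using linD[OF lin_ops[OF f]] vector_space_axioms
          by (simp add: scale_right_distrib scale_right_diff_distrib mult.commute)
        show "(\<lambda>y. f y - c *\<^sub>k y) ` M \<subseteq> M"
          using M f sub by (auto simp: invariant_subspace_def intro!: subspace_diff subspace_scale)
        show "y \<in> K" if "y \<in> M" "f y - c *\<^sub>k y \<in> K" for y using FK that by blast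
      qed (use sub K2 all in auto)
      with K2(1) show False by blast
    qed
    with all y show ?thesis by blast
  qed
  obtain x0 where x0: "x0 \<in> M" "x0 \<notin> K2" using K2(1) by blast
  have M_eq: "M = {c *\<^sub>k x0 + k | c k. k \<in> K2}" (is "M = ?R")
  proof -
    have R: "?R = {x + y |x y. x \<in> span {x0} \<and> y \<in> K2}"
      by (auto simp: span_singleton)
    have R_sub: "subspace ?R"
      unfolding R by (rule subspace_sums) (auto simp: sub)
    have RM: "?R \<subseteq> M"
      using x0 K2(1) sub by (auto intro!: subspace_add subspace_scale)
    have R_inv: "f ` ?R \<subseteq> ?R" if f: "f \<in> \<Phi>" for f
    proof clarify
      fix c k assume k: "k \<in> K2"
      have "f (c *\<^sub>k x0 + k) = (c * \<mu> f) *\<^sub>k x0 + (c *\<^sub>k (f x0 - \<mu> f *\<^sub>k x0) + f k)"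
        by (simp add: linD[OF lin_ops[OF f]] scale_right_diff_distrib)
      moreover have "c *\<^sub>k (f x0 - \<mu> f *\<^sub>k x0) + f k \<in> K2"
        using eig[OF f x0(1)] k K2(1) f sub(4)
        by (intro subspace_add subspace_scale) (auto simp: invariant_subspace_def)
      ultimately show "\<exists>d l. f (c *\<^sub>k x0 + k) = d *\<^sub>k x0 + l \<and> l \<in> K2" by blast
    qed
    have K2R: "K2 \<subseteq> ?R"
    proof
      fix k assume "k \<in> K2"
      then have "k = 0 *\<^sub>k x0 + k \<and> k \<in> K2" by simp
      then show "k \<in> ?R" by blast
    qed
    have x0R: "x0 \<in> ?R"
    proof -
      have "x0 = 1 *\<^sub>k x0 + 0 \<and> 0 \<in> K2" by (simp add: subspace_0 sub)
      then show ?thesis by blast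
    qed
    have "invariant_subspace \<Phi> ?R"
      using R_sub R_inv by (simp only: invariant_subspace_def) blast
    then have "?R \<subset> M \<Longrightarrow> ?R = K2" using K2(3)[of ?R] K2R by blast
    with x0R x0(2) have "\<not> ?R \<subset> M" by (metis (no_types, lifting))
    with RM show ?thesis by blast
  qed
  obtain Bs where Bs: "Bs \<subseteq> K2" "independent Bs" "K2 \<subseteq> span Bs"
    using basis_exists[of K2] by metis
  have "span Bs = K2" using Bs sub by (simp add: span_subspace)
  then have "x0 \<notin> span Bs" using x0(2) by simp
  then have ind: "independent (insert x0 Bs)" using Bs(2) by (rule independent_insertI)
  interpret fn: vector_space_pair scale "(*) :: 'a \<Rightarrow> 'a \<Rightarrow> 'a"
    by unfold_locales (auto simp: algebra_simps)
  obtain \<phi> where \<phi>: "Vector_Spaces.linear scale (*) \<phi>" "\<And>y. y \<in> insert x0 Bs \<Longrightarrow> \<phi> y = (if y = x0 then 1 else 0)"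
    using fn.linear_independent_extend[OF ind, of "\<lambda>y. if y = x0 then 1 else 0"] by blast
  interpret \<phi>: Vector_Spaces.linear scale "(*)" \<phi> by (rule \<phi>(1))
  have "x0 \<notin> Bs" using Bs(1) x0(2) by blast
  have \<phi>K2: "\<phi> y = 0" if "y \<in> K2" for y
  proof -
    have "y \<in> span Bs" using that Bs(3) by blast
    then show ?thesis
      by (rule fn.linear_eq_0_on_span[OF \<phi>(1), rotated]) (use \<phi>(2) \<open>x0 \<notin> Bs\<close> in auto)
  qed
  show thesis
  proof (rule that[OF \<phi>(1)])
    show "\<phi> y = 0" if "y \<in> L" for y using that \<phi>K2 K(1) K2(2) by blast
    show "\<exists>y\<in>M. \<phi> y \<noteq> 0" using \<phi>(2)[of x0] x0 by (intro bexI[of _ x0]) auto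
    show "\<phi> (f y) = \<mu> f * \<phi> y" if "f \<in> \<Phi>" "y \<in> M" for f y
      using \<phi>K2[OF eig[OF that]] by (simp add: \<phi>.diff \<phi>.scale)
  qed
qed

end

end

section \<open>Irreducibility of connected groups\<close>

interpretation fun_space: vector_space "\<lambda>c (f :: 'x \<Rightarrow> 'k::field). (\<lambda>x. c * f x)"
  by unfold_locales (auto simp: fun_eq_iff algebra_simps)

text \<open>For spaces of functions, \<open>dim\<close> is a \<open>card\<close> and would be 0 on
  an infinite basis. Containment in a finite span excludes that, so that dimensions can be compared
  as usual.\<close>

lemma (in vector_space) independent_card_le_dim_finite_span:
  assumes "S \<subseteq> span t" "finite t" "B \<subseteq> S" "independent B"
  shows "finite B \<and> card B \<le> dim S"
proof -
  obtain C where C: "C \<subseteq> S" "independent C" "S \<subseteq> span C" "card C = dim S"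
    by (rule basis_exists)
  have "finite C" using independent_span_bound[OF assms(2) C(2)] C(1) assms(1) by blast
  from independent_span_bound[OF this assms(4)] C assms(3) show ?thesis by auto
qed

lemma (in vector_space) subspace_eq_of_dim_finite_span:
  assumes "subspace S" "S \<subseteq> T" "T \<subseteq> span t" "finite t" "dim T \<le> dim S"
  shows "S = T"
proof (rule ccontr)
  assume "S \<noteq> T"
  then obtain f where f: "f \<in> T" "f \<notin> S" using assms(2) by blast
  obtain B where B: "B \<subseteq> S" "independent B" "S \<subseteq> span B" "card B = dim S"
    by (rule basis_exists)
  have "span B = S" using B assms(1) by (simp add: span_subspace)
  then have "f \<notin> span B" using f by simp
  then have "independent (insert f B)" by (rule independent_insertI) (rule B)
  moreover have "insert f B \<subseteq> T" using B(1) f(1) assms(2) by blast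
  ultimately have fin: "finite (insert f B) \<and> card (insert f B) \<le> dim T"
    by (intro independent_card_le_dim_finite_span[OF assms(3,4)])
  have "f \<notin> B" using f B by blast
  then have "card (insert f B) = Suc (card B)" using fin by (intro card_insert_disjoint) simp_all
  with fin have "Suc (card B) \<le> dim T" by linarith
  with assms(5) B(4) show False by linarith
qed

section \<open>Polynomial functions on matrices and their translates\<close>

lemma polynomial_maps_sum:
  "(\<And>i. i \<in> I \<Longrightarrow> p i \<in> polynomial_maps) \<Longrightarrow> (\<lambda>A. \<Sum>i\<in>I. p i A) \<in> polynomial_maps"
  by (induction I rule: infinite_finite_induct) (auto intro: polynomial_maps.intros)

lemma polynomial_maps_prod:
  "(\<And>i. i \<in> I \<Longrightarrow> p i \<in> polynomial_maps) \<Longrightarrow> (\<lambda>A. \<Prod>i\<in>I. p i A) \<in> polynomial_maps"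
  by (induction I rule: infinite_finite_induct) (auto intro: polynomial_maps.intros)

lemma polynomial_maps_scale: "p \<in> polynomial_maps \<Longrightarrow> (\<lambda>A. c * p A) \<in> polynomial_maps"
  by (intro polynomial_maps.intros)

lemma polynomial_maps_diff:
  "p \<in> polynomial_maps \<Longrightarrow> q \<in> polynomial_maps \<Longrightarrow> (\<lambda>A. p A - q A) \<in> polynomial_maps"
  using polynomial_maps.add[of p "\<lambda>A. (-1) * q A"] polynomial_maps_scale[of q "-1"] by simp

lemma polynomial_maps_translate:
  fixes p :: "'k::field ^ 'n ^ 'n \<Rightarrow> 'k" and a b :: "'k ^ 'n ^ 'n"
  shows "p \<in> polynomial_maps \<Longrightarrow> (\<lambda>A :: 'k ^ 'n ^ 'n. p (a ** A ** b)) \<in> polynomial_maps"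
proof (induction rule: polynomial_maps.induct)
  case (entry i j)
  have "(\<lambda>A. \<Sum>l\<in>UNIV. (\<Sum>k\<in>UNIV. a $ i $ k * A $ k $ l) * b $ l $ j) \<in> polynomial_maps"
    by (intro polynomial_maps_sum polynomial_maps.intros)
  then show ?case by (simp add: matrix_matrix_mult_def)
qed (auto intro: polynomial_maps.intros)

lemma span_mult_span:
  fixes f g :: "'x \<Rightarrow> 'k::field"
  assumes "f \<in> fun_space.span s" "g \<in> fun_space.span t"
  shows "(\<lambda>x. f x * g x) \<in> fun_space.span ((\<lambda>(f, g) x. f x * g x) ` (s \<times> t))" (is "_ \<in> ?S")
proof -
  have 1: "(\<lambda>x. f x * g x) \<in> ?S" if "f \<in> s" "g \<in> fun_space.span t" for f g
    using that(2)
  proof (induction rule: fun_space.span_induct_alt)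
    case base
    then show ?case using fun_space.span_zero by (simp add: zero_fun_def)
  next
    case (step c h y)
    have "(\<lambda>x. c * (f x * h x)) \<in> ?S"
      using that(1) step(1) by (intro fun_space.span_scale fun_space.span_base) force
    from fun_space.span_add[OF this step(2)] show ?case
      by (simp add: algebra_simps plus_fun_def)
  qed
  show ?thesis
    using assms(1)
  proof (induction rule: fun_space.span_induct_alt)
    case base
    then show ?case using fun_space.span_zero by (simp add: zero_fun_def)
  next
    case (step c h y)
    have "(\<lambda>x. c * (h x * g x)) \<in> ?S"
      using 1[OF step(1) assms(2)] by (intro fun_space.span_scale)
    from fun_space.span_add[OF this step(2)] show ?case
      by (simp add: algebra_simps plus_fun_def)
  qed
qed

lemma sum_fun_app: "(\<Sum>i\<in>I. f i) x = (\<Sum>i\<in>I. f i x)"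
  for f :: "'i \<Rightarrow> 'x \<Rightarrow> 'k::comm_monoid_add"
  by (induction I rule: infinite_finite_induct) simp_all

text \<open>Local finiteness of the regular representation: a left translate of a matrix entry is a
  combination of the entries of the same column, and the property passes to sums and, through
  products of spanning sets, to products.\<close>

lemma translates_finite_span:
  fixes p :: "'k::field ^ 'n ^ 'n \<Rightarrow> 'k"
  shows "p \<in> polynomial_maps \<Longrightarrow>
    \<exists>t. finite t \<and> (\<forall>a :: 'k ^ 'n ^ 'n. (\<lambda>A :: 'k ^ 'n ^ 'n. p (a ** A)) \<in> fun_space.span t)"
proof (induction rule: polynomial_maps.induct)
  case (const c)
  show ?case
    by (intro exI[of _ "{\<lambda>_. c}"]) (auto intro: fun_space.span_base)
next
  case (entry i j)
  let ?t = "range (\<lambda>k (A :: 'k ^ 'n ^ 'n). A $ k $ j)"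
  have "(\<lambda>A. (a ** A) $ i $ j) \<in> fun_space.span ?t" for a :: "'k ^ 'n ^ 'n"
  proof -
    have "(\<Sum>k\<in>UNIV. (\<lambda>A. a $ i $ k * A $ k $ j)) \<in> fun_space.span ?t"
      by (intro fun_space.span_sum fun_space.span_scale fun_space.span_base) auto
    also have "(\<Sum>k\<in>UNIV. (\<lambda>A. a $ i $ k * A $ k $ j)) = (\<lambda>A. (a ** A) $ i $ j)"
      by (simp add: fun_eq_iff matrix_matrix_mult_def sum_fun_app)
    finally show ?thesis .
  qed
  then show ?case by (intro exI[of _ ?t]) auto
next
  case (add p q)
  then obtain s t where st: "finite s" "finite t" "\<And>a :: 'k ^ 'n ^ 'n. (\<lambda>A :: 'k ^ 'n ^ 'n. p (a ** A)) \<in> fun_space.span s"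
    "\<And>a :: 'k ^ 'n ^ 'n. (\<lambda>A :: 'k ^ 'n ^ 'n. q (a ** A)) \<in> fun_space.span t" by metis
  have "(\<lambda>A. p (a ** A)) + (\<lambda>A. q (a ** A)) \<in> fun_space.span (s \<union> t)" for a :: "'k ^ 'n ^ 'n"
    using st(3,4)[of a] fun_space.span_mono[of s "s \<union> t"] fun_space.span_mono[of t "s \<union> t"]
    by (intro fun_space.span_add) auto
  then show ?case using st by (intro exI[of _ "s \<union> t"]) (auto simp: plus_fun_def)
next
  case (mult p q)
  then obtain s t where st: "finite s" "finite t" "\<And>a :: 'k ^ 'n ^ 'n. (\<lambda>A :: 'k ^ 'n ^ 'n. p (a ** A)) \<in> fun_space.span s"
    "\<And>a :: 'k ^ 'n ^ 'n. (\<lambda>A :: 'k ^ 'n ^ 'n. q (a ** A)) \<in> fun_space.span t" by metis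
  then show ?case
    using span_mult_span[OF st(3,4)]
    by (intro exI[of _ "(\<lambda>(f, g) x. f x * g x) ` (s \<times> t)"]) auto
qed

lemma openin_zariski_nonzero: "p \<in> polynomial_maps \<Longrightarrow> openin zariski {A. p A \<noteq> 0}"
  unfolding openin_zariski by (intro exI[of _ "{p}"]) (auto simp: zero_locus_def)

lemma openin_zariski_translate:
  fixes a :: "'k::field ^ 'n ^ 'n"
  assumes "openin zariski V"
  shows "openin zariski {A. a ** A \<in> V}"
proof -
  obtain P where P: "P \<subseteq> polynomial_maps" "- V = zero_locus P"
    using assms by (auto simp: openin_zariski)
  let ?Q = "(\<lambda>p A. p (a ** A ** mat 1)) ` P"
  have "?Q \<subseteq> polynomial_maps" using P polynomial_maps_translate by blast
  moreover have "- {A. a ** A \<in> V} = zero_locus ?Q"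
    using P(2) by (auto simp: zero_locus_def set_eq_iff)
  ultimately show ?thesis unfolding openin_zariski by blast
qed

text \<open>For the finite-dimensional space \<open>M\<close> spanned by the translates of \<open>q\<close>, let \<open>I x\<close> consist of the
  members of \<open>M\<close> that vanish near \<open>x\<close>. These spaces are translates of each other, so they have the
  same dimension, and \<open>I x \<subseteq> I y\<close> for \<open>y\<close> near \<open>x\<close>; hence \<open>I\<close> is locally constant. This replaces
  the decomposition of a Noetherian space into irreducible components.\<close>

lemma vanishing_on_open_subset:
  fixes G :: "('k::field ^ 'n ^ 'n) set"
  assumes G: "\<And>a. a \<in> G \<Longrightarrow> invertible a" "\<And>a b. a \<in> G \<Longrightarrow> b \<in> G \<Longrightarrow> a ** b \<in> G"
      "\<And>a b. a \<in> G \<Longrightarrow> a ** b = mat 1 \<Longrightarrow> b \<in> G" "mat 1 \<in> G"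
    and conn: "connectedin zariski G"
    and q: "q \<in> polynomial_maps"
    and V: "openin zariski V" "x0 \<in> V" "x0 \<in> G" "\<And>y. y \<in> V \<Longrightarrow> y \<in> G \<Longrightarrow> q y = 0"
    and z: "z \<in> G"
  shows "q z = 0"
proof -
  have inv: "\<exists>b\<in>G. a ** b = mat 1 \<and> b ** a = mat 1" if "a \<in> G" for a
    using G(1)[OF that] G(3)[OF that] unfolding invertible_def by blast
  define M where "M = fun_space.span ((\<lambda>a A :: 'k ^ 'n ^ 'n. q (a ** A)) ` G)"
  obtain t where t: "finite t" "\<And>a :: 'k ^ 'n ^ 'n. (\<lambda>A :: 'k ^ 'n ^ 'n. q (a ** A)) \<in> fun_space.span t"
    using translates_finite_span[OF q] by blast
  have Mt: "M \<subseteq> fun_space.span t"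
    unfolding M_def by (rule fun_space.span_minimal) (use t in auto)
  have qM: "q \<in> M"
    unfolding M_def using G(4) by (intro fun_space.span_base) (auto intro!: image_eqI[of _ _ "mat 1"])
  have linL: "Vector_Spaces.linear (\<lambda>c (f :: 'k ^ 'n ^ 'n \<Rightarrow> 'k) x. c * f x) (\<lambda>c f x. c * f x) (\<lambda>f A. f (a ** A))"
    for a :: "'k ^ 'n ^ 'n"
    by unfold_locales (auto simp: fun_eq_iff algebra_simps)
  have M_translate: "(\<lambda>A. f (a ** A)) \<in> M" if "f \<in> M" "a \<in> G" for f a
  proof -
    interpret L: Vector_Spaces.linear "\<lambda>c (f :: 'k ^ 'n ^ 'n \<Rightarrow> 'k) x. c * f x" "\<lambda>c f x. c * f x"
      "\<lambda>f A. f (a ** A)" by (rule linL)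
    show ?thesis
      using that(1) unfolding M_def
    proof (induction rule: fun_space.span_induct_alt)
      case base
      then show ?case using fun_space.span_zero by (simp add: zero_fun_def)
    next
      case (step c g h)
      then obtain b where b: "b \<in> G" "g = (\<lambda>A. q (b ** A))" by blast
      have "(\<lambda>A. g (a ** A)) \<in> fun_space.span ((\<lambda>a A. q (a ** A)) ` G)"
        unfolding b using G(2)[OF b(1) that(2)]
        by (intro fun_space.span_base) (auto simp: matrix_mul_assoc)
      from fun_space.span_add[OF fun_space.span_scale[OF this, of c] step(2)]
      show ?case by (simp add: plus_fun_def)
    qed
  qed
  define I where "I x = {f \<in> M. \<exists>V. openin zariski V \<and> x \<in> V \<and> (\<forall>y\<in>V \<inter> G. f y = 0)}" for x
  have I_sub: "fun_space.subspace (I x)" for x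
    unfolding fun_space.subspace_def
  proof (intro conjI ballI allI)
    show "0 \<in> I x"
    proof -
      have "openin zariski (UNIV :: ('k ^ 'n ^ 'n) set)" by (metis openin_topspace topspace_zariski)
      moreover have "0 \<in> M" unfolding M_def by (rule fun_space.span_zero)
      ultimately show ?thesis unfolding I_def by (intro CollectI conjI exI[of _ UNIV]) simp_all
    qed
    fix f assume f: "f \<in> I x"
    then show "(\<lambda>x. c * f x) \<in> I x" for c
      unfolding I_def M_def by (auto intro: fun_space.span_scale)
    fix g assume g: "g \<in> I x"
    obtain V W where "openin zariski V" "x \<in> V" "\<forall>y\<in>V \<inter> G. f y = 0"
      "openin zariski W" "x \<in> W" "\<forall>y\<in>W \<inter> G. g y = 0"
      using f g unfolding I_def by blast
    then have "openin zariski (V \<inter> W)" "x \<in> V \<inter> W" "\<forall>y\<in>V \<inter> W \<inter> G. (f + g) y = 0" by auto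
    moreover have "f + g \<in> M"
      using f g unfolding I_def M_def by (auto intro: fun_space.span_add)
    ultimately show "f + g \<in> I x" unfolding I_def by blast
  qed
  have It: "I x \<subseteq> fun_space.span t" for x using Mt unfolding I_def by blast
  have dim_le: "fun_space.dim (I (a ** x)) \<le> fun_space.dim (I x)" if a: "a \<in> G" for a x
  proof -
    obtain B where B: "B \<subseteq> I (a ** x)" "fun_space.independent B" "I (a ** x) \<subseteq> fun_space.span B"
      "card B = fun_space.dim (I (a ** x))"
      by (rule fun_space.basis_exists)
    let ?L = "\<lambda>f :: 'k ^ 'n ^ 'n \<Rightarrow> 'k. \<lambda>A. f (a ** A)"
    obtain b where b: "a ** b = mat 1" "b ** a = mat 1" using inv[OF a] by blast
    have inj: "inj ?L"
    proof (rule injI)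
      fix f g assume "?L f = ?L g"
      then have "f (a ** (b ** A)) = g (a ** (b ** A))" for A by (metis (no_types))
      then show "f = g" using b by (simp add: matrix_mul_assoc fun_eq_iff)
    qed
    interpret L: Vector_Spaces.linear "\<lambda>c (f :: 'k ^ 'n ^ 'n \<Rightarrow> 'k) x. c * f x" "\<lambda>c f x. c * f x" ?L
      by (rule linL)
    have ind: "fun_space.independent (?L ` B)"
      using B(2) inj by (intro L.independent_injective_image) (auto intro: inj_on_subset)
    have "?L ` B \<subseteq> I x"
    proof clarify
      fix f assume "f \<in> B"
      then obtain V where V: "f \<in> M" "openin zariski V" "a ** x \<in> V" "\<forall>y\<in>V \<inter> G. f y = 0"
        using B(1) unfolding I_def by blast
      then have "openin zariski {A. a ** A \<in> V}" "x \<in> {A. a ** A \<in> V}"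
        "\<forall>y\<in>{A. a ** A \<in> V} \<inter> G. f (a ** y) = 0"
        using openin_zariski_translate G(2)[OF a] by auto
      then show "?L f \<in> I x" unfolding I_def using M_translate[OF V(1) a] by blast
    qed
    from fun_space.independent_card_le_dim_finite_span[OF It t(1) this ind] B(4) inj
    show ?thesis by (simp add: card_image inj_on_subset)
  qed
  have dim_eq: "fun_space.dim (I y) = fun_space.dim (I x)" if "x \<in> G" "y \<in> G" for x y
  proof -
    have le: "fun_space.dim (I y) \<le> fun_space.dim (I x)" if xy: "x \<in> G" "y \<in> G" for x y
    proof -
      obtain b where "b \<in> G" "b ** x = mat 1" using inv[OF xy(1)] by blast
      then have "(y ** b) ** x = y" "y ** b \<in> G" using G(2) xy by (auto simp: matrix_mul_assoc[symmetric])
      then show ?thesis using dim_le[of "y ** b" x] by simp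
    qed
    show ?thesis using le that by (simp add: order_antisym)
  qed
  have "\<exists>V. openin zariski V \<and> x \<in> V \<and> (\<forall>y\<in>V \<inter> G. I y = I x)" if x: "x \<in> G" for x
  proof -
    obtain B where B: "B \<subseteq> I x" "fun_space.independent B" "I x \<subseteq> fun_space.span B"
      "card B = fun_space.dim (I x)"
      by (rule fun_space.basis_exists)
    have fin: "finite B"
      using fun_space.independent_card_le_dim_finite_span[OF It t(1) B(1,2)] by blast
    have "\<forall>f\<in>B. \<exists>V. openin zariski V \<and> x \<in> V \<and> (\<forall>y\<in>V \<inter> G. f y = 0)"
      using B(1) unfolding I_def by blast
    then obtain V where V: "\<And>f. f \<in> B \<Longrightarrow> openin zariski (V f) \<and> x \<in> V f \<and> (\<forall>y\<in>V f \<inter> G. f y = 0)"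
      by metis
    \<comment> \<open>A finite basis of \<open>I x\<close> vanishes on one common neighbourhood of
      \<open>x\<close>. The factor \<open>topspace zariski\<close> takes care of an empty
      basis.\<close>
    define W where "W = topspace zariski \<inter> (\<Inter>f\<in>B. V f)"
    have W: "openin zariski W"
      unfolding W_def using V fin
      by (cases "B = {}") (auto intro!: openin_Int openin_INT openin_topspace simp del: topspace_zariski)
    have xW: "x \<in> W" using V by (auto simp: W_def)
    have sub: "I x \<subseteq> I y" if y: "y \<in> W" for y
    proof
      fix f assume f: "f \<in> I x"
      have "fun_space.subspace {f. \<forall>y\<in>W \<inter> G. f y = 0}"
        by (auto simp: fun_space.subspace_def)
      moreover have "B \<subseteq> {f. \<forall>y\<in>W \<inter> G. f y = 0}"
        using V unfolding W_def by auto
      ultimately have "fun_space.span B \<subseteq> {f. \<forall>y\<in>W \<inter> G. f y = 0}"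
        using fun_space.span_minimal by blast
      then have "\<forall>y\<in>W \<inter> G. f y = 0" using f B(3) by blast
      then show "f \<in> I y" using f W y unfolding I_def by blast
    qed
    have "I y = I x" if y: "y \<in> W \<inter> G" for y
      using fun_space.subspace_eq_of_dim_finite_span[OF I_sub sub It t(1), of y] dim_eq[OF x, of y] y
      by auto
    with W xW show ?thesis by blast
  qed
  then obtain W where "\<And>x. x \<in> G \<Longrightarrow> openin zariski (W x) \<and> x \<in> W x \<and> (\<forall>y\<in>W x \<inter> G. I y = I x)"
    by metis
  then have W: "openin zariski (W x)" "x \<in> W x" "y \<in> W x \<Longrightarrow> y \<in> G \<Longrightarrow> I y = I x" if "x \<in> G" for x y
    using that by (metis IntI)+
  have const: "I z = I x0"
  proof (rule ccontr)
    assume neq: "I z \<noteq> I x0"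
    define E1 where "E1 = \<Union> (W ` {x \<in> G. I x = I x0})"
    define E2 where "E2 = \<Union> (W ` {x \<in> G. I x \<noteq> I x0})"
    have "openin zariski E1" "openin zariski E2"
      unfolding E1_def E2_def by (auto intro!: openin_Union W(1))
    moreover have "G \<subseteq> E1 \<union> E2"
      unfolding E1_def E2_def using W(2) by blast
    moreover have "E1 \<inter> E2 \<inter> G = {}"
    proof (rule ccontr)
      assume "E1 \<inter> E2 \<inter> G \<noteq> {}"
      then obtain y u v where "y \<in> G" "u \<in> G" "I u = I x0" "y \<in> W u" "v \<in> G" "I v \<noteq> I x0" "y \<in> W v"
        unfolding E1_def E2_def by blast
      then show False using W(3)[of u y] W(3)[of v y] by simp
    qed
    moreover have "x0 \<in> E1" unfolding E1_def using W(2)[OF V(3)] V(3) by blast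
    moreover have "z \<in> E2" unfolding E2_def using W(2)[OF z] z neq by blast
    ultimately show False using conn V(3) z unfolding connectedin by (metis IntI empty_iff)
  qed
  have "q \<in> I x0" using V qM unfolding I_def by blast
  then have "q \<in> I z" using const by simp
  then show ?thesis using z unfolding I_def by blast
qed

text \<open>\<open>H\<close> lies in the Zariski closure of \<open>S\<close>; \<open>S\<close>
  itself need not be contained in \<open>H\<close>. In this form density transports polynomial
  identities directly.\<close>

definition poly_dense :: "('k::field ^ 'n ^ 'n) set \<Rightarrow> ('k ^ 'n ^ 'n) set \<Rightarrow> bool" where
  "poly_dense S H \<longleftrightarrow> (\<forall>p\<in>polynomial_maps. (\<forall>x\<in>S. p x = 0) \<longrightarrow> (\<forall>x\<in>H. p x = 0))"

text \<open>The ring of polynomial functions restricted to \<open>H\<close> has no zero divisors,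
  which for nonempty \<open>H\<close> is irreducibility of its Zariski closure.\<close>

definition poly_irreducible :: "('k::field ^ 'n ^ 'n) set \<Rightarrow> bool" where
  "poly_irreducible H \<longleftrightarrow> (\<forall>p\<in>polynomial_maps. \<forall>q\<in>polynomial_maps. (\<forall>x\<in>H. p x * q x = 0) \<longrightarrow>
     (\<forall>x\<in>H. p x = 0) \<or> (\<forall>x\<in>H. q x = 0))"

lemma poly_denseD:
  "poly_dense S H \<Longrightarrow> p \<in> polynomial_maps \<Longrightarrow> (\<And>x. x \<in> S \<Longrightarrow> p x = 0) \<Longrightarrow> x \<in> H \<Longrightarrow> p x = 0"
  unfolding poly_dense_def by blast

lemma poly_irreducibleD:
  "poly_irreducible H \<Longrightarrow> p \<in> polynomial_maps \<Longrightarrow> q \<in> polynomial_maps \<Longrightarrow>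
    (\<And>x. x \<in> H \<Longrightarrow> p x * q x = 0) \<Longrightarrow> (\<forall>x\<in>H. p x = 0) \<or> (\<forall>x\<in>H. q x = 0)"
  unfolding poly_irreducible_def by blast

lemma zariski_dense_imp_poly_dense:
  assumes "zariski_dense G H" "H \<subseteq> G"
  shows "poly_dense H G"
  unfolding poly_dense_def
proof (intro ballI impI)
  fix p x assume p: "p \<in> polynomial_maps" "\<forall>x\<in>H. p x = 0" and x: "x \<in> G"
  have "closedin zariski (zero_locus {p})" unfolding closedin_zariski using p by blast
  then have "closedin (subtopology zariski G) (G \<inter> zero_locus {p})"
    by (simp add: closedin_subtopology_Int_closed)
  moreover have "H \<subseteq> G \<inter> zero_locus {p}" using p(2) assms(2) by (auto simp: zero_locus_def)
  ultimately have "subtopology zariski G closure_of H \<subseteq> G \<inter> zero_locus {p}"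
    by (rule closure_of_minimal[rotated])
  with assms(1) x show "p x = 0" unfolding zariski_dense_def zero_locus_def by blast
qed

text \<open>If p q vanishes on \<open>H\<close>, it vanishes on \<open>G\<close> by density. Where p
  is nonzero, an open condition, q vanishes, so one such point of \<open>G\<close> makes q vanish on
  all of \<open>G\<close> by \<open>vanishing_on_open_subset\<close>.\<close>

lemma connected_imp_poly_irreducible:
  assumes G: "subgroup G GL" and conn: "connectedin zariski G" and dense: "poly_dense H G" and sub: "H \<subseteq> G"
  shows "poly_irreducible H"
  unfolding poly_irreducible_def
proof (intro ballI impI)
  fix p q :: "'a ^ 'b ^ 'b \<Rightarrow> 'a"
  assume p: "p \<in> polynomial_maps" and q: "q \<in> polynomial_maps" and pq: "\<forall>x\<in>H. p x * q x = 0"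
  have pqG: "p x * q x = 0" if "x \<in> G" for x
    by (rule poly_denseD[OF dense polynomial_maps.mult[OF p q]]) (use pq that in auto)
  interpret G: subgroup G GL by (rule G)
  have inv: "invertible a" if "a \<in> G" for a
    using G.mem_carrier[OF that] by (simp add: GL_def)
  have mult: "a ** b \<in> G" if "a \<in> G" "b \<in> G" for a b
    using G.m_closed[OF that] by (simp add: GL_def)
  have one: "mat 1 \<in> G" using G.one_closed by (simp add: GL_def)
  have right_inv: "b \<in> G" if a: "a \<in> G" and b: "a ** b = mat 1" for a b
  proof -
    have "inv\<^bsub>GL\<^esub> a ** a = mat 1"
      using group.l_inv[OF group_GL G.mem_carrier[OF a]] by (simp add: GL_def)
    then have "b = inv\<^bsub>GL\<^esub> a" using b by (metis matrix_mul_assoc matrix_mul_lid matrix_mul_rid)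
    then show ?thesis using G.m_inv_closed[OF a] by simp
  qed
  have "\<forall>x\<in>G. q x = 0" if "x0 \<in> G" "p x0 \<noteq> 0" for x0
  proof
    fix z assume "z \<in> G"
    with inv mult right_inv one conn q openin_zariski_nonzero[OF p] _ that(1) _ show "q z = 0"
      by (rule vanishing_on_open_subset) (use that pqG in auto)
  qed
  then show "(\<forall>x\<in>H. p x = 0) \<or> (\<forall>x\<in>H. q x = 0)" using sub by blast
qed

text \<open>If no piece is dense, each has a polynomial that vanishes on it but not on
  \<open>H\<close>. The product of these vanishes on \<open>S\<close>, hence on \<open>H\<close>,
  against irreducibility.\<close>

lemma poly_dense_finite_union:
  assumes irr: "poly_irreducible H" and H: "H \<noteq> {}" and S: "poly_dense S H"
    and I: "finite I" and cover: "S \<subseteq> (\<Union>i\<in>I. C i)"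
  shows "\<exists>i\<in>I. poly_dense (C i) H"
proof (rule ccontr)
  assume "\<not> (\<exists>i\<in>I. poly_dense (C i) H)"
  then have "\<forall>i\<in>I. \<exists>p. p \<in> polynomial_maps \<and> (\<forall>x\<in>C i. p x = 0) \<and> \<not> (\<forall>x\<in>H. p x = 0)"
    unfolding poly_dense_def by blast
  then obtain p where p: "\<And>i. i \<in> I \<Longrightarrow> p i \<in> polynomial_maps" "\<And>i x. i \<in> I \<Longrightarrow> x \<in> C i \<Longrightarrow> p i x = 0"
    "\<And>i. i \<in> I \<Longrightarrow> \<not> (\<forall>x\<in>H. p i x = 0)" by metis
  have prodS: "(\<Prod>i\<in>I. p i x) = 0" if x: "x \<in> S" for x
  proof -
    obtain i where "i \<in> I" "x \<in> C i" using cover x by blast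
    then show ?thesis using p(2)[of i x] I by (auto intro!: prod_zero)
  qed
  have prodH: "\<forall>x\<in>H. (\<Prod>i\<in>I. p i x) = 0"
    using poly_denseD[OF S polynomial_maps_prod[of I p, OF p(1)] prodS] by blast
  have "J \<subseteq> I \<Longrightarrow> \<not> (\<forall>x\<in>H. (\<Prod>i\<in>J. p i x) = 0)" if "finite J" for J
    using that
  proof (induction J)
    case empty
    then show ?case using H by auto
  next
    case (insert j J)
    then have j: "p j \<in> polynomial_maps" and J: "(\<lambda>x. \<Prod>i\<in>J. p i x) \<in> polynomial_maps"
      using p(1) by (auto intro!: polynomial_maps_prod)
    have "\<not> (\<forall>x\<in>H. p j x = 0)" "\<not> (\<forall>x\<in>H. (\<Prod>i\<in>J. p i x) = 0)"
      using insert p(3)[of j] by simp_all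
    then have "\<not> (\<forall>x\<in>H. p j x * (\<Prod>i\<in>J. p i x) = 0)"
      using poly_irreducibleD[OF irr j J] by metis
    with insert show ?case by simp
  qed
  from this[OF I] prodH show False by blast
qed

lemma poly_dense_translate:
  assumes dense: "poly_dense ((\<lambda>x. a ** x ** b) ` S) H"
    and a: "a_left ** a = mat 1" and b: "b ** b_right = mat 1"
    and H: "\<And>x. x \<in> H \<Longrightarrow> a ** x ** b \<in> H"
  shows "poly_dense S H"
  unfolding poly_dense_def
proof (intro ballI impI)
  fix p x assume p: "p \<in> polynomial_maps" "\<forall>x\<in>S. p x = 0" and x: "x \<in> H"
  have cancel: "a_left ** (a ** x ** b) ** b_right = x" for x
  proof -
    have "a_left ** (a ** x ** b) ** b_right = (a_left ** a) ** x ** (b ** b_right)" by (simp add: matrix_mul_assoc)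
    then show ?thesis by (simp add: a b)
  qed
  have "p (a_left ** (a ** x ** b) ** b_right) = 0"
    by (rule poly_denseD[OF dense polynomial_maps_translate[OF p(1)]]) (use p(2) cancel H x in auto)
  then show "p x = 0" by (simp add: cancel)
qed

section \<open>Determinant and adjugate as polynomial maps\<close>

lemma det_polynomial:
  assumes "\<And>i j. (\<lambda>A. M A $ i $ j) \<in> polynomial_maps"
  shows "(\<lambda>A. det (M A)) \<in> polynomial_maps"
  unfolding det_def
  by (intro polynomial_maps_sum polynomial_maps.mult polynomial_maps.const polynomial_maps_prod assms)

text \<open>Cramer's rule: entry (k, l) is the determinant of \<open>A\<close> with column k
  replaced by the l-th unit vector. Unlike the inverse, which it equals up to the factor
  \<open>det A\<close>, it is polynomial in \<open>A\<close>.\<close>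

definition adjugate :: "'k::field ^ 'n ^ 'n \<Rightarrow> 'k ^ 'n ^ 'n" where
  "adjugate A = (\<chi> k l. det (\<chi> i j. if j = k then (if i = l then 1 else 0) else A $ i $ j))"

lemma adjugate_polynomial: "(\<lambda>A. adjugate A $ i $ j) \<in> polynomial_maps"
  unfolding adjugate_def vec_lambda_beta
proof (rule det_polynomial)
  show "(\<lambda>A. (\<chi> k l. if l = i then if k = j then 1 else 0 else A $ k $ l) $ k $ l) \<in> polynomial_maps" for k l
    by (cases "l = i"; cases "k = j") (auto intro: polynomial_maps.intros)
qed

lemma adjugate_eq:
  fixes A B :: "'k::field ^ 'n ^ 'n"
  assumes "A ** B = mat 1" "B ** A = mat 1"
  shows "det A * B $ k $ l = adjugate A $ k $ l"
proof -
  have "invertible A" using assms unfolding invertible_def by blast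
  then have d: "det A \<noteq> 0" by (simp add: invertible_det_nz)
  have "A *v column l B = axis l 1"
    using assms(1) by (simp add: vec_eq_iff matrix_matrix_mult_def matrix_vector_mult_def column_def mat_def axis_def)
  then have "column l B = (\<chi> k. det (\<chi> i j. if j = k then axis l 1 $ i else A $ i $ j) / det A)"
    using cramer[OF d] by blast
  then have "column l B $ k = det (\<chi> i j. if j = k then axis l 1 $ i else A $ i $ j) / det A"
    by (metis (no_types, lifting) vec_lambda_beta)
  then show ?thesis
    using d unfolding column_def adjugate_def axis_def vec_lambda_beta by (simp add: field_simps)
qed

section \<open>Linear groups without unipotents\<close>

text \<open>On a matrix, \<open>*s\<close> would expect a scalar of the type of a row; this is the
  action of the field.\<close>

definition mat_scale :: "'k::field \<Rightarrow> 'k ^ 'n ^ 'n \<Rightarrow> 'k ^ 'n ^ 'n" where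
  "mat_scale c A = (\<chi> i j. c * A $ i $ j)"

definition mat_unit :: "'n \<times> 'n \<Rightarrow> 'k::field ^ 'n ^ 'n" where
  "mat_unit e = (\<chi> i j. if (i, j) = e then 1 else 0)"

lemma vector_space_mat_scale: "vector_space (mat_scale :: 'k::field \<Rightarrow> 'k ^ 'n ^ 'n \<Rightarrow> _)"
proof
  fix a b and x y :: "'k ^ 'n ^ 'n"
  show "mat_scale a (x + y) = mat_scale a x + mat_scale a y"
    unfolding mat_scale_def vec_eq_iff by (simp add: distrib_left)
  show "mat_scale (a + b) x = mat_scale a x + mat_scale b x"
    unfolding mat_scale_def vec_eq_iff by (simp add: distrib_right)
  show "mat_scale a (mat_scale b x) = mat_scale (a * b) x"
    unfolding mat_scale_def vec_eq_iff by simp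
  show "mat_scale 1 x = x"
    unfolding mat_scale_def vec_eq_iff by simp
qed

lemma sum_mat_scale_component:
  "(\<Sum>e\<in>I. mat_scale (c e) (M e)) $ i $ j = (\<Sum>e\<in>I. c e * M e $ i $ j)"
  by (simp add: mat_scale_def)

lemma mat_unit_expansion: "(\<Sum>e\<in>UNIV. mat_scale (A $ fst e $ snd e) (mat_unit e)) = A"
proof -
  have "(\<Sum>e\<in>UNIV. A $ fst e $ snd e * mat_unit e $ i $ j) = A $ i $ j" for i j
  proof -
    have "(\<Sum>e\<in>UNIV. A $ fst e $ snd e * mat_unit e $ i $ j)
      = (\<Sum>e\<in>UNIV. if e = (i, j) then A $ i $ j else 0)"
      by (intro sum.cong) (auto simp: mat_unit_def)
    then show ?thesis by simp
  qed
  then show ?thesis by (simp add: vec_eq_iff mat_scale_def)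
qed

lemma inj_mat_unit: "inj (mat_unit :: 'n \<times> 'n \<Rightarrow> 'k::field ^ 'n ^ 'n)"
proof (rule injI)
  fix d e :: "'n \<times> 'n" assume "(mat_unit d :: 'k ^ 'n ^ 'n) = mat_unit e"
  then have "(mat_unit d :: 'k ^ 'n ^ 'n) $ fst d $ snd d = mat_unit e $ fst d $ snd d" by simp
  then show "d = e" by (auto simp: mat_unit_def split: if_splits)
qed

interpretation mat_space: alg_closed_vector_space
  "mat_scale :: 'k::alg_closed_field \<Rightarrow> 'k ^ 'n ^ 'n \<Rightarrow> _" "range mat_unit"
proof -
  interpret vector_space "mat_scale :: 'k::alg_closed_field \<Rightarrow> 'k ^ 'n ^ 'n \<Rightarrow> _"
    by (rule vector_space_mat_scale)
  have "independent (range (mat_unit :: 'n \<times> 'n \<Rightarrow> 'k ^ 'n ^ 'n))"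
  proof (rule independent_if_scalars_zero)
    fix f and x :: "'k ^ 'n ^ 'n"
    assume 0: "(\<Sum>x\<in>range (mat_unit :: _ \<Rightarrow> 'k ^ 'n ^ 'n). mat_scale (f x) x) = 0" and "x \<in> range (mat_unit :: _ \<Rightarrow> 'k ^ 'n ^ 'n)"
    then obtain e where e: "x = mat_unit e" by blast
    have "(\<Sum>d\<in>UNIV. mat_scale (f (mat_unit d)) (mat_unit d :: 'k ^ 'n ^ 'n)) = 0"
      using 0 by (simp add: sum.reindex[OF inj_mat_unit])
    from this[THEN arg_cong, of "\<lambda>A. A $ fst e $ snd e"]
    have "(\<Sum>d\<in>UNIV. f (mat_unit d) * (mat_unit d :: 'k ^ 'n ^ 'n) $ fst e $ snd e) = 0"
      by (simp only: sum_mat_scale_component zero_index)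
    also have "(\<Sum>d\<in>UNIV. f (mat_unit d) * (mat_unit d :: 'k ^ 'n ^ 'n) $ fst e $ snd e)
      = (\<Sum>d\<in>UNIV. if d = e then f (mat_unit e) else 0)"
      by (intro sum.cong) (auto simp: mat_unit_def)
    finally show "f x = 0" by (simp add: e)
  qed simp
  moreover have "A \<in> span (range mat_unit)" for A :: "'k ^ 'n ^ 'n"
  proof -
    have "(\<Sum>e\<in>UNIV. mat_scale (A $ fst e $ snd e) (mat_unit e)) \<in> span (range mat_unit)"
      by (intro span_sum span_scale span_base) auto
    then show ?thesis by (simp only: mat_unit_expansion)
  qed
  ultimately show "alg_closed_vector_space (mat_scale :: 'k \<Rightarrow> 'k ^ 'n ^ 'n \<Rightarrow> _) (range mat_unit)"
    by unfold_locales auto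
qed

section \<open>Eigenvalues and weights on column vectors\<close>

interpretation col_space: alg_closed_vector_space
  "(*s) :: 'k::alg_closed_field \<Rightarrow> 'k ^ 'n \<Rightarrow> _" cart_basis
  by unfold_locales

lemma col_lin: "col_space.lin ((*v) (A :: 'k::alg_closed_field ^ 'n ^ 'n))"
  unfolding Vector_Spaces.linear_iff
  using vec.vector_space_axioms by (simp add: matrix_vector_right_distrib vector_scalar_commute)

lemma column_eq_mult_axis: "column i A = A *v axis i 1" for A :: "'k::field ^ 'n ^ 'm"
proof -
  have "(\<Sum>j\<in>UNIV. A $ k $ j * (if j = i then 1 else 0)) = (\<Sum>j\<in>UNIV. if j = i then A $ k $ i else 0)" for k
    by (intro sum.cong) auto
  then show ?thesis
    by (simp add: column_def matrix_vector_mult_def axis_def vec_eq_iff)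
qed

text \<open>Let \<open>L\<close> be the space of vectors killed by a power of f = c - 1. If it is
  proper, f has an eigenvector z modulo \<open>L\<close> with eigenvalue \<open>\<mu>\<close>;
  applying a power of f that kills the error turns z into a true eigenvector of c with eigenvalue 1
  + \<open>\<mu>\<close>. So \<open>\<mu>\<close> is 0, and z was in \<open>L\<close> after
  all.\<close>

lemma unipotent_if_eigenvalues_one:
  fixes c :: "'k::alg_closed_field ^ 'n ^ 'n"
  assumes eig: "\<And>l x. x \<noteq> 0 \<Longrightarrow> c *v x = l *s x \<Longrightarrow> l = 1"
  shows "unipotent c"
proof -
  define f where "f = (*v) (c - mat 1)"
  have f: "col_space.lin f" unfolding f_def by (rule col_lin)
  have fc: "f x = c *v x - x" for x by (simp add: f_def matrix_vector_mult_diff_rdistrib)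
  have fp: "col_space.lin (f ^^ d)" for d
  proof (induction d)
    case 0
    then show ?case using vec.vector_space_axioms by (simp add: Vector_Spaces.linear_iff)
  next
    case (Suc d)
    have "(f ^^ Suc d) = f \<circ> (f ^^ d)" by simp
    then show ?case using f Suc unfolding Vector_Spaces.linear_iff by simp
  qed
  have kill: "(f ^^ e) x = 0" if "(f ^^ d) x = 0" "d \<le> e" for d e x
  proof -
    have "(f ^^ e) x = (f ^^ (e - d)) ((f ^^ d) x)"
      using that(2) by (simp flip: funpow_add o_apply[of "f ^^ (e - d)" "f ^^ d"])
    then show ?thesis using that(1) col_space.linD(4)[OF fp] by simp
  qed
  define L where "L = {x. \<exists>d. (f ^^ d) x = 0}"
  have L: "vec.subspace L"
    unfolding vec.subspace_def
  proof (intro conjI ballI allI)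
    show "0 \<in> L" unfolding L_def using col_space.linD(4)[OF fp] by blast
    fix x assume x: "x \<in> L"
    then show "a *s x \<in> L" for a unfolding L_def by (auto simp: col_space.linD(3)[OF fp])
    fix y assume "y \<in> L"
    then obtain d e where "(f ^^ d) x = 0" "(f ^^ e) y = 0" using x by (auto simp: L_def)
    then have "(f ^^ max d e) (x + y) = 0"
      by (simp add: col_space.linD(1)[OF fp] kill[of d x "max d e"] kill[of e y "max d e"])
    then show "x + y \<in> L" unfolding L_def by blast
  qed
  have "y \<in> L" for y
  proof (rule ccontr)
    assume y: "y \<notin> L"
    obtain \<mu> z where z: "z \<notin> L" "f z - \<mu> *s z \<in> L"
      using col_space.eigenvector_mod[OF f L vec.subspace_UNIV subset_UNIV UNIV_I y] by blast
    then obtain d where "(f ^^ d) (f z - \<mu> *s z) = 0" by (auto simp: L_def)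
    then have ev: "f ((f ^^ d) z) = \<mu> *s (f ^^ d) z"
      by (simp add: col_space.linD[OF fp] funpow_swap1)
    moreover have nz: "(f ^^ d) z \<noteq> 0" using z(1) by (auto simp: L_def)
    ultimately have "c *v (f ^^ d) z = (1 + \<mu>) *s (f ^^ d) z"
      by (simp add: fc algebra_simps vector_sadd_rdistrib)
    from eig[OF nz this] have "\<mu> = 0" by simp
    then have "(f ^^ Suc d) z = 0" using ev by simp
    then show False using z(1) by (auto simp: L_def simp del: funpow.simps)
  qed
  then obtain d where d: "\<And>y. (f ^^ d y) y = 0" unfolding L_def by (simp only: mem_Collect_eq) metis
  \<comment> \<open>A common exponent for the finitely many basis vectors: the sum bounds each of
    the exponents.\<close>
  define m where "m = (\<Sum>i\<in>UNIV. d (axis i 1))"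
  have "(f ^^ m) (axis i 1) = 0" for i
    by (rule kill[OF d]) (auto simp: m_def intro: member_le_sum)
  moreover have pow: "(((**) (c - mat 1)) ^^ k) (mat 1) *v y = (f ^^ k) y" for k y
    by (induction k) (simp_all add: f_def flip: matrix_vector_mul_assoc)
  ultimately have "column i ((((**) (c - mat 1)) ^^ m) (mat 1)) = 0" for i
    by (metis column_eq_mult_axis)
  then have "(((**) (c - mat 1)) ^^ m) (mat 1) = 0"
    by (simp add: vec_eq_iff column_def)
  then show ?thesis unfolding unipotent_def by blast
qed

text \<open>The weights of \<open>A\<close> on column vectors. The value 0 off \<open>A\<close>
  makes a weight determined by its restriction to \<open>A\<close>, so that counting functions
  counts weights.\<close>

definition character_of :: "('k::field ^ 'n ^ 'n) set \<Rightarrow> ('k ^ 'n ^ 'n \<Rightarrow> 'k) \<Rightarrow> bool" where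
  "character_of A w \<longleftrightarrow> (\<forall>a. a \<notin> A \<longrightarrow> w a = 0) \<and> (\<exists>x. x \<noteq> 0 \<and> (\<forall>a\<in>A. a *v x = w a *s x))"

text \<open>Eigenvectors of distinct weights are linearly independent, so there are at most
  \<open>CARD('n)\<close> weights.\<close>

lemma finite_characters:
  fixes A :: "('k::alg_closed_field ^ 'n ^ 'n) set"
  shows "finite {w. character_of A w}"
proof -
  have "\<forall>w\<in>{w. character_of A w}. \<exists>x. x \<noteq> 0 \<and> (\<forall>a\<in>A. a *v x = w a *s x)"
    by (auto simp: character_of_def)
  then obtain ev where ev: "\<And>w. character_of A w \<Longrightarrow> ev w \<noteq> 0"
    "\<And>w a. character_of A w \<Longrightarrow> a \<in> A \<Longrightarrow> a *v ev w = w a *s ev w" by (metis mem_Collect_eq)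
  have indep: "F \<subseteq> {w. character_of A w} \<Longrightarrow> (\<Sum>w\<in>F. c w *s ev w) = 0 \<Longrightarrow> \<forall>w\<in>F. c w = 0"
    if "finite F" for F c
    using that
  proof (induction F arbitrary: c)
    case (insert v F)
    \<comment> \<open>Applying a - v a to the relation kills the term of \<open>v\<close> and
      multiplies the other coefficients by w a - v a, which leaves a relation over
      \<open>F\<close>.\<close>
    have "\<forall>w\<in>F. c w * (w a - v a) = 0" if a: "a \<in> A" for a
    proof (rule insert.IH)
      have "a *v (\<Sum>w\<in>insert v F. c w *s ev w) = (\<Sum>w\<in>insert v F. c w *s (w a *s ev w))"
        unfolding col_space.lin_sum[OF col_lin] using insert.prems(1) ev(2)[OF _ a]
        by (intro sum.cong) (auto simp: vector_scalar_commute)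
      then have "(\<Sum>w\<in>insert v F. c w *s (w a *s ev w)) - v a *s (\<Sum>w\<in>insert v F. c w *s ev w) = 0"
        by (simp add: insert.prems(2))
      then show "(\<Sum>w\<in>F. (c w * (w a - v a)) *s ev w) = 0"
        using insert.hyps
        by (simp add: algebra_simps vec.scale_sum_right vec.scale_left_diff_distrib vec.scale_right_distrib sum_subtractf)
    qed (use insert.prems in auto)
    then have cF: "c w = 0" if "w \<in> F" for w
    proof -
      have "w \<noteq> v" using that insert.hyps by blast
      then obtain a where "w a \<noteq> v a" by blast
      \<comment> \<open>Characters vanish off \<open>A\<close>, so two of them can differ only at
        elements of \<open>A\<close>.\<close>
      moreover have "a \<in> A"
      proof (rule ccontr)
        assume "a \<notin> A"
        moreover have "character_of A w" "character_of A v" using that insert.prems(1) by blast+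
        ultimately show False using \<open>w a \<noteq> v a\<close> by (simp add: character_of_def)
      qed
      ultimately show ?thesis using \<open>\<And>a. a \<in> A \<Longrightarrow> \<forall>w\<in>F. c w * (w a - v a) = 0\<close> that by force
    qed
    then have "c v *s ev v = 0" using insert by simp
    then show ?case using cF ev(1)[of v] insert.prems(1) by simp
  qed simp
  have "card F \<le> CARD('n)" if F: "finite F" "F \<subseteq> {w. character_of A w}" for F
  proof -
    have inj: "inj_on ev F"
    proof (rule inj_onI, rule ccontr)
      fix v w assume vw: "v \<in> F" "w \<in> F" "ev v = ev w" "v \<noteq> w"
      have "(\<Sum>u\<in>{v, w}. (if u = v then 1 else - 1) *s ev u) = 0" using vw by simp
      from indep[OF _ _ this] vw F show False by auto
    qed
    have "vec.independent (ev ` F)"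
    proof (rule vec.independent_if_scalars_zero)
      fix c x assume "(\<Sum>x\<in>ev ` F. c x *s x) = 0" "x \<in> ev ` F"
      with indep[OF F, of "\<lambda>w. c (ev w)"] show "c x = 0"
        by (auto simp: sum.reindex[OF inj])
    qed (use F in simp)
    then have "card (ev ` F) \<le> CARD('n)"
      using vec.independent_bound_general[of "ev ` F"] vec.dim_subset_UNIV[of "ev ` F"]
      by (simp add: vec.dimension_def card_cart_basis)
    then show ?thesis by (simp add: card_image[OF inj])
  qed
  then show ?thesis by (rule finite_if_finite_subsets_card_bdd[THEN conjunct1, rotated]) auto
qed

section \<open>Centralizers and finite index in an abstract group\<close>

definition centr :: "('a, 'm) monoid_scheme \<Rightarrow> 'a set \<Rightarrow> 'a set \<Rightarrow> 'a set" where
  "centr G K Y = {k \<in> K. \<forall>y\<in>Y. k \<otimes>\<^bsub>G\<^esub> y = y \<otimes>\<^bsub>G\<^esub> k}"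

definition finite_idx :: "('a, 'm) monoid_scheme \<Rightarrow> 'a set \<Rightarrow> 'a set \<Rightarrow> bool" where
  "finite_idx G K C \<longleftrightarrow> finite ((\<lambda>k. k <#\<^bsub>G\<^esub> C) ` K)"

context group
begin

text \<open>\<open>\<theta>\<close> is a finite-valued invariant that determines the coset; in later
  uses it is a permutation of weights, a tuple of cosets or a coset in another group.\<close>

lemma finite_idxI:
  assumes C: "subgroup C G" and K: "K \<subseteq> carrier G" and fin: "finite (\<theta> ` K)"
    and \<theta>: "\<And>k l. k \<in> K \<Longrightarrow> l \<in> K \<Longrightarrow> \<theta> k = \<theta> l \<Longrightarrow> inv k \<otimes> l \<in> C"
  shows "finite_idx G K C"
proof -
  have eq: "k <# C = l <# C" if "k \<in> K" "l \<in> K" "\<theta> k = \<theta> l" for k l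
  proof -
    have kl: "k \<in> carrier G" "l \<in> carrier G" using K that by auto
    then have "l = k \<otimes> (inv k \<otimes> l)" by (simp add: m_assoc[symmetric])
    with \<theta>[OF that] have "l \<in> k <# C" unfolding l_coset_def by blast
    then show ?thesis using l_repr_independence[OF _ kl(1) C] by blast
  qed
  have "\<forall>t\<in>\<theta> ` K. \<exists>k. k \<in> K \<and> \<theta> k = t" by blast
  then obtain g where g: "\<And>t. t \<in> \<theta> ` K \<Longrightarrow> g t \<in> K \<and> \<theta> (g t) = t"
    by metis
  have "(\<lambda>k. k <# C) ` K \<subseteq> (\<lambda>t. g t <# C) ` \<theta> ` K"
  proof clarify
    fix k assume k: "k \<in> K"
    then have "g (\<theta> k) \<in> K" "\<theta> (g (\<theta> k)) = \<theta> k" using g by auto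
    then have "k <# C = g (\<theta> k) <# C" using eq[of k "g (\<theta> k)"] k by metis
    then show "k <# C \<in> (\<lambda>t. g t <# C) ` \<theta> ` K" using k by blast
  qed
  then show ?thesis unfolding finite_idx_def using fin finite_subset by blast
qed

lemma l_coset_eq_imp:
  assumes "subgroup C G" "k \<in> carrier G" "l \<in> carrier G" "k <# C = l <# C"
  shows "inv k \<otimes> l \<in> C"
proof -
  have "l \<in> k <# C" using assms subgroup.one_closed[OF assms(1)] unfolding l_coset_def by force
  then obtain c where "c \<in> C" "l = k \<otimes> c" unfolding l_coset_def by blast
  then show ?thesis
    using assms subgroup.mem_carrier[OF assms(1)] by (simp add: m_assoc[symmetric])
qed

lemma finite_idx_cover:
  assumes "finite_idx G K C" "subgroup C G" "K \<subseteq> carrier G"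
  obtains F where "finite F" "F \<subseteq> K" "K \<subseteq> (\<Union>f\<in>F. f <# C)"
proof -
  obtain F where F: "F \<subseteq> K" "finite F" "(\<lambda>k. k <# C) ` K = (\<lambda>k. k <# C) ` F"
    using finite_subset_image[OF assms(1)[unfolded finite_idx_def] subset_refl] by blast
  have "K \<subseteq> (\<Union>f\<in>F. f <# C)"
  proof
    fix k assume k: "k \<in> K"
    then obtain f where "f \<in> F" "k <# C = f <# C" using F(3) by blast
    moreover have "k \<in> k <# C"
      using k assms(3) subgroup.one_closed[OF assms(2)] unfolding l_coset_def by force
    ultimately show "k \<in> (\<Union>f\<in>F. f <# C)" by blast
  qed
  with F that show thesis by blast
qed

end

locale unipotent_free_linear_group =
  fixes H :: "('k::alg_closed_field ^ 'n ^ 'n) set" and G :: "('k ^ 'n ^ 'n) monoid"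
  assumes H: "subgroup H GL" and G_def: "G = GL\<lparr>carrier := H\<rparr>"
    and no_unipotents: "\<And>A. A \<in> H \<Longrightarrow> unipotent A \<Longrightarrow> A = mat 1"
begin

sublocale G: group G
  unfolding G_def using subgroup.subgroup_is_group[OF H group_GL] .

lemma G_simps: "carrier G = H" "x \<otimes>\<^bsub>G\<^esub> y = x ** y" "\<one>\<^bsub>G\<^esub> = mat 1"
  by (simp_all add: G_def GL_def)

text \<open>Let k and l permute the weights of \<open>A\<close> in the same way, and let e be the
  product of the inverse of k with l. For a in \<open>A\<close>, the elements a and b = e^-1 a e
  have the same weights, so b a^-1 has all weights 1, is unipotent and therefore trivial. Hence e
  centralizes \<open>A\<close>.\<close>

lemma abelian_normalizer:
  assumes A: "subgroup A G" and comm: "\<And>a b. a \<in> A \<Longrightarrow> b \<in> A \<Longrightarrow> a \<otimes>\<^bsub>G\<^esub> b = b \<otimes>\<^bsub>G\<^esub> a"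
    and K: "subgroup K G" and norm: "\<And>k a. k \<in> K \<Longrightarrow> a \<in> A \<Longrightarrow> k \<otimes>\<^bsub>G\<^esub> a \<otimes>\<^bsub>G\<^esub> inv\<^bsub>G\<^esub> k \<in> A"
    and C: "subgroup (centr G K A) G"
  shows "finite_idx G K (centr G K A)"
proof -
  let ?i = "\<lambda>x. inv\<^bsub>G\<^esub> x"
  have AH: "A \<subseteq> H" and KH: "K \<subseteq> H" using subgroup.subset[OF A] subgroup.subset[OF K] by (auto simp: G_simps)
  have inv: "?i x ** x = mat 1" "x ** ?i x = mat 1" "?i x \<in> H" if "x \<in> H" for x
    using G.l_inv G.r_inv G.inv_closed that by (simp_all add: G_simps)
  have norm': "?i k ** a ** k \<in> A" if "k \<in> K" "a \<in> A" for k a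
    using norm[OF subgroup.m_inv_closed[OF K that(1)] that(2)] that KH by (auto simp: G_simps)
  \<comment> \<open>The eigenspace of \<open>c\<close> for an eigenvalue l is
    \<open>A\<close>-invariant, so it contains a common eigenvector of \<open>A\<close>. Its weight
    takes the value l at \<open>c\<close>, hence l = 1.\<close>
  have all_one: "c = mat 1" if c: "c \<in> A" and w1: "\<And>w. character_of A w \<Longrightarrow> w c = 1" for c
  proof (rule no_unipotents[OF _ unipotent_if_eigenvalues_one])
    show "c \<in> H" using c AH by blast
    fix l x assume x: "x \<noteq> 0" "c *v x = l *s x"
    let ?\<Phi> = "(*v) ` A" and ?E = "{y \<in> UNIV. c *v y - l *s y \<in> {0}}"
    have lin: "\<And>f. f \<in> ?\<Phi> \<Longrightarrow> col_space.lin f" using col_lin by blast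
    have com: "f (g y) = g (f y)" if "f \<in> ?\<Phi>" "g \<in> ?\<Phi>" for f g y
      using that comm by (auto simp: matrix_vector_mul_assoc G_simps)
    have zero: "col_space.invariant_subspace ?\<Phi> {0}"
      by (auto simp: col_space.invariant_subspace_def)
    have univ: "col_space.invariant_subspace ?\<Phi> UNIV"
      by (auto simp: col_space.invariant_subspace_def)
    have E: "col_space.invariant_subspace ?\<Phi> ?E"
    proof (rule col_space.invariant_eigenspace_mod)
      show "col_space.lin f" if "f \<in> ?\<Phi>" for f using lin that .
      show "f (g y) = g (f y)" if "f \<in> ?\<Phi>" "g \<in> ?\<Phi>" for f g y using com that .
    qed (use c zero univ in auto)
    have proper: "{0} \<subset> ?E" using x by auto
    obtain y \<mu> where y: "y \<in> ?E" "y \<notin> {0}" "\<And>f. f \<in> ?\<Phi> \<Longrightarrow> f y - \<mu> f *s y \<in> {0}"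
    proof (rule col_space.common_eigenvector_mod[OF _ _ zero E proper])
      show "col_space.lin f" if "f \<in> ?\<Phi>" for f using lin that .
      show "f (g y) = g (f y)" if "f \<in> ?\<Phi>" "g \<in> ?\<Phi>" for f g y using com that .
    qed (use that in blast)
    define w where "w a = (if a \<in> A then \<mu> ((*v) a) else 0)" for a
    have "character_of A w"
      unfolding character_of_def
      using y(2) y(3)[OF imageI] by (intro conjI exI[of _ y]) (auto simp: w_def)
    from w1[OF this] have "\<mu> ((*v) c) = 1" using c by (simp add: w_def)
    with y(3)[OF imageI[OF c]] have "c *v y = 1 *s y" by simp
    moreover have "c *v y = l *s y" using y(1) by simp
    ultimately have "1 *s y = l *s y" by (rule subst)
    then show "l = 1" using y(2) vec.scale_cancel_right[of 1 y l] by blast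
  qed
  \<comment> \<open>The action of k on weights by conjugation, restricted to the finite set of
    weights so that only finitely many functions arise.\<close>
  define \<theta> where "\<theta> k = (\<lambda>w\<in>{w. character_of A w}. \<lambda>a. if a \<in> A then w (?i k ** a ** k) else 0)" for k
  show ?thesis
  proof (rule G.finite_idxI[OF C])
    show "K \<subseteq> carrier G" using KH by (simp add: G_simps)
    have "\<theta> k \<in> {w. character_of A w} \<rightarrow>\<^sub>E {w. character_of A w}" if k: "k \<in> K" for k
    proof -
      have "character_of A (\<lambda>a. if a \<in> A then w (?i k ** a ** k) else 0)" if "character_of A w" for w
      proof -
        from \<open>character_of A w\<close> obtain x where x: "x \<noteq> 0" "\<And>a. a \<in> A \<Longrightarrow> a *v x = w a *s x"
          unfolding character_of_def by blast
        have kH: "k \<in> H" using k KH by blast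
        have "k *v x \<noteq> 0"
        proof
          assume "k *v x = 0"
          then have "?i k *v (k *v x) = 0" by simp
          then show False using x(1) by (simp add: matrix_vector_mul_assoc inv[OF kH])
        qed
        moreover have "a *v (k *v x) = w (?i k ** a ** k) *s (k *v x)" if a: "a \<in> A" for a
        proof -
          have "a *v (k *v x) = k *v ((?i k ** a ** k) *v x)"
            by (simp add: matrix_vector_mul_assoc matrix_mul_assoc inv[OF kH])
          also have "\<dots> = w (?i k ** a ** k) *s (k *v x)"
            by (simp add: x(2)[OF norm'[OF k a]] vector_scalar_commute)
          finally show ?thesis .
        qed
        ultimately show ?thesis unfolding character_of_def by (intro conjI exI[of _ "k *v x"]) auto
      qed
      then show ?thesis unfolding \<theta>_def by auto
    qed
    then have "\<theta> ` K \<subseteq> {w. character_of A w} \<rightarrow>\<^sub>E {w. character_of A w}" by blast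
    then show "finite (\<theta> ` K)"
      by (rule finite_subset) (intro finite_PiE finite_characters)
    fix k l assume k: "k \<in> K" and l: "l \<in> K" and eq: "\<theta> k = \<theta> l"
    have kH: "k \<in> H" and lH: "l \<in> H" using k l KH by auto
    define e where "e = ?i k ** l"
    have eK: "e \<in> K"
      using subgroup.m_closed[OF K subgroup.m_inv_closed[OF K k] l] by (simp add: G_simps e_def)
    then have eH: "e \<in> H" using KH by blast
    have ie: "?i e = ?i l ** k"
    proof -
      have "e ** (?i l ** k) = ?i k ** (l ** ?i l) ** k" by (simp add: e_def matrix_mul_assoc)
      then have "e ** (?i l ** k) = mat 1" by (simp add: inv kH lH)
      then have "?i e ** (e ** (?i l ** k)) = ?i e" by simp
      then show ?thesis by (simp add: matrix_mul_assoc inv[OF eH])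
    qed
    have "e ** a = a ** e" if a: "a \<in> A" for a
    proof -
      have aH: "a \<in> H" using a AH by blast
      define b where "b = ?i e ** a ** e"
      have b: "b \<in> A" unfolding b_def by (rule norm'[OF eK a])
      have wb: "w b = w a" if w: "character_of A w" for w
      proof -
        \<comment> \<open>Chosen so that conjugating it back by \<open>k\<close> gives
          \<open>a\<close> and by \<open>l\<close> gives \<open>b\<close>.\<close>
        define d where "d = k ** a ** ?i k"
        have d: "d \<in> A" using norm[OF k a] by (simp add: G_simps d_def)
        have "\<theta> k w d = \<theta> l w d" using eq by simp
        then have "w (?i k ** d ** k) = w (?i l ** d ** l)" using w d by (simp add: \<theta>_def)
        moreover have "?i k ** d ** k = a"
        proof -
          have "?i k ** d ** k = (?i k ** k) ** a ** (?i k ** k)" by (simp add: d_def matrix_mul_assoc)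
          then show ?thesis by (simp add: inv kH)
        qed
        moreover have "?i l ** d ** l = b"
          unfolding b_def ie by (simp add: d_def e_def matrix_mul_assoc)
        ultimately show ?thesis by simp
      qed
      define c where "c = b ** ?i a"
      have c: "c \<in> A"
        using subgroup.m_closed[OF A b subgroup.m_inv_closed[OF A a]] by (simp add: G_simps c_def)
      have ca: "c ** a = b" using inv[OF aH] by (simp add: c_def flip: matrix_mul_assoc)
      have "c = mat 1"
      proof (rule all_one[OF c])
        fix w assume w: "character_of A w"
        then obtain x where x: "x \<noteq> 0" "\<And>a. a \<in> A \<Longrightarrow> a *v x = w a *s x"
          unfolding character_of_def by blast
        have "b *v x = c *v (a *v x)" by (simp add: ca matrix_vector_mul_assoc)
        then have "w a *s x = (w a * w c) *s x"
          by (simp add: x(2)[OF b] x(2)[OF a] x(2)[OF c] wb[OF w] vector_scalar_commute)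
        then have "w a = w a * w c" using x(1) vec.scale_cancel_right[of "w a" x "w a * w c"] by blast
        moreover have "w a \<noteq> 0"
        proof
          assume "w a = 0"
          then have "?i a *v (a *v x) = 0" by (simp add: x(2)[OF a])
          then show False using x(1) by (simp add: matrix_vector_mul_assoc inv[OF aH])
        qed
        ultimately show "w c = 1" by simp
      qed
      then have "b = a" using ca by simp
      then have "e ** (?i e ** a ** e) = e ** a" by (simp add: b_def)
      then show ?thesis by (simp add: matrix_mul_assoc inv[OF eH])
    qed
    then show "?i k \<otimes>\<^bsub>G\<^esub> l \<in> centr G K A"
      using eK by (simp add: centr_def G_simps e_def)
  qed
qed

text \<open>Commuting with y is a linear condition on y, so a maximal linearly independent subset of
  \<open>Y\<close> has the same centralizer.\<close>

lemma finite_centralizer_basis: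
  assumes "Y \<subseteq> carrier G"
  shows "\<exists>F. finite F \<and> F \<subseteq> Y \<and> centr G (carrier G) F \<subseteq> centr G (carrier G) Y"
proof -
  obtain F where F: "F \<subseteq> Y" "mat_space.independent F" "Y \<subseteq> mat_space.span F"
    using mat_space.maximal_independent_subset by metis
  have "g ** y = y ** g" if g: "\<And>x. x \<in> F \<Longrightarrow> g ** x = x ** g" and y: "y \<in> Y" for g y
  proof -
    have "y \<in> mat_space.span F" using F(3) y by blast
    then show ?thesis
    proof (induction rule: mat_space.span_induct_alt)
      case (step c x y)
      have "g ** mat_scale c x = mat_scale c (g ** x)" "mat_scale c x ** g = mat_scale c (x ** g)"
        by (simp_all add: mat_scale_def matrix_matrix_mult_def vec_eq_iff sum_distrib_left mult.left_commute mult.assoc)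
      then show ?case using step g by (simp add: matrix_matrix_mult_def vec_eq_iff distrib_left distrib_right sum.distrib)
    qed simp
  qed
  then have "centr G (carrier G) F \<subseteq> centr G (carrier G) Y"
    unfolding centr_def G_simps by blast
  with F(1) mat_space.finiteI_independent[OF F(2)] show ?thesis by blast
qed

end

section \<open>Centralizers of finite index\<close>

context group
begin

definition cnj :: "'a \<Rightarrow> 'a \<Rightarrow> 'a" where
  "cnj g x = g \<otimes> x \<otimes> inv g"

lemma cnj_closed [simp]: "g \<in> carrier G \<Longrightarrow> x \<in> carrier G \<Longrightarrow> cnj g x \<in> carrier G"
  by (simp add: cnj_def)

lemma cnj_mult: "g \<in> carrier G \<Longrightarrow> x \<in> carrier G \<Longrightarrow> y \<in> carrier G \<Longrightarrow>
    cnj g (x \<otimes> y) = cnj g x \<otimes> cnj g y"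
proof -
  assume gxy: "g \<in> carrier G" "x \<in> carrier G" "y \<in> carrier G"
  have "cnj g x \<otimes> cnj g y = g \<otimes> x \<otimes> (inv g \<otimes> g) \<otimes> y \<otimes> inv g"
    using gxy by (simp only: cnj_def m_assoc m_closed inv_closed)
  then show "cnj g (x \<otimes> y) = cnj g x \<otimes> cnj g y"
    using gxy by (simp add: cnj_def m_assoc)
qed

lemma cnj_cnj: "g \<in> carrier G \<Longrightarrow> h \<in> carrier G \<Longrightarrow> x \<in> carrier G \<Longrightarrow>
    cnj g (cnj h x) = cnj (g \<otimes> h) x"
  by (simp add: cnj_def m_assoc inv_mult_group)

lemma cnj_one [simp]: "x \<in> carrier G \<Longrightarrow> cnj \<one> x = x"
  by (simp add: cnj_def)

lemma cnj_of_one [simp]: "g \<in> carrier G \<Longrightarrow> cnj g \<one> = \<one>"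
  by (simp add: cnj_def)

lemma cnj_inv_cancel [simp]: "g \<in> carrier G \<Longrightarrow> x \<in> carrier G \<Longrightarrow> cnj (inv g) (cnj g x) = x"
  "g \<in> carrier G \<Longrightarrow> x \<in> carrier G \<Longrightarrow> cnj g (cnj (inv g) x) = x"
  by (simp_all add: cnj_cnj)

lemma cnj_eq_iff: "g \<in> carrier G \<Longrightarrow> x \<in> carrier G \<Longrightarrow> cnj g x = x \<longleftrightarrow> g \<otimes> x = x \<otimes> g"
  unfolding cnj_def by (metis inv_solve_right' m_closed)

lemma cnj_inv: "g \<in> carrier G \<Longrightarrow> x \<in> carrier G \<Longrightarrow> cnj g (inv x) = inv (cnj g x)"
  by (simp add: cnj_def m_assoc inv_mult_group)

lemma cnj_commute:
  assumes "g \<in> carrier G" "x \<in> carrier G" "y \<in> carrier G" "x \<otimes> y = y \<otimes> x"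
  shows "cnj g x \<otimes> cnj g y = cnj g y \<otimes> cnj g x"
  using assms by (metis cnj_mult)

lemma inv_cancel_middle:
  assumes "x \<in> carrier G" "y \<in> carrier G" "z \<in> carrier G"
  shows "(x \<otimes> inv y) \<otimes> (y \<otimes> z) = x \<otimes> z"
proof -
  have "(x \<otimes> inv y) \<otimes> (y \<otimes> z) = x \<otimes> (inv y \<otimes> y) \<otimes> z"
    using assms by (simp only: m_assoc m_closed inv_closed)
  then show ?thesis using assms by simp
qed

lemma centrD: "k \<in> centr G K Y \<Longrightarrow> y \<in> Y \<Longrightarrow> k \<otimes> y = y \<otimes> k" "k \<in> centr G K Y \<Longrightarrow> k \<in> K"
  by (auto simp: centr_def)

lemma centr_subgroup:
  assumes K: "subgroup K G" and Y: "Y \<subseteq> carrier G"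
  shows "subgroup (centr G K Y) G"
proof (rule subgroupI)
  show "centr G K Y \<subseteq> carrier G" using subgroup.subset[OF K] by (auto simp: centr_def)
  show "centr G K Y \<noteq> {}"
    using subgroup.one_closed[OF K] Y by (auto simp: centr_def intro!: exI[of _ \<one>])
  fix a assume a: "a \<in> centr G K Y"
  then have ac: "a \<in> carrier G" using subgroup.subset[OF K] by (auto simp: centr_def)
  have "inv a \<otimes> y = y \<otimes> inv a" if y: "y \<in> Y" for y
  proof -
    have yc: "y \<in> carrier G" using y Y by blast
    have "cnj a y = y" using centrD(1)[OF a y] cnj_eq_iff[OF ac yc] by simp
    then have "cnj (inv a) y = y" using cnj_inv_cancel(1)[OF ac yc] by simp
    then show ?thesis using cnj_eq_iff[of "inv a" y] ac yc by simp
  qed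
  then show "inv a \<in> centr G K Y" using a subgroup.m_inv_closed[OF K] by (auto simp: centr_def)
  fix b assume b: "b \<in> centr G K Y"
  then have bc: "b \<in> carrier G" using subgroup.subset[OF K] by (auto simp: centr_def)
  have "a \<otimes> b \<otimes> y = y \<otimes> (a \<otimes> b)" if y: "y \<in> Y" for y
  proof -
    have yc: "y \<in> carrier G" using y Y by blast
    have "a \<otimes> b \<otimes> y = a \<otimes> (y \<otimes> b)" using centrD(1)[OF b y] ac bc yc by (simp add: m_assoc)
    also have "\<dots> = y \<otimes> a \<otimes> b" using centrD(1)[OF a y] ac bc yc by (simp add: m_assoc[symmetric])
    finally show ?thesis using ac bc yc by (simp add: m_assoc)
  qed
  then show "a \<otimes> b \<in> centr G K Y" using a b subgroup.m_closed[OF K] by (auto simp: centr_def)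
qed

lemma centr_cnj:
  assumes D: "D \<subseteq> carrier G" and K: "subgroup K G" and g: "g \<in> carrier G"
    and gK: "\<And>k. k \<in> K \<Longrightarrow> cnj g k \<in> K" and gD: "\<And>d. d \<in> D \<Longrightarrow> cnj (inv g) d \<in> D"
    and k: "k \<in> centr G K D"
  shows "cnj g k \<in> centr G K D"
proof -
  have kK: "k \<in> K" and kc: "k \<in> carrier G" using k subgroup.subset[OF K] by (auto simp: centr_def)
  have "cnj g k \<otimes> d = d \<otimes> cnj g k" if d: "d \<in> D" for d
  proof -
    have dc: "d \<in> carrier G" using d D by blast
    have "k \<otimes> cnj (inv g) d = cnj (inv g) d \<otimes> k" using centrD(1)[OF k gD[OF d]] .
    from cnj_commute[OF g kc _ this] show ?thesis using g dc by simp
  qed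
  then show ?thesis using gK[OF kK] by (simp add: centr_def)
qed

lemma finite_idx_mono:
  assumes "finite_idx G K C" "subgroup C G" "subgroup D G" "C \<subseteq> D" "K \<subseteq> carrier G"
  shows "finite_idx G K D"
proof (rule finite_idxI[where \<theta> = "\<lambda>k. k <# C"])
  show "finite ((\<lambda>k. k <# C) ` K)" using assms(1) unfolding finite_idx_def .
  show "inv k \<otimes> l \<in> D" if "k \<in> K" "l \<in> K" "k <# C = l <# C" for k l
    using l_coset_eq_imp[OF assms(2)] that assms by blast
qed (use assms in auto)

lemma finite_idxI_cover:
  assumes C: "subgroup C G" and K: "K \<subseteq> carrier G" and F: "finite F" "F \<subseteq> carrier G"
    and cover: "K \<subseteq> (\<Union>f\<in>F. f <# C)"
  shows "finite_idx G K C"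
proof -
  have "\<forall>k\<in>K. \<exists>f. f \<in> F \<and> k \<in> f <# C" using cover by blast
  then obtain \<theta> where \<theta>: "\<And>k. k \<in> K \<Longrightarrow> \<theta> k \<in> F \<and> k \<in> \<theta> k <# C" by metis
  show ?thesis
  proof (rule finite_idxI[OF C K, where \<theta> = \<theta>])
    show "finite (\<theta> ` K)" using \<theta> F(1) by (meson finite_subset image_subsetI)
    fix k l assume kl: "k \<in> K" "l \<in> K" "\<theta> k = \<theta> l"
    define f where "f = \<theta> k"
    have f: "f \<in> carrier G" using \<theta>[OF kl(1)] F(2) unfolding f_def by blast
    have "k \<in> f <# C" "l \<in> f <# C" unfolding f_def using \<theta>[OF kl(1)] \<theta>[OF kl(2)] kl(3) by simp_all
    then obtain c d where c: "c \<in> C" "k = f \<otimes> c" and d: "d \<in> C" "l = f \<otimes> d"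
      unfolding l_coset_def by blast
    have cc: "c \<in> carrier G" "d \<in> carrier G" using c d subgroup.subset[OF C] by auto
    have "inv k \<otimes> l = inv c \<otimes> (inv f \<otimes> f) \<otimes> d"
      unfolding c(2) d(2) using f cc by (simp only: m_assoc inv_mult_group m_closed inv_closed)
    also have "\<dots> = inv c \<otimes> d" using f cc by simp
    finally show "inv k \<otimes> l \<in> C"
      using c d subgroup.m_closed[OF C] subgroup.m_inv_closed[OF C] by simp
  qed
qed

lemma finite_idx_trans:
  assumes "finite_idx G K L" "finite_idx G L C" "subgroup L G" "subgroup C G" "K \<subseteq> carrier G"
  shows "finite_idx G K C"
proof -
  have Lc: "L \<subseteq> carrier G" using subgroup.subset[OF assms(3)] .
  obtain F where F: "finite F" "F \<subseteq> K" "K \<subseteq> (\<Union>f\<in>F. f <# L)"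
    using finite_idx_cover[OF assms(1,3,5)] by blast
  obtain E where E: "finite E" "E \<subseteq> L" "L \<subseteq> (\<Union>f\<in>E. f <# C)"
    using finite_idx_cover[OF assms(2,4) Lc] by blast
  show ?thesis
  proof (rule finite_idxI_cover[OF assms(4,5)])
    show "finite ((\<lambda>(f, e). f \<otimes> e) ` (F \<times> E))" using F E by simp
    have "F \<subseteq> carrier G" "E \<subseteq> carrier G" using F(2) E(2) Lc assms(5) by blast+
    then show "(\<lambda>(f, e). f \<otimes> e) ` (F \<times> E) \<subseteq> carrier G" by auto
    show "K \<subseteq> (\<Union>f\<in>(\<lambda>(f, e). f \<otimes> e) ` (F \<times> E). f <# C)"
    proof
      fix k assume "k \<in> K"
      then obtain f l where f: "f \<in> F" "l \<in> L" "k = f \<otimes> l" using F(3) unfolding l_coset_def by blast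
      then obtain e c where e: "e \<in> E" "c \<in> C" "l = e \<otimes> c" using E(3) unfolding l_coset_def by blast
      have "f \<in> carrier G" "e \<in> carrier G" "c \<in> carrier G"
        using f e F E Lc assms(5) subgroup.subset[OF assms(4)] by auto
      then have "k = (f \<otimes> e) \<otimes> c" using f e by (simp add: m_assoc)
      then have "k \<in> (f \<otimes> e) <# C" using e unfolding l_coset_def by blast
      then show "k \<in> (\<Union>f\<in>(\<lambda>(f, e). f \<otimes> e) ` (F \<times> E). f <# C)" using f e by auto
    qed
  qed
qed

text \<open>Conjugation by \<open>g\<close> is an automorphism of \<open>K\<close> that carries the
  centralizer of \<open>x\<close> to that of \<open>cnj g x\<close>, so the index is
  unchanged.\<close>

lemma finite_idx_centr_cnj:
  assumes fin: "finite_idx G K (centr G K {x})" and K: "subgroup K G" and x: "x \<in> carrier G"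
    and g: "g \<in> carrier G" and gK: "\<And>k. k \<in> K \<Longrightarrow> cnj g k \<in> K" "\<And>k. k \<in> K \<Longrightarrow> cnj (inv g) k \<in> K"
  shows "finite_idx G K (centr G K {cnj g x})"
proof (rule finite_idxI[where \<theta> = "\<lambda>k. cnj (inv g) k <# centr G K {x}"])
  have Kc: "K \<subseteq> carrier G" using subgroup.subset[OF K] .
  show "subgroup (centr G K {cnj g x}) G" using centr_subgroup[OF K] x g by simp
  show "K \<subseteq> carrier G" by (rule Kc)
  have "(\<lambda>k. cnj (inv g) k <# centr G K {x}) ` K \<subseteq> (\<lambda>k. k <# centr G K {x}) ` K"
    using gK(2) by blast
  then show "finite ((\<lambda>k. cnj (inv g) k <# centr G K {x}) ` K)"
    using fin unfolding finite_idx_def by (rule finite_subset)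
  fix k l assume kl: "k \<in> K" "l \<in> K" "cnj (inv g) k <# centr G K {x} = cnj (inv g) l <# centr G K {x}"
  have klc: "k \<in> carrier G" "l \<in> carrier G" using kl Kc by auto
  have "subgroup (centr G K {x}) G" using centr_subgroup[OF K] x by simp
  from l_coset_eq_imp[OF this _ _ kl(3)]
  have "inv (cnj (inv g) k) \<otimes> cnj (inv g) l \<in> centr G K {x}" using klc g by simp
  then have "cnj (inv g) (inv k \<otimes> l) \<in> centr G K {x}"
    using klc g by (simp add: cnj_mult cnj_inv)
  then have "cnj (inv g) (inv k \<otimes> l) \<otimes> x = x \<otimes> cnj (inv g) (inv k \<otimes> l)"
    by (simp add: centr_def)
  from cnj_commute[OF g _ x this] have "(inv k \<otimes> l) \<otimes> cnj g x = cnj g x \<otimes> (inv k \<otimes> l)"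
    using klc g by simp
  then show "inv k \<otimes> l \<in> centr G K {cnj g x}"
    using kl subgroup.m_closed[OF K] subgroup.m_inv_closed[OF K] by (simp add: centr_def)
qed

end

text \<open>These are \<open>abelian_normalizer\<close> and \<open>finite_centralizer_basis\<close>
  as axioms, so that the group theory can be done without matrices.\<close>

locale centralizer_finite_group = group +
  assumes abelian_normalizer_finite_idx:
    "\<And>A K. subgroup A G \<Longrightarrow> (\<And>a b. a \<in> A \<Longrightarrow> b \<in> A \<Longrightarrow> a \<otimes> b = b \<otimes> a) \<Longrightarrow> subgroup K G \<Longrightarrow>
      (\<And>k a. k \<in> K \<Longrightarrow> a \<in> A \<Longrightarrow> k \<otimes> a \<otimes> inv k \<in> A) \<Longrightarrow> finite_idx G K (centr G K A)"
    and finite_centralizer_set: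
    "\<And>Y. Y \<subseteq> carrier G \<Longrightarrow> \<exists>F. finite F \<and> F \<subseteq> Y \<and> centr G (carrier G) F \<subseteq> centr G (carrier G) Y"
begin

text \<open>\<open>Y\<close> may be infinite, but a finite subset already cuts out its centralizer,
  which leaves a finite intersection of subgroups of finite index.\<close>

lemma finite_idx_centr:
  assumes K: "subgroup K G" and Y: "Y \<subseteq> carrier G"
    and fin: "\<And>y. y \<in> Y \<Longrightarrow> finite_idx G K (centr G K {y})"
  shows "finite_idx G K (centr G K Y)"
proof -
  have Kc: "K \<subseteq> carrier G" using subgroup.subset[OF K] .
  obtain F where F: "finite F" "F \<subseteq> Y" "centr G (carrier G) F \<subseteq> centr G (carrier G) Y"
    using finite_centralizer_set[OF Y] by blast
  define \<theta> where "\<theta> k = (\<lambda>y\<in>F. k <# centr G K {y})" for k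
  show ?thesis
  proof (rule finite_idxI[where \<theta> = \<theta>])
    show "subgroup (centr G K Y) G" by (rule centr_subgroup[OF K Y])
    show "K \<subseteq> carrier G" by (rule Kc)
    have "\<theta> ` K \<subseteq> (\<Pi>\<^sub>E y\<in>F. (\<lambda>k. k <# centr G K {y}) ` K)" by (auto simp: \<theta>_def)
    then show "finite (\<theta> ` K)"
      by (rule finite_subset) (intro finite_PiE F(1), use fin F(2) in \<open>auto simp: finite_idx_def\<close>)
    fix k l assume kl: "k \<in> K" "l \<in> K" "\<theta> k = \<theta> l"
    have klK: "inv k \<otimes> l \<in> K" using kl subgroup.m_closed[OF K] subgroup.m_inv_closed[OF K] by simp
    have "inv k \<otimes> l \<otimes> y = y \<otimes> (inv k \<otimes> l)" if y: "y \<in> F" for y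
    proof -
      have "k <# centr G K {y} = l <# centr G K {y}" using fun_cong[OF kl(3), of y] y by (simp add: \<theta>_def)
      moreover have "subgroup (centr G K {y}) G" using centr_subgroup[OF K, of "{y}"] y F(2) Y by auto
      ultimately have "inv k \<otimes> l \<in> centr G K {y}" using l_coset_eq_imp kl Kc by blast
      then show ?thesis by (simp add: centr_def)
    qed
    then have "inv k \<otimes> l \<in> centr G (carrier G) F" using klK Kc by (auto simp: centr_def)
    then have "inv k \<otimes> l \<in> centr G (carrier G) Y" using F(3) by blast
    then show "inv k \<otimes> l \<in> centr G K Y" using klK by (simp add: centr_def)
  qed
qed

section \<open>Abelian normal subgroups of nilpotent groups\<close>

definition normalized_abelian :: "'a set \<Rightarrow> 'a set \<Rightarrow> bool" where
  "normalized_abelian U A \<longleftrightarrow> subgroup A G \<and> A \<subseteq> U \<and> (\<forall>a\<in>A. \<forall>b\<in>A. a \<otimes> b = b \<otimes> a) \<and>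
     (\<forall>u\<in>U. \<forall>a\<in>A. cnj u a \<in> A)"

lemma ex_maximal_normalized_abelian:
  assumes U: "subgroup U G"
  obtains A where "normalized_abelian U A" "\<And>A'. normalized_abelian U A' \<Longrightarrow> A \<subseteq> A' \<Longrightarrow> A' = A"
proof -
  let ?A = "{A. normalized_abelian U A}"
  have Uc: "U \<subseteq> carrier G" using subgroup.subset[OF U] .
  have "normalized_abelian U {\<one>}"
    unfolding normalized_abelian_def
    using triv_subgroup subgroup.one_closed[OF U] Uc by auto
  then have ne: "?A \<noteq> {}" by blast
  have "\<exists>M\<in>?A. \<forall>A\<in>?A. M \<subseteq> A \<longrightarrow> A = M"
  proof (rule subset_Zorn_nonempty[OF ne])
    fix C assume C: "C \<noteq> {}" "subset.chain ?A C"
    then have "normalized_abelian U A" if "A \<in> C" for A using that by (auto simp: subset_chain_def)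
    then have mem: "subgroup A G" "A \<subseteq> U" "\<And>a b. a \<in> A \<Longrightarrow> b \<in> A \<Longrightarrow> a \<otimes> b = b \<otimes> a"
      "\<And>u a. u \<in> U \<Longrightarrow> a \<in> A \<Longrightarrow> cnj u a \<in> A" if "A \<in> C" for A
      using that unfolding normalized_abelian_def by blast+
    have common: "\<exists>A\<in>C. a \<in> A \<and> b \<in> A" if "a \<in> \<Union>C" "b \<in> \<Union>C" for a b
      using that C(2) unfolding subset_chain_def by blast
    have CU: "\<Union>C \<subseteq> U" using mem(2) by blast
    have "subgroup (\<Union>C) G"
    proof (rule subgroupI)
      show "\<Union>C \<subseteq> carrier G" using CU Uc by blast
      obtain A where A: "A \<in> C" using C(1) by blast
      then show "\<Union>C \<noteq> {}" using subgroup.one_closed[OF mem(1)[OF A]] by blast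
      fix a assume a: "a \<in> \<Union>C"
      then obtain A where "A \<in> C" "a \<in> A" by blast
      then show "inv a \<in> \<Union>C" using subgroup.m_inv_closed[OF mem(1)] by blast
      fix b assume "b \<in> \<Union>C"
      then obtain A where "A \<in> C" "a \<in> A" "b \<in> A" using common a by blast
      then show "a \<otimes> b \<in> \<Union>C" using subgroup.m_closed[OF mem(1)] by blast
    qed
    moreover have "a \<otimes> b = b \<otimes> a" if ab: "a \<in> \<Union>C" "b \<in> \<Union>C" for a b
    proof -
      obtain A where "A \<in> C" "a \<in> A" "b \<in> A" using common[OF ab] by blast
      then show ?thesis using mem(3) by blast
    qed
    moreover have "cnj u a \<in> \<Union>C" if "u \<in> U" "a \<in> \<Union>C" for u a
      using that mem(4) by blast
    moreover note CU
    ultimately show "\<Union>C \<in> ?A" unfolding normalized_abelian_def by (intro CollectI conjI ballI)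
  qed
  then show thesis using that by blast
qed

text \<open>A maximal abelian normal subgroup of a nilpotent group is its own centralizer: otherwise take
  the last term of the lower central series containing an element \<open>x\<close> of the centralizer outside
  \<open>A\<close>; then \<open>A\<close> and \<open>x\<close> lie in a larger abelian normal subgroup.\<close>

lemma maximal_normalized_abelian_self_centralizing:
  assumes U: "subgroup U G" and nil: "nilpotent_group (G\<lparr>carrier := U\<rparr>)"
    and A: "normalized_abelian U A" and maximal: "\<And>A'. normalized_abelian U A' \<Longrightarrow> A \<subseteq> A' \<Longrightarrow> A' = A"
  shows "centr G U A \<subseteq> A"
proof (rule ccontr)
  assume neg: "\<not> centr G U A \<subseteq> A"
  have Uc: "U \<subseteq> carrier G" using subgroup.subset[OF U] .
  have Asub: "subgroup A G" "A \<subseteq> U" and Acom: "\<And>a b. a \<in> A \<Longrightarrow> b \<in> A \<Longrightarrow> a \<otimes> b = b \<otimes> a"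
    and Anorm: "\<And>u a. u \<in> U \<Longrightarrow> a \<in> A \<Longrightarrow> cnj u a \<in> A"
    using A unfolding normalized_abelian_def by auto
  have Ac: "A \<subseteq> carrier G" using Asub Uc by blast
  have uU: "cnj u v \<in> U" "cnj (inv u) v \<in> U" if "u \<in> U" "v \<in> U" for u v
    unfolding cnj_def using that subgroup.m_closed[OF U] subgroup.m_inv_closed[OF U] Uc by auto
  let ?L = "lower_central (G\<lparr>carrier := U\<rparr>)"
  obtain n where n: "?L n = {\<one>}" using nil unfolding nilpotent_group_def by auto
  let ?P = "\<lambda>j. centr G U A \<inter> ?L j \<subseteq> A"
  have "\<not> ?P 0" using neg by (auto simp: centr_def)
  have Pn: "?P n" using n subgroup.one_closed[OF Asub(1)] by auto
  have "\<exists>j. \<not> ?P j \<and> ?P (Suc j)"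
  proof (rule ccontr)
    assume *: "\<nexists>j. \<not> ?P j \<and> ?P (Suc j)"
    have "\<not> ?P i" for i by (induction i) (use \<open>\<not> ?P 0\<close> * in blast)+
    with Pn show False by blast
  qed
  then obtain j where j: "\<not> ?P j" "?P (Suc j)" by blast
  then obtain x where x: "x \<in> centr G U A" "x \<in> ?L j" "x \<notin> A" by blast
  have xU: "x \<in> U" and xc: "x \<in> carrier G" using x Uc by (auto simp: centr_def)
  have Cnorm: "cnj u c \<in> centr G U A" if "u \<in> U" "c \<in> centr G U A" for u c
    by (rule centr_cnj[OF Ac U]) (use that Uc uU Anorm subgroup.m_inv_closed[OF U] in auto)
  have xcnj: "cnj u x \<otimes> inv x \<in> A" if u: "u \<in> U" for u
  proof -
    have "u \<otimes> x \<otimes> inv u \<otimes> inv x \<in> ?L (Suc j)"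
      unfolding lower_central.simps
      by (intro generate.incl CollectI exI[of _ u] exI[of _ x]) (use u x(2) xU U in simp)
    moreover have "cnj u x \<otimes> inv x \<in> centr G U A"
      using Cnorm[OF u x(1)] subgroup.m_closed[OF centr_subgroup[OF U Ac]]
        subgroup.m_inv_closed[OF centr_subgroup[OF U Ac] x(1)] by blast
    ultimately show ?thesis using j(2) unfolding cnj_def by blast
  qed
  define Y where "Y = insert x A"
  have Yc: "Y \<subseteq> carrier G" and YU: "Y \<subseteq> U" unfolding Y_def using xc xU Ac Asub by auto
  define D where "D = centr G U Y"
  have Dsub: "subgroup D G" unfolding D_def by (rule centr_subgroup[OF U Yc])
  have Dc: "D \<subseteq> carrier G" using subgroup.subset[OF Dsub] .
  \<comment> \<open>The double centralizer of the commuting set \<open>Y\<close> stands for the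
    subgroup generated by \<open>A\<close> and \<open>x\<close>: from Y \<subseteq> D follows A2
    \<subseteq> D, so it is abelian, and it is normalized by \<open>U\<close> because
    \<open>D\<close> is.\<close>
  define A2 where "A2 = centr G U D"
  have YD: "Y \<subseteq> D"
  proof
    fix y assume y: "y \<in> Y"
    have "y \<otimes> z = z \<otimes> y" if "z \<in> Y" for z
      using y that x(1) Acom unfolding Y_def centr_def by auto
    then show "y \<in> D" using y YU unfolding D_def centr_def by blast
  qed
  have YA2: "Y \<subseteq> A2"
    using YU unfolding A2_def D_def by (auto simp: centr_def)
  have A2D: "A2 \<subseteq> D"
  proof
    fix a assume a: "a \<in> A2"
    then have "a \<otimes> y = y \<otimes> a" if "y \<in> Y" for y using that YD unfolding A2_def by (auto simp: centr_def)
    then show "a \<in> D" using a unfolding A2_def D_def by (auto simp: centr_def)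
  qed
  \<comment> \<open>Conjugation by elements of \<open>U\<close> preserves \<open>A\<close> and moves
    \<open>x\<close> only by a factor in \<open>A\<close>, so it preserves the condition of
    commuting with both.\<close>
  have Dnorm: "cnj u d \<in> D" if u: "u \<in> U" and d: "d \<in> D" for u d
  proof -
    have dU: "d \<in> U" and dc: "d \<in> carrier G" using d Dc unfolding D_def by (auto simp: centr_def)
    have uc: "u \<in> carrier G" and iu: "inv u \<in> U" using u Uc subgroup.m_inv_closed[OF U] by auto
    have "d \<otimes> cnj (inv u) y = cnj (inv u) y \<otimes> d" if y: "y \<in> Y" for y
    proof (cases "y \<in> A")
      case True
      then have "cnj (inv u) y \<in> Y" using Anorm[OF iu] unfolding Y_def by blast
      then show ?thesis using d unfolding D_def by (auto simp: centr_def)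
    next
      case False
      then have y: "y = x" using y unfolding Y_def by blast
      let ?a = "cnj (inv u) x \<otimes> inv x"
      have a: "?a \<in> A" by (rule xcnj[OF iu])
      have e: "cnj (inv u) x = ?a \<otimes> x" using uc xc by (simp add: m_assoc)
      have ac: "?a \<in> carrier G" using a Ac by blast
      have "?a \<in> Y" "x \<in> Y" using a unfolding Y_def by auto
      then have "?a \<otimes> d = d \<otimes> ?a" "x \<otimes> d = d \<otimes> x" using d unfolding D_def by (auto simp: centr_def)
      then have "?a \<otimes> x \<otimes> d = d \<otimes> (?a \<otimes> x)"
        using ac xc dc by (metis m_assoc)
      then show ?thesis unfolding y by (subst (1 2) e) simp
    qed
    then have "cnj u d \<otimes> y = y \<otimes> cnj u d" if y: "y \<in> Y" for y
      using cnj_commute[OF uc dc, of "cnj (inv u) y"] y Yc uc by (metis cnj_closed cnj_inv_cancel(2) inv_closed subsetD)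
    then show ?thesis using uU(1)[OF u dU] unfolding D_def by (simp add: centr_def)
  qed
  have "normalized_abelian U A2"
    unfolding normalized_abelian_def
  proof (intro conjI ballI)
    show "subgroup A2 G" unfolding A2_def by (rule centr_subgroup[OF U Dc])
    show "A2 \<subseteq> U" unfolding A2_def by (auto simp: centr_def)
    show "a \<otimes> b = b \<otimes> a" if "a \<in> A2" "b \<in> A2" for a b
      using that A2D unfolding A2_def by (auto simp: centr_def)
    show "cnj u a \<in> A2" if "u \<in> U" "a \<in> A2" for u a
      unfolding A2_def
      by (rule centr_cnj[OF Dc U]) (use that Uc uU Dnorm subgroup.m_inv_closed[OF U] in \<open>auto simp: A2_def\<close>)
  qed
  from maximal[OF this] have "A2 = A" using YA2 unfolding Y_def by blast
  then show False using YA2 x(3) unfolding Y_def by blast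
qed

text \<open>A maximal abelian normal subgroup A of \<open>U\<close> contains its own centralizer and
  thus has finite index by \<open>abelian_normalizer_finite_idx\<close>, but \<open>B\<close> need
  not normalize it. The centralizer in \<open>U\<close> of all \<open>B\<close>-conjugates of A is
  normalized by \<open>B\<close>, lies in A, and has finite index since the centralizer of each
  single conjugate does.\<close>

lemma nilpotent_virtually_abelian:
  assumes B: "subgroup B G" and U: "subgroup U G" "U \<subseteq> B" and norm: "\<And>b u. b \<in> B \<Longrightarrow> u \<in> U \<Longrightarrow> cnj b u \<in> U"
    and nil: "nilpotent_group (G\<lparr>carrier := U\<rparr>)"
  obtains V where "normalized_abelian B V" "V \<subseteq> U" "finite_idx G U V"
proof -
  have Bc: "B \<subseteq> carrier G" and Uc: "U \<subseteq> carrier G" using subgroup.subset B U(1) by blast+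
  obtain A where A: "normalized_abelian U A" "\<And>A'. normalized_abelian U A' \<Longrightarrow> A \<subseteq> A' \<Longrightarrow> A' = A"
    using ex_maximal_normalized_abelian[OF U(1)] by blast
  have Asub: "subgroup A G" "A \<subseteq> U" and Acom: "\<And>a b. a \<in> A \<Longrightarrow> b \<in> A \<Longrightarrow> a \<otimes> b = b \<otimes> a"
    and Anorm: "\<And>u a. u \<in> U \<Longrightarrow> a \<in> A \<Longrightarrow> cnj u a \<in> A"
    using A(1) unfolding normalized_abelian_def by auto
  have Ac: "A \<subseteq> carrier G" using Asub Uc by blast
  have self: "centr G U A \<subseteq> A"
    using maximal_normalized_abelian_self_centralizing[OF U(1) nil A] .
  have finA: "finite_idx G U (centr G U A)"
    by (rule abelian_normalizer_finite_idx) (use Asub U Acom Anorm in \<open>auto simp: cnj_def\<close>)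
  define Y where "Y = {cnj b a | b a. b \<in> B \<and> a \<in> A}"
  have Yc: "Y \<subseteq> carrier G" unfolding Y_def using Bc Ac cnj_closed by blast
  have AY: "A \<subseteq> Y"
  proof
    fix a assume "a \<in> A"
    then have "a = cnj \<one> a \<and> \<one> \<in> B \<and> a \<in> A" using Ac subgroup.one_closed[OF B] by auto
    then show "a \<in> Y" unfolding Y_def by blast
  qed
  define V where "V = centr G U Y"
  have Vsub: "subgroup V G" unfolding V_def by (rule centr_subgroup[OF U(1) Yc])
  have VA: "V \<subseteq> A" using self AY unfolding V_def by (auto simp: centr_def)
  have finV: "finite_idx G U V"
    unfolding V_def
  proof (rule finite_idx_centr[OF U(1) Yc])
    fix y assume "y \<in> Y"
    then obtain b a where ba: "y = cnj b a" "b \<in> B" "a \<in> A" unfolding Y_def by blast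
    have "centr G U A \<subseteq> centr G U {a}" using ba by (auto simp: centr_def)
    then have "finite_idx G U (centr G U {a})"
      using finite_idx_mono[OF finA] centr_subgroup[OF U(1) Ac] centr_subgroup[OF U(1), of "{a}"] ba Ac Uc by auto
    then show "finite_idx G U (centr G U {y})"
      unfolding ba(1)
      by (rule finite_idx_centr_cnj[OF _ U(1)]) (use ba Ac Bc norm subgroup.m_inv_closed[OF B] in auto)
  qed
  have "V \<subseteq> U" unfolding V_def by (auto simp: centr_def)
  have "cnj b v \<in> V" if "b \<in> B" "v \<in> V" for b v
    unfolding V_def
  proof (rule centr_cnj[OF Yc U(1)])
    fix y assume "y \<in> Y"
    then obtain c a where ca: "y = cnj c a" "c \<in> B" "a \<in> A" unfolding Y_def by blast
    have "cnj (inv b) y = cnj (inv b \<otimes> c) a"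
      unfolding ca(1) using subsetD[OF Bc] subsetD[OF Ac] that(1) ca(2,3) by (simp add: cnj_cnj)
    moreover have "inv b \<otimes> c \<in> B" using that ca subgroup.m_closed[OF B] subgroup.m_inv_closed[OF B] by blast
    ultimately show "cnj (inv b) y \<in> Y" using ca unfolding Y_def by blast
  qed (use that norm Bc in \<open>auto simp: V_def\<close>)
  moreover have "a \<otimes> b = b \<otimes> a" if "a \<in> V" "b \<in> V" for a b
    using Acom VA that by blast
  ultimately have "normalized_abelian B V"
    unfolding normalized_abelian_def using Vsub U(2) \<open>V \<subseteq> U\<close> by (intro conjI ballI) auto
  then show thesis by (rule that) (rule \<open>V \<subseteq> U\<close>, rule finV)
qed

end

text \<open>The axiom is the abstract form of connectedness: centralizers are Zariski-closed, and a
  connected group has no proper closed subgroup of finite index.\<close>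

locale connected_centralizer_finite_group = centralizer_finite_group +
  assumes central_if_finite_idx: "\<And>x g. x \<in> carrier G \<Longrightarrow> finite_idx G (carrier G) (centr G (carrier G) {x}) \<Longrightarrow>
    g \<in> carrier G \<Longrightarrow> g \<otimes> x = x \<otimes> g"
begin

text \<open>Elements of \<open>K\<close> move \<open>x\<close> by factors in the center
  \<open>centr G N N\<close> of \<open>N\<close>, so \<open>K\<close> normalizes the centralizer D
  of \<open>x\<close> in \<open>N\<close> and the centralizer A of D in \<open>N\<close>. Since
  \<open>x\<close> is in D, A is contained in D and so abelian, and it contains \<open>x\<close>;
  apply \<open>abelian_normalizer_finite_idx\<close> to A.\<close>

lemma finite_idx_centr_of_commutators:
  assumes K: "subgroup K G" and N: "subgroup N G" and x: "x \<in> N"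
    and KN: "\<And>k n. k \<in> K \<Longrightarrow> n \<in> N \<Longrightarrow> cnj k n \<in> N"
    and comm: "\<And>k. k \<in> K \<Longrightarrow> cnj k x \<otimes> inv x \<in> centr G N N"
  shows "finite_idx G K (centr G K {x})"
proof -
  have Kc: "K \<subseteq> carrier G" and Nc: "N \<subseteq> carrier G" using subgroup.subset K N by blast+
  have xc: "x \<in> carrier G" using x Nc by blast
  define D where "D = centr G N {x}"
  have Dsub: "subgroup D G" unfolding D_def using centr_subgroup[OF N] xc by simp
  have Dc: "D \<subseteq> carrier G" using subgroup.subset[OF Dsub] .
  define A where "A = centr G N D"
  have Asub: "subgroup A G" unfolding A_def by (rule centr_subgroup[OF N Dc])
  have Ac: "A \<subseteq> carrier G" using subgroup.subset[OF Asub] .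
  have xD: "x \<in> D" using x by (auto simp: D_def centr_def)
  have xA: "x \<in> A" using x by (auto simp: A_def D_def centr_def)
  have AD: "A \<subseteq> D" using xD by (auto simp: A_def D_def centr_def)
  have Dnorm: "cnj k d \<in> D" if k: "k \<in> K" and d: "d \<in> D" for k d
  proof -
    have kc: "k \<in> carrier G" and ik: "inv k \<in> K" using k Kc subgroup.m_inv_closed[OF K] by auto
    have dN: "d \<in> N" and dc: "d \<in> carrier G" and dx: "d \<otimes> x = x \<otimes> d"
      using d Dc by (auto simp: D_def centr_def)
    let ?z = "cnj (inv k) x \<otimes> inv x"
    have z: "?z \<in> centr G N N" by (rule comm[OF ik])
    have zc: "?z \<in> carrier G" using kc xc by simp
    have e: "cnj (inv k) x = ?z \<otimes> x" using kc xc by (simp add: m_assoc)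
    have "?z \<otimes> d = d \<otimes> ?z" using z dN by (auto simp: centr_def)
    then have "d \<otimes> (?z \<otimes> x) = ?z \<otimes> x \<otimes> d" using zc dc xc dx by (metis m_assoc)
    then have "d \<otimes> cnj (inv k) x = cnj (inv k) x \<otimes> d" by (subst (1 2) e) simp
    from cnj_commute[OF kc dc _ this] have "cnj k d \<otimes> x = x \<otimes> cnj k d" using kc xc by simp
    then show ?thesis using KN[OF k dN] by (simp add: D_def centr_def)
  qed
  have "finite_idx G K (centr G K A)"
  proof (rule abelian_normalizer_finite_idx[OF Asub _ K])
    show "a \<otimes> b = b \<otimes> a" if "a \<in> A" "b \<in> A" for a b using that AD by (auto simp: A_def centr_def)
    show "k \<otimes> a \<otimes> inv k \<in> A" if "k \<in> K" "a \<in> A" for k a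
      unfolding cnj_def[symmetric] A_def
      by (rule centr_cnj[OF Dc N])
        (use that Kc KN Dnorm subgroup.m_inv_closed[OF K] in \<open>auto simp: A_def\<close>)
  qed
  then show ?thesis
    by (rule finite_idx_mono) (use centr_subgroup[OF K Ac] centr_subgroup[OF K, of "{x}"] xc xA Kc in \<open>auto simp: centr_def\<close>)
qed

text \<open>Let Z be the center of \<open>N\<close>. The preceding lemma, applied to
  \<open>N\<close> acting on itself, makes N/Z finite, so the stabilizer K of the coset x Z under
  conjugation has finite index. Applied to K, it gives the centralizer of \<open>x\<close> finite
  index in K, hence in the whole group, and \<open>central_if_finite_idx\<close> finishes.\<close>

lemma central_if_commutators_central:
  assumes N: "subgroup N G" and norm: "\<And>g n. g \<in> carrier G \<Longrightarrow> n \<in> N \<Longrightarrow> cnj g n \<in> N"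
    and comm: "\<And>m n g. m \<in> N \<Longrightarrow> n \<in> N \<Longrightarrow> g \<in> carrier G \<Longrightarrow> g \<otimes> (cnj m n \<otimes> inv n) = (cnj m n \<otimes> inv n) \<otimes> g"
    and x: "x \<in> N" and g: "g \<in> carrier G"
  shows "g \<otimes> x = x \<otimes> g"
proof -
  have Nc: "N \<subseteq> carrier G" using subgroup.subset N by blast
  have xc: "x \<in> carrier G" using x Nc by blast
  define Z where "Z = centr G N N"
  have Zsub: "subgroup Z G" unfolding Z_def by (rule centr_subgroup[OF N Nc])
  have Zc: "Z \<subseteq> carrier G" using subgroup.subset[OF Zsub] .
  have finZ: "finite_idx G N Z"
    unfolding Z_def
  proof (rule finite_idx_centr[OF N Nc])
    fix y assume y: "y \<in> N"
    show "finite_idx G N (centr G N {y})"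
    proof (rule finite_idx_centr_of_commutators[OF N N y])
      fix k assume k: "k \<in> N"
      show "cnj k n \<in> N" if "n \<in> N" for n using norm that k Nc by blast
      have "cnj k y \<otimes> inv y \<in> N"
        using norm[of k y] k y Nc subgroup.m_closed[OF N] subgroup.m_inv_closed[OF N] by blast
      then show "cnj k y \<otimes> inv y \<in> centr G N N"
        using comm[OF k y] Nc unfolding centr_def by (auto simp: subset_iff)
    qed
  qed
  have Znorm: "cnj g z \<in> Z" if "g \<in> carrier G" "z \<in> Z" for g z
    unfolding Z_def by (rule centr_cnj[OF Nc N]) (use that norm in \<open>auto simp: Z_def\<close>)
  define K where "K = {k \<in> carrier G. cnj k x \<otimes> inv x \<in> Z}"
  have K: "subgroup K G"
  proof (rule subgroupI)
    show "K \<subseteq> carrier G" by (auto simp: K_def)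
    have "\<one> \<in> K" using xc subgroup.one_closed[OF Zsub] by (simp add: K_def)
    then show "K \<noteq> {}" by blast
    fix a assume a: "a \<in> K"
    then have ac: "a \<in> carrier G" and az: "cnj a x \<otimes> inv x \<in> Z" by (auto simp: K_def)
    have "cnj (inv a) (inv (cnj a x \<otimes> inv x)) \<in> Z"
      using Znorm subgroup.m_inv_closed[OF Zsub az] ac by simp
    moreover have "cnj (inv a) (inv (cnj a x \<otimes> inv x)) = cnj (inv a) x \<otimes> inv x"
      using ac xc by (simp add: inv_mult_group cnj_mult cnj_inv)
    ultimately show "inv a \<in> K" using ac by (simp add: K_def)
    fix b assume b: "b \<in> K"
    then have bc: "b \<in> carrier G" and bz: "cnj b x \<otimes> inv x \<in> Z" by (auto simp: K_def)
    have "cnj a (cnj b x \<otimes> inv x) \<otimes> (cnj a x \<otimes> inv x) \<in> Z"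
      using subgroup.m_closed[OF Zsub Znorm[OF ac bz] az] .
    moreover have "cnj a (cnj b x \<otimes> inv x) \<otimes> (cnj a x \<otimes> inv x) = cnj (a \<otimes> b) x \<otimes> inv x"
    proof -
      have "cnj a (cnj b x \<otimes> inv x) = cnj (a \<otimes> b) x \<otimes> inv (cnj a x)"
        using ac bc xc by (simp add: cnj_mult cnj_inv cnj_cnj)
      then show ?thesis using inv_cancel_middle[of "cnj (a \<otimes> b) x" "cnj a x" "inv x"] ac bc xc by simp
    qed
    ultimately show "a \<otimes> b \<in> K" using ac bc by (simp add: K_def)
  qed
  have Kc: "K \<subseteq> carrier G" using subgroup.subset[OF K] .
  have "finite_idx G (carrier G) K"
  proof (rule finite_idxI[OF K subset_refl, where \<theta> = "\<lambda>g. cnj g x <# Z"])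
    have "(\<lambda>g. cnj g x <# Z) ` carrier G \<subseteq> (\<lambda>k. k <# Z) ` N" using norm x by blast
    then show "finite ((\<lambda>g. cnj g x <# Z) ` carrier G)"
      using finZ unfolding finite_idx_def by (rule finite_subset)
    fix g h assume g: "g \<in> carrier G" and h: "h \<in> carrier G" and eq: "cnj g x <# Z = cnj h x <# Z"
    have "inv (cnj g x) \<otimes> cnj h x \<in> Z" using l_coset_eq_imp[OF Zsub _ _ eq] g h xc by simp
    \<comment> \<open>This conjugation turns the quotient of \<open>cnj g x\<close> and
      \<open>cnj h x\<close> into the commutator of \<open>inv g \<otimes> h\<close> with
      \<open>x\<close>.\<close>
    then have "cnj (x \<otimes> inv g) (inv (cnj g x) \<otimes> cnj h x) \<in> Z" using Znorm g xc by simp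
    moreover have "cnj (x \<otimes> inv g) (inv (cnj g x) \<otimes> cnj h x) = cnj (inv g \<otimes> h) x \<otimes> inv x"
    proof -
      have "cnj (x \<otimes> inv g) (inv (cnj g x) \<otimes> cnj h x) = cnj x (cnj (inv g) (inv (cnj g x) \<otimes> cnj h x))"
        using g h xc by (simp add: cnj_cnj)
      also have "cnj (inv g) (inv (cnj g x) \<otimes> cnj h x) = inv x \<otimes> cnj (inv g \<otimes> h) x"
        using g h xc by (simp add: cnj_mult cnj_inv cnj_cnj flip: cnj_inv)
      also have "cnj x (inv x \<otimes> cnj (inv g \<otimes> h) x) = cnj (inv g \<otimes> h) x \<otimes> inv x"
        using g h xc unfolding cnj_def[of x] by (simp add: m_assoc[symmetric])
      finally show ?thesis .
    qed
    ultimately show "inv g \<otimes> h \<in> K" using g h by (simp add: K_def)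
  qed
  moreover have "finite_idx G K (centr G K {x})"
    by (rule finite_idx_centr_of_commutators[OF K N x]) (use norm Kc in \<open>auto simp: K_def Z_def\<close>)
  moreover have sub: "subgroup (centr G K {x}) G" using centr_subgroup[OF K] xc by simp
  ultimately have "finite_idx G (carrier G) (centr G K {x})"
    using finite_idx_trans K by blast
  then have "finite_idx G (carrier G) (centr G (carrier G) {x})"
    by (rule finite_idx_mono) (use sub centr_subgroup[OF subgroup_self, of "{x}"] xc Kc in \<open>auto simp: centr_def\<close>)
  then show ?thesis using central_if_finite_idx xc g by blast
qed

text \<open>The centralizer of a term of the derived series is a solvable normal subgroup, so its derived
  series becomes central from the bottom up.\<close>

lemma centralizer_of_derived_central:
  assumes x: "x \<in> centr G (carrier G) ((derived G ^^ r) (carrier G))" and g: "g \<in> carrier G"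
  shows "g \<otimes> x = x \<otimes> g"
proof -
  have normal_derived: "(derived G ^^ i) M \<lhd> G" if "M \<lhd> G" for M i
    by (induction i) (use that derived_is_normal in auto)
  define D where "D = (derived G ^^ r) (carrier G)"
  have D: "D \<lhd> G" unfolding D_def by (rule normal_derived) (rule normal_self)
  have Dc: "D \<subseteq> carrier G" using normal_imp_subgroup[OF D] subgroup.subset by blast
  define M where "M = centr G (carrier G) D"
  have M: "M \<lhd> G"
    unfolding normal_inv_iff
  proof (intro conjI ballI)
    show "subgroup M G" unfolding M_def by (rule centr_subgroup[OF subgroup_self Dc])
    fix g m assume "g \<in> carrier G" "m \<in> M"
    then show "g \<otimes> m \<otimes> inv g \<in> M"
      unfolding M_def cnj_def[symmetric]
      by (intro centr_cnj[OF Dc subgroup_self]) (use normal.inv_op_closed1[OF D] normal.inv_op_closed2[OF D] in \<open>auto simp: cnj_def\<close>)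
  qed
  let ?E = "\<lambda>i. (derived G ^^ i) M"
  have central: "\<forall>x\<in>?E i. \<forall>g\<in>carrier G. g \<otimes> x = x \<otimes> g"
    if "\<And>m n g. m \<in> ?E i \<Longrightarrow> n \<in> ?E i \<Longrightarrow> g \<in> carrier G \<Longrightarrow> g \<otimes> (cnj m n \<otimes> inv n) = (cnj m n \<otimes> inv n) \<otimes> g" for i
  proof (intro ballI)
    fix x g assume "x \<in> ?E i" "g \<in> carrier G"
    moreover have "cnj g n \<in> ?E i" if "g \<in> carrier G" "n \<in> ?E i" for g n
      unfolding cnj_def using normal.inv_op_closed2[OF normal_derived[OF M] that] .
    ultimately show "g \<otimes> x = x \<otimes> g"
      using central_if_commutators_central[OF normal_imp_subgroup[OF normal_derived[OF M]] _ that] by blast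
  qed
  have Mc: "M \<subseteq> carrier G" by (auto simp: M_def centr_def)
  have ErM: "?E r \<subseteq> M"
    using normal_imp_subgroup[OF M]
  proof (induction r)
    case (Suc r)
    then show ?case using derived_incl by simp
  qed simp
  have ErD: "?E r \<subseteq> D" unfolding D_def by (rule mono_exp_of_derived[OF Mc])
  \<comment> \<open>The start of the descent from r to 0: \<open>?E r\<close> lies in
    \<open>D\<close> and in the centralizer \<open>M\<close> of \<open>D\<close>, so it is
    commutative.\<close>
  have "\<forall>x\<in>?E (r - i). \<forall>g\<in>carrier G. g \<otimes> x = x \<otimes> g" if "i \<le> r" for i
    using that
  proof (induction i)
    case 0
    show ?case
      unfolding diff_zero
    proof (rule central)
      fix m n g assume mn: "m \<in> ?E r" "n \<in> ?E r" "g \<in> carrier G"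
      have c: "m \<in> carrier G" "n \<in> carrier G" using mn ErM Mc by auto
      have "m \<otimes> n = n \<otimes> m" using mn ErM ErD unfolding M_def by (auto simp: centr_def)
      then have "cnj m n = n" using cnj_eq_iff c by simp
      then show "g \<otimes> (cnj m n \<otimes> inv n) = (cnj m n \<otimes> inv n) \<otimes> g" using mn c by simp
    qed
  next
    case (Suc i)
    have s: "Suc (r - Suc i) = r - i" using Suc.prems by simp
    show ?case
    proof (rule central)
      fix m n g assume mn: "m \<in> ?E (r - Suc i)" "n \<in> ?E (r - Suc i)" "g \<in> carrier G"
      have "cnj m n \<otimes> inv n \<in> derived_set G (?E (r - Suc i))"
        using mn unfolding cnj_def by blast
      then have "cnj m n \<otimes> inv n \<in> derived G (?E (r - Suc i))"
        unfolding derived_def by (rule generate.incl)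
      then have "cnj m n \<otimes> inv n \<in> ?E (r - i)" unfolding s[symmetric] by simp
      moreover have "\<forall>x\<in>?E (r - i). \<forall>g\<in>carrier G. g \<otimes> x = x \<otimes> g" using Suc by simp
      ultimately show "g \<otimes> (cnj m n \<otimes> inv n) = (cnj m n \<otimes> inv n) \<otimes> g" using mn(3) by blast
    qed
  qed
  from this[of r] have "\<forall>x\<in>M. \<forall>g\<in>carrier G. g \<otimes> x = x \<otimes> g" by simp
  then show ?thesis using x g unfolding M_def D_def by blast
qed

end

section \<open>Split spherical BN-pairs\<close>

lemma (in group) BN_pair_facts:
  assumes BN: "BN_pair G B N S"
  shows "subgroup B G" "subgroup N G" "generate G (B \<union> N) = carrier G"
    and "B \<inter> N \<lhd> G\<lparr>carrier := N\<rparr>" "S \<subseteq> carrier (weyl_group G B N)"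
    and "generate (weyl_group G B N) S = carrier (weyl_group G B N)"
    and "\<And>s w. s \<in> S \<Longrightarrow> w \<in> carrier (weyl_group G B N) \<Longrightarrow> s <#> B <#> w \<subseteq>
      (B <#> (s \<otimes>\<^bsub>weyl_group G B N\<^esub> w) <#> B) \<union> (B <#> w <#> B)"
    and "\<And>s. s \<in> S \<Longrightarrow> \<not> s <#> B <#> inv\<^bsub>weyl_group G B N\<^esub> s \<subseteq> B"
  using BN unfolding BN_pair_def Let_def by blast+

context group
begin

context
  fixes B N :: "'a set" and S :: "'a set set"
  assumes BN: "BN_pair G B N S"
begin

abbreviation "BN_torus \<equiv> B \<inter> N"
abbreviation "BN_weyl \<equiv> weyl_group G B N"

lemmas BN_facts = BN_pair_facts[OF BN]

lemma BN_carriers: "B \<subseteq> carrier G" "N \<subseteq> carrier G" "BN_torus \<subseteq> carrier G"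
  using subgroup.subset BN_facts(1,2) by blast+

lemma BN_torus_subgroup: "subgroup BN_torus G"
  using BN_facts(1,2) by (rule subgroups_Inter_pair)

lemma BN_torus_normal: "n \<in> N \<Longrightarrow> t \<in> BN_torus \<Longrightarrow> cnj n t \<in> BN_torus"
proof -
  assume n: "n \<in> N" and t: "t \<in> BN_torus"
  from normal.inv_op_closed2[OF BN_facts(4), of n t] n t BN_facts(2)
  show "cnj n t \<in> BN_torus" by (simp add: cnj_def)
qed

lemma BN_weyl_group: "group BN_weyl"
  unfolding weyl_group_def using BN_facts(4) by (rule normal.factorgroup_is_group)

lemma BN_weyl_carrier: "carrier BN_weyl = (\<lambda>n. BN_torus #> n) ` N"
  by (auto simp: weyl_group_def FactGroup_def RCOSETS_def r_coset_def)

lemma BN_weyl_mult: "x \<otimes>\<^bsub>BN_weyl\<^esub> y = x <#> y"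
  by (simp add: weyl_group_def FactGroup_def set_mult_def)

lemma BN_weyl_inv:
  assumes w: "w \<in> carrier BN_weyl" and n: "n \<in> w"
  shows "inv n \<in> inv\<^bsub>BN_weyl\<^esub> w"
proof -
  have "w \<subseteq> N" using w subgroup.m_closed[OF BN_facts(2)] by (auto simp: BN_weyl_carrier r_coset_def)
  then have "inv\<^bsub>G\<lparr>carrier := N\<rparr>\<^esub> n = inv n" using n BN_facts(2) by (intro m_inv_consistent) auto
  moreover have "inv\<^bsub>BN_weyl\<^esub> w = set_inv\<^bsub>G\<lparr>carrier := N\<rparr>\<^esub> w"
    unfolding weyl_group_def
    by (rule normal.inv_FactGroup[OF BN_facts(4)]) (use w in \<open>simp add: weyl_group_def\<close>)
  moreover have "inv\<^bsub>G\<lparr>carrier := N\<rparr>\<^esub> n \<in> set_inv\<^bsub>G\<lparr>carrier := N\<rparr>\<^esub> w"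
    using n unfolding SET_INV_def by blast
  ultimately show ?thesis by simp
qed

lemma BN_weyl_inv_mem:
  assumes w: "w \<in> carrier BN_weyl" and n: "n \<in> inv\<^bsub>BN_weyl\<^esub> w"
  shows "inv n \<in> w"
  using BN_weyl_inv[OF group.inv_closed[OF BN_weyl_group w] n] group.inv_inv[OF BN_weyl_group w] by simp

lemma BN_coset_subset: "w \<in> carrier BN_weyl \<Longrightarrow> w \<subseteq> N"
  using subgroup.m_closed[OF BN_facts(2)] by (auto simp: BN_weyl_carrier r_coset_def)

lemma BN_coset_mem: "n \<in> N \<Longrightarrow> n \<in> BN_torus #> n \<and> BN_torus #> n \<in> carrier BN_weyl"
  using subgroup.one_closed[OF BN_torus_subgroup] BN_carriers
  by (auto simp: BN_weyl_carrier r_coset_def intro!: bexI[of _ \<one>])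

text \<open>The elements that map R = B N B into itself by left multiplication are closed under
  products and contain \<open>B\<close>; by (BN1) they contain all representatives of
  \<open>S\<close>, hence \<open>N\<close>, hence everything. Apply this to the identity element in
  R.\<close>

lemma bruhat_decomposition:
  assumes fin: "finite (carrier BN_weyl)" and g: "g \<in> carrier G"
  obtains b n b' where "b \<in> B" "n \<in> N" "b' \<in> B" "g = b \<otimes> n \<otimes> b'"
proof -
  define R where "R = {b \<otimes> n \<otimes> b' | b n b'. b \<in> B \<and> n \<in> N \<and> b' \<in> B}"
  define P where "P = {g \<in> carrier G. \<forall>x\<in>R. g \<otimes> x \<in> R}"
  note Bc = subsetD[OF BN_carriers(1)] and Nc = subsetD[OF BN_carriers(2)]
  note Bm = subgroup.m_closed[OF BN_facts(1)]
  have Rc: "R \<subseteq> carrier G" unfolding R_def using Bc Nc by auto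
  have P_mult: "g \<otimes> h \<in> P" if "g \<in> P" "h \<in> P" for g h
  proof -
    have gh: "g \<in> carrier G" "h \<in> carrier G" using that by (auto simp: P_def)
    have "g \<otimes> h \<otimes> x \<in> R" if x: "x \<in> R" for x
    proof -
      have "g \<otimes> (h \<otimes> x) \<in> R" using that \<open>g \<in> P\<close> \<open>h \<in> P\<close> by (auto simp: P_def)
      then show ?thesis using gh x Rc by (auto simp: m_assoc)
    qed
    then show ?thesis using gh by (auto simp: P_def)
  qed
  have BP: "b \<in> P" if b: "b \<in> B" for b
  proof -
    have "b \<otimes> (c \<otimes> n \<otimes> c') \<in> R" if "c \<in> B" "n \<in> N" "c' \<in> B" for c n c'
    proof -
      have "b \<otimes> (c \<otimes> n \<otimes> c') = (b \<otimes> c) \<otimes> n \<otimes> c'" using b that Bc Nc by (simp add: m_assoc)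
      then show ?thesis using that Bm[OF b] unfolding R_def by blast
    qed
    then show ?thesis using Bc[OF b] unfolding P_def R_def by blast
  qed
  have double: "(B <#> w <#> B) \<subseteq> R" if "w \<in> carrier BN_weyl" for w
    using BN_coset_subset[OF that] unfolding R_def set_mult_def by blast
  have SP: "a \<in> P" if s: "s \<in> S" and a: "a \<in> s" for s a
  proof -
    have sW: "s \<in> carrier BN_weyl" using s BN_facts(5) by blast
    have aN: "a \<in> N" using BN_coset_subset[OF sW] a by blast
    have "a \<otimes> (c \<otimes> n \<otimes> c') \<in> R" if c: "c \<in> B" "n \<in> N" "c' \<in> B" for c n c'
    proof -
      let ?w = "BN_torus #> n"
      have w: "n \<in> ?w" "?w \<in> carrier BN_weyl" using BN_coset_mem c by auto
      have "a \<otimes> c \<otimes> n \<in> s <#> B <#> ?w" using a c w unfolding set_mult_def by blast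
      then have "a \<otimes> c \<otimes> n \<in> (B <#> (s \<otimes>\<^bsub>BN_weyl\<^esub> ?w) <#> B) \<union> (B <#> ?w <#> B)"
        using BN_facts(7)[OF s w(2)] by blast
      then have "a \<otimes> c \<otimes> n \<in> R"
        using double[OF w(2)] double[OF monoid.m_closed[OF group.is_monoid[OF BN_weyl_group] sW w(2)]] by blast
      then obtain b m b' where m: "b \<in> B" "m \<in> N" "b' \<in> B" "a \<otimes> c \<otimes> n = b \<otimes> m \<otimes> b'"
        unfolding R_def by blast
      have "a \<otimes> (c \<otimes> n \<otimes> c') = a \<otimes> c \<otimes> n \<otimes> c'" using aN c Bc Nc by (simp add: m_assoc)
      also have "\<dots> = b \<otimes> m \<otimes> (b' \<otimes> c')" unfolding m(4) using m c Bc Nc by (simp add: m_assoc)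
      finally show ?thesis using m c Bm unfolding R_def by blast
    qed
    then show ?thesis using Nc[OF aN] unfolding P_def R_def by blast
  qed
  interpret W: group BN_weyl by (rule BN_weyl_group)
  define Q where "Q = {w \<in> carrier BN_weyl. w \<subseteq> P}"
  have Q_mult: "v \<otimes>\<^bsub>BN_weyl\<^esub> w \<in> Q" if "v \<in> Q" "w \<in> Q" for v w
  proof -
    have "v <#> w \<subseteq> P" using that P_mult unfolding Q_def set_mult_def by blast
    then show ?thesis using that unfolding Q_def by (auto simp: BN_weyl_mult[symmetric])
  qed
  have Q_one: "\<one>\<^bsub>BN_weyl\<^esub> \<in> Q"
  proof -
    have "\<one>\<^bsub>BN_weyl\<^esub> = BN_torus" by (simp add: weyl_group_def FactGroup_def)
    then show ?thesis using BP W.one_closed unfolding Q_def by auto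
  qed
  have Q_pow: "w [^]\<^bsub>BN_weyl\<^esub> (k :: nat) \<in> Q" if "w \<in> Q" for w k
    by (induction k) (use Q_one Q_mult that in auto)
  have SQ: "s \<in> Q" if "s \<in> S" for s using SP[OF that] that BN_facts(5) unfolding Q_def by blast
  have "w \<in> Q" if "w \<in> generate BN_weyl S" for w
    using that
  proof (induction rule: generate.induct)
    \<comment> \<open>\<open>Q\<close> is known to be closed under products but not under inverses;
      finiteness of the Weyl group makes the inverse a power.\<close>
    case (inv h)
    have hW: "h \<in> carrier BN_weyl" using inv BN_facts(5) by blast
    have "h [^]\<^bsub>BN_weyl\<^esub> (order BN_weyl - 1) \<otimes>\<^bsub>BN_weyl\<^esub> h = h [^]\<^bsub>BN_weyl\<^esub> Suc (order BN_weyl - 1)"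
      by simp
    also have "Suc (order BN_weyl - 1) = order BN_weyl"
      using fin W.order_gt_0_iff_finite by auto
    also have "h [^]\<^bsub>BN_weyl\<^esub> order BN_weyl = \<one>\<^bsub>BN_weyl\<^esub>" by (rule W.pow_order_eq_1[OF hW])
    finally have "inv\<^bsub>BN_weyl\<^esub> h = h [^]\<^bsub>BN_weyl\<^esub> (order BN_weyl - 1)"
      using hW by (intro W.inv_equality) auto
    then show ?case using Q_pow[OF SQ[OF inv]] by simp
  qed (use Q_one SQ Q_mult in auto)
  then have NP: "n \<in> P" if "n \<in> N" for n
    using BN_coset_mem[OF that] BN_facts(6) unfolding Q_def by blast
  have "x \<in> P" if "x \<in> generate G (B \<union> N)" for x
    using that
  proof (induction rule: generate.induct)
    case one
    show ?case using BP[OF subgroup.one_closed[OF BN_facts(1)]] .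
  next
    case (incl h)
    then show ?case using BP NP by blast
  next
    case (inv h)
    then show ?case
      using BP NP subgroup.m_inv_closed[OF BN_facts(1)] subgroup.m_inv_closed[OF BN_facts(2)] by blast
  next
    case (eng h1 h2)
    then show ?case using P_mult by blast
  qed
  then have "g \<in> P" using g BN_facts(3) by blast
  moreover have "\<one> \<in> R"
    unfolding R_def using subgroup.one_closed[OF BN_facts(1)] subgroup.one_closed[OF BN_facts(2)]
    by (intro CollectI exI[of _ \<one>]) simp
  ultimately have "g \<otimes> \<one> \<in> R" unfolding P_def by blast
  then show thesis using that g unfolding R_def by auto
qed

text \<open>A central element of \<open>B\<close> lies in every conjugate of \<open>B\<close> by the
  Weyl group, and saturation says that these intersect in the torus.\<close>

lemma central_in_BN_torus:
  assumes sat: "BN_saturated G B N" and x: "x \<in> B" and central: "\<And>g. g \<in> carrier G \<Longrightarrow> g \<otimes> x = x \<otimes> g"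
  shows "x \<in> BN_torus"
proof -
  have xc: "x \<in> carrier G" using x BN_carriers by blast
  have "x \<in> w <#> B <#> inv\<^bsub>BN_weyl\<^esub> w" if w: "w \<in> carrier BN_weyl" for w
  proof -
    obtain n where n: "n \<in> N" "n \<in> w" using w BN_coset_mem by (auto simp: BN_weyl_carrier)
    have nc: "n \<in> carrier G" using n BN_carriers by blast
    have "n \<otimes> x \<otimes> inv n \<in> w <#> B <#> inv\<^bsub>BN_weyl\<^esub> w"
      using n x BN_weyl_inv[OF w n(2)] unfolding set_mult_def by blast
    moreover have "n \<otimes> x \<otimes> inv n = x" using cnj_eq_iff[OF nc xc] central[OF nc] by (simp add: cnj_def)
    ultimately show ?thesis by simp
  qed
  then show ?thesis using sat unfolding BN_saturated_def by blast
qed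

text \<open>Once \<open>S\<close> is empty, the Weyl group is trivial, so \<open>N\<close> lies in
  \<open>B\<close>, and \<open>B\<close> alone generates the group.\<close>

lemma BN_trivial_if_unipotent_part_trivial:
  assumes B: "B = BN_torus"
  shows "B = carrier G"
proof -
  have "S = {}"
  proof (rule ccontr)
    assume "S \<noteq> {}"
    then obtain s where s: "s \<in> S" by blast
    then have sW: "s \<in> carrier BN_weyl" using BN_facts(5) by blast
    have "a \<otimes> b \<otimes> c \<in> B" if a: "a \<in> s" and b: "b \<in> B" and c: "c \<in> inv\<^bsub>BN_weyl\<^esub> s" for a b c
    proof -
      obtain n where n: "n \<in> N" "s = BN_torus #> n" using sW by (auto simp: BN_weyl_carrier)
      obtain t where t: "t \<in> BN_torus" "a = t \<otimes> n" using a n unfolding r_coset_def by blast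
      obtain t' where t': "t' \<in> BN_torus" "inv c = t' \<otimes> n"
        using BN_weyl_inv_mem[OF sW c] n unfolding r_coset_def by blast
      have cc: "c \<in> carrier G"
        using c BN_coset_subset[OF group.inv_closed[OF BN_weyl_group sW]] BN_carriers by blast
      have car: "n \<in> carrier G" "t \<in> carrier G" "t' \<in> carrier G" "b \<in> carrier G"
        using n t t' b BN_carriers by auto
      have "c = inv (t' \<otimes> n)" using t'(2) cc by (metis inv_inv)
      then have "a \<otimes> b \<otimes> c = t \<otimes> cnj n b \<otimes> inv t'"
        using car unfolding t(2) cnj_def by (simp add: m_assoc inv_mult_group)
      moreover have "cnj n b \<in> BN_torus" using BN_torus_normal n b B by blast
      ultimately show ?thesis
        using t t' subgroup.m_closed[OF BN_torus_subgroup] subgroup.m_inv_closed[OF BN_torus_subgroup] by auto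
    qed
    then have "s <#> B <#> inv\<^bsub>BN_weyl\<^esub> s \<subseteq> B" unfolding set_mult_def by blast
    with BN_facts(8)[OF s] show False by blast
  qed
  then have "carrier BN_weyl = {BN_torus}"
    using BN_facts(6) group.generate_empty[OF BN_weyl_group] by (simp add: weyl_group_def FactGroup_def)
  then have NT: "N \<subseteq> BN_torus" using BN_coset_mem by blast
  then have "generate G (B \<union> N) \<subseteq> B"
    by (intro generate_subgroup_incl BN_facts(1)) auto
  then show ?thesis using BN_facts(3) BN_carriers by blast
qed

end

end

text \<open>\<open>dense A\<close> stands for \<open>poly_dense A H\<close>, and
  \<open>dense_double_coset\<close> encapsulates the argument with the adjoint representation. A
  locale assumption has a fixed index type; triples are what the cover by translated Bruhat cells
  needs.\<close>

locale zariski_dense_group = centralizer_finite_group +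
  fixes dense :: "'a set \<Rightarrow> bool"
  assumes dense_carrier: "dense (carrier G)"
    and dense_finite_union: "\<And>A (C :: 'a \<times> 'a \<times> 'a \<Rightarrow> 'a set) J. dense A \<Longrightarrow> finite J \<Longrightarrow> A \<subseteq> (\<Union>j\<in>J. C j) \<Longrightarrow>
      \<exists>j\<in>J. dense (C j)"
    and dense_translate: "\<And>a b A. a \<in> carrier G \<Longrightarrow> b \<in> carrier G \<Longrightarrow> A \<subseteq> carrier G \<Longrightarrow>
      dense ((\<lambda>x. a \<otimes> x \<otimes> b) ` A) \<Longrightarrow> dense A"
    and dense_commute: "\<And>A x y g. dense A \<Longrightarrow> A \<subseteq> carrier G \<Longrightarrow> x \<in> carrier G \<Longrightarrow> y \<in> carrier G \<Longrightarrow>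
      (\<And>g. g \<in> A \<Longrightarrow> g \<otimes> x = y \<otimes> g) \<Longrightarrow> g \<in> carrier G \<Longrightarrow> g \<otimes> x = y \<otimes> g"
    and dense_double_coset: "\<And>V T0 w. subgroup V G \<Longrightarrow> (\<And>u v. u \<in> V \<Longrightarrow> v \<in> V \<Longrightarrow> u \<otimes> v = v \<otimes> u) \<Longrightarrow>
      subgroup T0 G \<Longrightarrow> (\<And>t v. t \<in> T0 \<Longrightarrow> v \<in> V \<Longrightarrow> t \<otimes> v = v \<otimes> t) \<Longrightarrow> w \<in> carrier G \<Longrightarrow>
      (\<And>t. t \<in> T0 \<Longrightarrow> inv w \<otimes> t \<otimes> w \<in> T0) \<Longrightarrow>
      dense {v \<otimes> t \<otimes> w \<otimes> v' | v t v'. v \<in> V \<and> t \<in> T0 \<and> v' \<in> V} \<Longrightarrow>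
      \<exists>r. V \<subseteq> centr G (carrier G) ((derived G ^^ r) (carrier G))"
begin

text \<open>If finitely many cosets of the centralizer of x cover the group, one of them is dense,
  and so is the centralizer as a translate of it. Commuting with x then extends from this dense set
  to all elements.\<close>

sublocale connected_centralizer_finite_group
proof
  fix x g assume x: "x \<in> carrier G" and fin: "finite_idx G (carrier G) (centr G (carrier G) {x})"
    and g: "g \<in> carrier G"
  let ?C = "centr G (carrier G) {x}"
  have C: "subgroup ?C G" using centr_subgroup[OF subgroup_self, of "{x}"] x by simp
  obtain F where F: "finite F" "F \<subseteq> carrier G" "carrier G \<subseteq> (\<Union>f\<in>F. f <# ?C)"
    by (rule finite_idx_cover[OF fin C subset_refl])
  \<comment> \<open>The index f is padded to a triple to match the type in
    \<open>dense_finite_union\<close>.\<close>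
  have "carrier G \<subseteq> (\<Union>(f, _, _)\<in>F \<times> {\<one>} \<times> {\<one>}. f <# ?C)" using F(3) by auto
  from dense_finite_union[OF dense_carrier _ this] F(1) obtain f where f: "f \<in> F" "dense (f <# ?C)" by auto
  have fc: "f \<in> carrier G" using f F by blast
  have "f <# ?C = (\<lambda>x. f \<otimes> x \<otimes> \<one>) ` ?C"
    using fc by (auto simp: l_coset_def centr_def)
  then have "dense ?C" using dense_translate[OF fc one_closed subgroup.subset[OF C]] f(2) by simp
  from dense_commute[OF this subgroup.subset[OF C] x x _ g] show "g \<otimes> x = x \<otimes> g"
    by (simp add: centr_def)
qed

theorem split_spherical_BN_pair_trivial:
  assumes BN: "BN_pair G B N S" and split: "BN_split G B N" and spherical: "BN_spherical G B N"
  shows "B = carrier G"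
proof -
  let ?T = "B \<inter> N"
  note BNf = BN_pair_facts[OF BN]
  note BNc = BN_carriers[OF BN]
  have Tsub: "subgroup ?T G" by (rule BN_torus_subgroup[OF BN])
  have finW: "finite (carrier (weyl_group G B N))" using spherical unfolding BN_spherical_def .
  have sat: "BN_saturated G B N" using split unfolding BN_split_def by blast
  obtain U where U: "U \<lhd> G\<lparr>carrier := B\<rparr>" "nilpotent_group (G\<lparr>carrier := U\<rparr>)"
    "U \<inter> ?T = {\<one>}" "U <#> ?T = B" using split unfolding BN_split_def by blast
  have "subgroup U (G\<lparr>carrier := B\<rparr>)" using U(1) by (rule normal.axioms(1))
  then have Usub: "subgroup U G" and UB: "U \<subseteq> B"
    using incl_subgroup[OF BNf(1)] subgroup.subset by fastforce+
  have Uc: "U \<subseteq> carrier G" using UB BNc by blast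
  have Unorm: "cnj b u \<in> U" if "b \<in> B" "u \<in> U" for b u
    using normal.inv_op_closed2[OF U(1), of b u] that BNf(1) by (simp add: cnj_def)
  obtain V where V: "normalized_abelian B V" "V \<subseteq> U" "finite_idx G U V"
    by (rule nilpotent_virtually_abelian[OF BNf(1) Usub UB Unorm U(2)])
  have Vsub: "subgroup V G" and Vcom: "\<And>u v. u \<in> V \<Longrightarrow> v \<in> V \<Longrightarrow> u \<otimes> v = v \<otimes> u"
    and Vnorm: "\<And>b v. b \<in> B \<Longrightarrow> v \<in> V \<Longrightarrow> cnj b v \<in> V"
    using V(1) unfolding normalized_abelian_def by auto
  have Vc: "V \<subseteq> carrier G" using V(2) Uc by blast
  \<comment> \<open>All \<open>N\<close>-conjugates of \<open>V\<close> instead of \<open>V\<close>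
    alone: the set is stable under \<open>N\<close>, so its centralizer \<open>T0\<close> in the
    torus is normalized by \<open>N\<close>.\<close>
  define Y where "Y = {cnj n v | n v. n \<in> N \<and> v \<in> V}"
  have Yc: "Y \<subseteq> carrier G" unfolding Y_def using BNc Vc cnj_closed by blast
  have VY: "V \<subseteq> Y"
  proof
    fix v assume "v \<in> V"
    then have "v = cnj \<one> v \<and> \<one> \<in> N \<and> v \<in> V" using Vc subgroup.one_closed[OF BNf(2)] by auto
    then show "v \<in> Y" unfolding Y_def by blast
  qed
  define T0 where "T0 = centr G ?T Y"
  have T0sub: "subgroup T0 G" unfolding T0_def by (rule centr_subgroup[OF Tsub Yc])
  have T0T: "T0 \<subseteq> ?T" unfolding T0_def by (auto simp: centr_def)
  have T0c: "T0 \<subseteq> carrier G" using subgroup.subset[OF T0sub] .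
  have T0V: "t \<otimes> v = v \<otimes> t" if "t \<in> T0" "v \<in> V" for t v
    using that VY unfolding T0_def by (auto simp: centr_def)
  have finT: "finite_idx G ?T T0"
    unfolding T0_def
  proof (rule finite_idx_centr[OF Tsub Yc])
    fix y assume "y \<in> Y"
    then obtain n v where nv: "y = cnj n v" "n \<in> N" "v \<in> V" unfolding Y_def by blast
    have vc: "{v} \<subseteq> carrier G" using nv Vc by blast
    have "finite_idx G ?T (centr G ?T V)"
      by (rule abelian_normalizer_finite_idx[OF Vsub Vcom Tsub]) (use Vnorm in \<open>auto simp: cnj_def\<close>)
    then have fin: "finite_idx G ?T (centr G ?T {v})"
      by (rule finite_idx_mono[OF _ centr_subgroup[OF Tsub Vc] centr_subgroup[OF Tsub vc]])
        (use nv BNc in \<open>auto simp: centr_def\<close>)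
    have "n \<in> carrier G" "inv n \<in> N" using nv BNc subgroup.m_inv_closed[OF BNf(2)] by auto
    then show "finite_idx G ?T (centr G ?T {y})"
      unfolding nv(1) using nv vc BN_torus_normal[OF BN]
      by (intro finite_idx_centr_cnj[OF fin Tsub]) auto
  qed
  have T0norm: "cnj n t \<in> T0" if n: "n \<in> N" and t: "t \<in> T0" for n t
    unfolding T0_def
  proof (rule centr_cnj[OF Yc Tsub])
    show nc: "n \<in> carrier G" using n BNc by blast
    show "cnj n k \<in> ?T" if "k \<in> ?T" for k by (rule BN_torus_normal[OF BN n that])
    show "t \<in> centr G ?T Y" using t unfolding T0_def .
    fix y assume "y \<in> Y"
    then obtain m v where mv: "y = cnj m v" "m \<in> N" "v \<in> V" unfolding Y_def by blast
    have "cnj (inv n) y = cnj (inv n \<otimes> m) v"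
      unfolding mv(1) using nc subsetD[OF BNc(2) mv(2)] subsetD[OF Vc mv(3)] by (simp add: cnj_cnj)
    moreover have "inv n \<otimes> m \<in> N"
      using n mv subgroup.m_closed[OF BNf(2)] subgroup.m_inv_closed[OF BNf(2)] by blast
    ultimately show "cnj (inv n) y \<in> Y" using mv unfolding Y_def by blast
  qed
  obtain F where F: "finite F" "F \<subseteq> U" "U \<subseteq> (\<Union>f\<in>F. f <# V)"
    by (rule finite_idx_cover[OF V(3) Vsub Uc])
  obtain E where E: "finite E" "E \<subseteq> ?T" "?T \<subseteq> (\<Union>f\<in>E. f <# T0)"
    by (rule finite_idx_cover[OF finT T0sub BNc(3)])
  define D where "D = (\<lambda>(f, e). f \<otimes> e) ` (F \<times> E)"
  have D: "finite D" unfolding D_def using F E by simp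
  have "F \<subseteq> carrier G" "E \<subseteq> carrier G" using F(2) E(2) Uc BNc by blast+
  then have Dc: "D \<subseteq> carrier G" unfolding D_def by auto
  \<comment> \<open>Coset representatives for \<open>V\<close> in \<open>U\<close> and for
    \<open>T0\<close> in the torus combine to \<open>D\<close>, because \<open>B\<close> normalizes
    \<open>V\<close> and so v e = e v' with v' in \<open>V\<close>.\<close>
  have Bdec: "\<exists>d\<in>D. \<exists>v\<in>V. \<exists>t\<in>T0. b = d \<otimes> v \<otimes> t" if b: "b \<in> B" for b
  proof -
    have "b \<in> U <#> ?T" using b U(4) by simp
    then obtain u t where ut: "u \<in> U" "t \<in> ?T" "b = u \<otimes> t" unfolding set_mult_def by blast
    obtain f v where fv: "f \<in> F" "v \<in> V" "u = f \<otimes> v" using F(3) ut(1) unfolding l_coset_def by blast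
    obtain e t0 where et: "e \<in> E" "t0 \<in> T0" "t = e \<otimes> t0" using E(3) ut(2) unfolding l_coset_def by blast
    have eB: "inv e \<in> B" using et E(2) subgroup.m_inv_closed[OF BNf(1)] by blast
    have car: "f \<in> carrier G" "v \<in> carrier G" "e \<in> carrier G" "t0 \<in> carrier G"
      using fv et F(2) E(2) Uc BNc Vc T0c by auto
    have "v \<otimes> e = e \<otimes> cnj (inv e) v" using car by (simp add: cnj_def m_assoc[symmetric])
    then have "b = (f \<otimes> e) \<otimes> cnj (inv e) v \<otimes> t0"
      unfolding ut(3) fv(3) et(3) using car by (metis cnj_closed inv_closed m_assoc m_closed)
    moreover have "f \<otimes> e \<in> D" unfolding D_def using fv et by auto
    moreover have "cnj (inv e) v \<in> V" by (rule Vnorm[OF eB fv(2)])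
    ultimately show ?thesis using et(2) by blast
  qed
  define R where "R = (\<lambda>w. SOME n. n \<in> N \<and> w = ?T #> n) ` carrier (weyl_group G B N)"
  have R_rep: "(SOME n. n \<in> N \<and> w = ?T #> n) \<in> N \<and> w = ?T #> (SOME n. n \<in> N \<and> w = ?T #> n)"
    if "w \<in> carrier (weyl_group G B N)" for w
    by (rule someI_ex) (use that in \<open>auto simp: BN_weyl_carrier[OF BN]\<close>)
  have R: "finite R" "R \<subseteq> N" unfolding R_def using finW R_rep by auto
  define cell where "cell r = {v \<otimes> t \<otimes> r \<otimes> v' | v t v'. v \<in> V \<and> t \<in> T0 \<and> v' \<in> V}" for r
  have cell_c: "cell r \<subseteq> carrier G" if "r \<in> N" for r
    unfolding cell_def using that subsetD[OF Vc] subsetD[OF T0c] subsetD[OF BNc(2)] by auto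
  have "\<exists>d\<in>D. \<exists>r\<in>R. \<exists>e\<in>D. \<exists>c\<in>cell r. g = d \<otimes> c \<otimes> inv e" if g: "g \<in> carrier G" for g
  proof -
    obtain b n b' where bnb: "b \<in> B" "n \<in> N" "b' \<in> B" "g = b \<otimes> n \<otimes> b'"
      by (rule bruhat_decomposition[OF BN finW g])
    have nW: "n \<in> ?T #> n" "?T #> n \<in> carrier (weyl_group G B N)" using BN_coset_mem[OF BN bnb(2)] by auto
    define r where "r = (SOME m. m \<in> N \<and> ?T #> n = ?T #> m)"
    have "r \<in> R"
      unfolding R_def r_def by (rule image_eqI[where x = "?T #> n", OF refl nW(2)])
    moreover have "r \<in> N" "?T #> n = ?T #> r"
      unfolding r_def by (rule conjunct1[OF R_rep[OF nW(2)]], rule conjunct2[OF R_rep[OF nW(2)]])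
    ultimately have r: "r \<in> R" "r \<in> N" "?T #> n = ?T #> r" .
    have "n \<in> ?T #> r" using nW(1) unfolding r(3) .
    then obtain t where t: "t \<in> ?T" "n = t \<otimes> r" unfolding r_coset_def by blast
    have "b \<otimes> t \<in> B" by (rule subgroup.m_closed[OF BNf(1) bnb(1)]) (use t(1) in blast)
    from Bdec[OF this] obtain d v t1 where d: "d \<in> D" "v \<in> V" "t1 \<in> T0" "b \<otimes> t = d \<otimes> v \<otimes> t1" by blast
    \<comment> \<open>The inverse of b' is decomposed so that, after inverting, the representative e
      stands at the far right; the torus factor next to r is then moved across r into
      \<open>T0\<close>.\<close>
    from Bdec[OF subgroup.m_inv_closed[OF BNf(1) bnb(3)]]
    obtain e v2 t2 where e: "e \<in> D" "v2 \<in> V" "t2 \<in> T0" "inv b' = e \<otimes> v2 \<otimes> t2" by blast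
    have car: "b \<in> carrier G" "t \<in> carrier G" "r \<in> carrier G" "b' \<in> carrier G" "d \<in> carrier G" "v \<in> carrier G"
      "t1 \<in> carrier G" "e \<in> carrier G" "v2 \<in> carrier G" "t2 \<in> carrier G"
      using bnb t r d e BNc Dc Vc T0c by auto
    have it2: "inv t2 \<in> T0" using subgroup.m_inv_closed[OF T0sub e(3)] .
    have "b' = inv (e \<otimes> v2 \<otimes> t2)" using e(4) car by (metis inv_inv)
    also have "\<dots> = inv t2 \<otimes> inv v2 \<otimes> inv e" using car by (simp add: inv_mult_group m_assoc)
    finally have b': "b' = inv t2 \<otimes> inv v2 \<otimes> inv e" .
    have "g = (b \<otimes> t) \<otimes> r \<otimes> b'" unfolding bnb(4) t(2) using car by (simp add: m_assoc)
    also have "\<dots> = d \<otimes> v \<otimes> t1 \<otimes> (r \<otimes> inv t2) \<otimes> inv v2 \<otimes> inv e"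
      unfolding d(4) b' using car by (simp add: m_assoc)
    also have "r \<otimes> inv t2 = cnj r (inv t2) \<otimes> r" using car by (simp add: cnj_def m_assoc)
    also have "d \<otimes> v \<otimes> t1 \<otimes> (cnj r (inv t2) \<otimes> r) \<otimes> inv v2 \<otimes> inv e
      = d \<otimes> (v \<otimes> (t1 \<otimes> cnj r (inv t2)) \<otimes> r \<otimes> inv v2) \<otimes> inv e"
      using car by (simp add: m_assoc)
    finally have "g = d \<otimes> (v \<otimes> (t1 \<otimes> cnj r (inv t2)) \<otimes> r \<otimes> inv v2) \<otimes> inv e" .
    moreover have "t1 \<otimes> cnj r (inv t2) \<in> T0"
      using subgroup.m_closed[OF T0sub d(3) T0norm[OF r(2) it2]] .
    then have "v \<otimes> (t1 \<otimes> cnj r (inv t2)) \<otimes> r \<otimes> inv v2 \<in> cell r"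
      unfolding cell_def using d(2) subgroup.m_inv_closed[OF Vsub e(2)] by blast
    ultimately show ?thesis using d(1) e(1) r(1) by blast
  qed
  then have cover: "carrier G \<subseteq> (\<Union>j\<in>D \<times> R \<times> D. case j of (d, r, e) \<Rightarrow> (\<lambda>x. d \<otimes> x \<otimes> inv e) ` cell r)"
    by fastforce
  have "finite (D \<times> R \<times> D)" using D R by simp
  from dense_finite_union[OF dense_carrier this cover]
  obtain d r e where dre: "d \<in> D" "r \<in> R" "e \<in> D" "dense ((\<lambda>x. d \<otimes> x \<otimes> inv e) ` cell r)" by auto
  have rN: "r \<in> N" and rc: "r \<in> carrier G" using dre R BNc by auto
  have dense_cell: "dense (cell r)"
    by (rule dense_translate[OF _ _ cell_c[OF rN] dre(4)]) (use dre Dc in auto)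
  have "\<exists>k. V \<subseteq> centr G (carrier G) ((derived G ^^ k) (carrier G))"
  proof (rule dense_double_coset[OF Vsub Vcom T0sub T0V rc _ dense_cell[unfolded cell_def]])
    fix t assume t: "t \<in> T0"
    have "cnj (inv r) t \<in> T0" using T0norm[OF subgroup.m_inv_closed[OF BNf(2) rN] t] .
    then show "inv r \<otimes> t \<otimes> r \<in> T0" using rc by (simp add: cnj_def)
  qed
  then have Vcentral: "g \<otimes> v = v \<otimes> g" if "v \<in> V" "g \<in> carrier G" for v g
    using centralizer_of_derived_central that by blast
  have V1: "v = \<one>" if v: "v \<in> V" for v
  proof -
    have "v \<in> B" using v V(2) UB by blast
    then have "v \<in> ?T" by (rule central_in_BN_torus[OF BN sat]) (rule Vcentral[OF v])
    then show ?thesis using v V(2) U(3) by blast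
  qed
  have finU: "finite U"
  proof -
    have "U \<subseteq> F"
    proof
      fix u assume "u \<in> U"
      then obtain f v where "f \<in> F" "v \<in> V" "u = f \<otimes> v" using F(3) unfolding l_coset_def by blast
      then show "u \<in> F" using V1[of v] F(2) Uc by auto
    qed
    then show ?thesis using F(1) finite_subset by blast
  qed
  have V_eq: "V = {\<one>}" using V1 subgroup.one_closed[OF Vsub] by blast
  have "cell r = (\<lambda>x. \<one> \<otimes> x \<otimes> r \<otimes> \<one>) ` T0"
    unfolding cell_def V_eq by blast
  also have "\<dots> = (\<lambda>x. \<one> \<otimes> x \<otimes> r) ` T0"
    by (rule image_cong) (use subsetD[OF T0c] rc in auto)
  finally have "cell r = (\<lambda>x. \<one> \<otimes> x \<otimes> r) ` T0" .
  then have denseT0: "dense T0" using dense_translate[OF one_closed rc T0c] dense_cell by simp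
  have U1: "u = \<one>" if u: "u \<in> U" for u
  proof -
    have uc: "u \<in> carrier G" using u Uc by blast
    \<comment> \<open>Conjugation by \<open>T0\<close> sends u into the finite set \<open>U\<close>.
      For some u', the elements taking u to u' are dense, so all group elements do, and the identity
      gives u' = u.\<close>
    have "T0 \<subseteq> (\<Union>(u', _, _)\<in>U \<times> {\<one>} \<times> {\<one>}. {g \<in> carrier G. g \<otimes> u = u' \<otimes> g})"
    proof
      fix t assume t: "t \<in> T0"
      then have tc: "t \<in> carrier G" and "cnj t u \<in> U" using T0c T0T Unorm u by auto
      moreover have "t \<otimes> u = cnj t u \<otimes> t" using tc uc by (simp add: cnj_def m_assoc)
      ultimately show "t \<in> (\<Union>(u', _, _)\<in>U \<times> {\<one>} \<times> {\<one>}. {g \<in> carrier G. g \<otimes> u = u' \<otimes> g})" by auto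
    qed
    from dense_finite_union[OF denseT0 _ this] finU
    obtain u' where u': "u' \<in> U" "dense {g \<in> carrier G. g \<otimes> u = u' \<otimes> g}" by auto
    have u'c: "u' \<in> carrier G" using u' Uc by blast
    have all: "g \<otimes> u = u' \<otimes> g" if "g \<in> carrier G" for g
      by (rule dense_commute[OF u'(2) _ uc u'c _ that]) auto
    have "u = u'" using all[OF one_closed] uc u'c by simp
    then have "g \<otimes> u = u \<otimes> g" if "g \<in> carrier G" for g using all[OF that] by simp
    moreover have "u \<in> B" using u UB by blast
    ultimately have "u \<in> ?T" using central_in_BN_torus[OF BN sat] by blast
    then show ?thesis using u U(3) by blast
  qed
  have "B \<subseteq> ?T"
  proof
    fix b assume "b \<in> B"
    then have "b \<in> U <#> ?T" using U(4) by simp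
    then obtain u t where "u \<in> U" "t \<in> ?T" "b = u \<otimes> t" unfolding set_mult_def by blast
    then show "b \<in> ?T" using U1[of u] BNc by auto
  qed
  then show ?thesis by (intro BN_trivial_if_unipotent_part_trivial[OF BN]) blast
qed

end

section \<open>The adjoint representation\<close>

definition poly_matrix :: "('k::field ^ 'n ^ 'n \<Rightarrow> 'k ^ 'n ^ 'n) \<Rightarrow> bool" where
  "poly_matrix M \<longleftrightarrow> (\<forall>i j. (\<lambda>A. M A $ i $ j) \<in> polynomial_maps)"

lemma poly_matrix_simple:
  "poly_matrix (\<lambda>A. A)" "poly_matrix (\<lambda>_. C)" "poly_matrix adjugate"
  by (auto simp: poly_matrix_def intro: polynomial_maps.intros adjugate_polynomial)

lemma poly_matrix_mult: "poly_matrix M \<Longrightarrow> poly_matrix P \<Longrightarrow> poly_matrix (\<lambda>A. M A ** P A)"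
  by (auto simp: poly_matrix_def matrix_matrix_mult_def intro!: polynomial_maps_sum polynomial_maps.mult)

lemma poly_matrix_functional:
  assumes "poly_matrix M" and "Vector_Spaces.linear mat_scale (*) \<phi>"
  shows "(\<lambda>A. \<phi> (M A)) \<in> polynomial_maps"
proof -
  interpret \<phi>: Vector_Spaces.linear mat_scale "(*)" \<phi> by fact
  have "\<phi> (M A) = (\<Sum>e\<in>UNIV. \<phi> (mat_unit e) * M A $ fst e $ snd e)" for A
  proof -
    have "\<phi> (M A) = \<phi> (\<Sum>e\<in>UNIV. mat_scale (M A $ fst e $ snd e) (mat_unit e))"
      by (simp only: mat_unit_expansion)
    also have "\<dots> = (\<Sum>e\<in>UNIV. \<phi> (mat_unit e) * M A $ fst e $ snd e)"
      by (simp add: \<phi>.sum \<phi>.scale mult.commute)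
    finally show ?thesis .
  qed
  then have "(\<lambda>A. \<phi> (M A)) = (\<lambda>A. \<Sum>e\<in>UNIV. \<phi> (mat_unit e) * M A $ fst e $ snd e)" by blast
  moreover have "(\<lambda>A. \<Sum>e\<in>UNIV. \<phi> (mat_unit e) * M A $ fst e $ snd e) \<in> polynomial_maps"
    using assms(1) by (intro polynomial_maps_sum polynomial_maps_scale) (auto simp: poly_matrix_def)
  ultimately show ?thesis by simp
qed

lemma poly_dense_matrix_eq:
  assumes "poly_dense S H" "poly_matrix M" "poly_matrix P" "\<And>A. A \<in> S \<Longrightarrow> M A = P A" "A \<in> H"
  shows "M A = P A"
proof -
  have "M A $ i $ j - P A $ i $ j = 0" for i j
    by (rule poly_denseD[OF assms(1) polynomial_maps_diff _ assms(5)])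
      (use assms in \<open>auto simp: poly_matrix_def\<close>)
  then show ?thesis by (simp add: vec_eq_iff)
qed

lemma adjugate_eq_scale:
  "A ** B = mat 1 \<Longrightarrow> B ** A = mat 1 \<Longrightarrow> adjugate A = mat_scale (det A) B"
  by (simp add: vec_eq_iff mat_scale_def adjugate_eq)

lemma mat_scale_mult: "mat_scale c A ** B = mat_scale c (A ** B)" "A ** mat_scale c B = mat_scale c (A ** B)"
  by (simp_all add: mat_scale_def matrix_matrix_mult_def vec_eq_iff sum_distrib_left mult.left_commute mult.assoc)

lemma lin_conjugation: "mat_space.lin (\<lambda>y. A ** y ** B)"
  unfolding Vector_Spaces.linear_iff
  using vector_space_mat_scale
  by (simp add: mat_scale_mult matrix_add_ldistrib) (simp add: matrix_matrix_mult_def vec_eq_iff distrib_right sum.distrib)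

context unipotent_free_linear_group
begin

text \<open>The action is on the space of all matrices, which contains \<open>H\<close>. Thus
  elements of \<open>V\<close> are themselves vectors of the representation, and commuting with g
  means being fixed by \<open>ad g\<close>.\<close>

definition ad :: "'k ^ 'n ^ 'n \<Rightarrow> 'k ^ 'n ^ 'n \<Rightarrow> 'k ^ 'n ^ 'n" where
  "ad g y = g ** y ** inv\<^bsub>G\<^esub> g"

abbreviation "hinv \<equiv> m_inv G"

lemma hinv: "x \<in> H \<Longrightarrow> hinv x ** x = mat 1" "x \<in> H \<Longrightarrow> x ** hinv x = mat 1" "x \<in> H \<Longrightarrow> hinv x \<in> H"
  using G.l_inv G.r_inv G.inv_closed by (simp_all add: G_simps)

lemma H_mult: "x \<in> H \<Longrightarrow> y \<in> H \<Longrightarrow> x ** y \<in> H"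
  using G.m_closed by (simp add: G_simps)

lemma hinv_mult: "x \<in> H \<Longrightarrow> y \<in> H \<Longrightarrow> hinv (x ** y) = hinv y ** hinv x"
  using G.inv_mult_group by (simp add: G_simps)

lemma lin_ad: "mat_space.lin (ad g)"
  unfolding ad_def by (rule lin_conjugation)

lemmas ad_linear = mat_space.linD[OF lin_ad]

lemma ad_ad: "g \<in> H \<Longrightarrow> h \<in> H \<Longrightarrow> ad g (ad h y) = ad (g ** h) y"
  by (simp add: ad_def hinv_mult matrix_mul_assoc)

lemma ad_one [simp]: "ad (mat 1) y = y"
  using G.inv_one by (simp add: ad_def G_simps)

lemma ad_hinv: "g \<in> H \<Longrightarrow> ad (hinv g) (ad g y) = y" "g \<in> H \<Longrightarrow> ad g (ad (hinv g) y) = y"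
  by (simp_all add: ad_ad hinv)

lemma ad_eq_iff: "g \<in> H \<Longrightarrow> ad g y = y \<longleftrightarrow> g ** y = y ** g"
proof
  assume g: "g \<in> H"
  have e: "ad g y ** g = g ** y"
    unfolding ad_def by (simp add: hinv[OF g] flip: matrix_mul_assoc)
  show "g ** y = y ** g" if "ad g y = y" using e that by simp
  show "ad g y = y" if "g ** y = y ** g"
    unfolding ad_def that by (simp add: hinv[OF g] flip: matrix_mul_assoc)
qed

lemma det_nz: "g \<in> H \<Longrightarrow> det g \<noteq> 0"
  using hinv by (metis invertible_def invertible_det_nz)

abbreviation stable :: "('k ^ 'n ^ 'n) set \<Rightarrow> bool" where
  "stable L \<equiv> mat_space.invariant_subspace (ad ` H) L"

lemma stableD: "stable L \<Longrightarrow> g \<in> H \<Longrightarrow> y \<in> L \<Longrightarrow> ad g y \<in> L" "stable L \<Longrightarrow> mat_space.subspace L"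
  unfolding mat_space.invariant_subspace_def by auto

end

section \<open>The part of the adjoint representation fixed by \<open>T0\<close>\<close>

locale dense_double_coset = unipotent_free_linear_group H G
  for H :: "('k::alg_closed_field ^ 'n ^ 'n) set" and G :: "('k ^ 'n ^ 'n) monoid" +
  fixes V T0 :: "('k ^ 'n ^ 'n) set" and w :: "'k ^ 'n ^ 'n"
  assumes irr: "poly_irreducible H"
    and V: "subgroup V G" and Vcom: "\<And>u v. u \<in> V \<Longrightarrow> v \<in> V \<Longrightarrow> u ** v = v ** u"
    and T0: "subgroup T0 G" and T0V: "\<And>t v. t \<in> T0 \<Longrightarrow> v \<in> V \<Longrightarrow> t ** v = v ** t"
    and w: "w \<in> H" and T0w: "\<And>t. t \<in> T0 \<Longrightarrow> inv\<^bsub>G\<^esub> w ** t ** w \<in> T0"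
    and dense: "poly_dense {v ** t ** w ** v' | v t v'. v \<in> V \<and> t \<in> T0 \<and> v' \<in> V} H"
begin

definition cell :: "('k ^ 'n ^ 'n) set" where
  "cell = {v ** t ** w ** v' | v t v'. v \<in> V \<and> t \<in> T0 \<and> v' \<in> V}"

lemma VH: "v \<in> V \<Longrightarrow> v \<in> H" and T0H: "t \<in> T0 \<Longrightarrow> t \<in> H"
  using subgroup.mem_carrier[OF V] subgroup.mem_carrier[OF T0] by (simp_all add: G_simps)

lemma Vinv: "v \<in> V \<Longrightarrow> hinv v \<in> V"
  by (rule subgroup.m_inv_closed[OF V])

lemma T0inv: "t \<in> T0 \<Longrightarrow> hinv t \<in> T0"
  by (rule subgroup.m_inv_closed[OF T0])

lemma T0mult: "s \<in> T0 \<Longrightarrow> t \<in> T0 \<Longrightarrow> s ** t \<in> T0"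
  using subgroup.m_closed[OF T0] by (simp add: G_simps)

lemma oneH: "mat 1 \<in> H"
  using G.one_closed by (simp add: G_simps)

text \<open>The largest \<open>H\<close>-stable subspace on which \<open>T0\<close> acts
  trivially.\<close>

definition fixed_part :: "('k ^ 'n ^ 'n) set" where
  "fixed_part = {y. \<forall>h\<in>H. \<forall>t\<in>T0. t ** ad h y = ad h y ** t}"

text \<open>For g = u t' w v the witness is w^-1 (t'^-1 t t') w: \<open>T0\<close> commutes with u
  and v, and \<open>w\<close> conjugates it into itself.\<close>

lemma cell_normalizes: "g \<in> cell \<Longrightarrow> t \<in> T0 \<Longrightarrow> \<exists>s\<in>T0. t ** g = g ** s"
proof -
  assume "g \<in> cell" and t: "t \<in> T0"
  then obtain u s v where g: "u \<in> V" "s \<in> T0" "v \<in> V" "g = u ** s ** w ** v" unfolding cell_def by blast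
  let ?s = "hinv w ** (hinv s ** t ** s) ** w"
  have s: "?s \<in> T0" by (intro T0w T0mult T0inv g t)
  have "g ** ?s = u ** s ** w ** (v ** ?s)" unfolding g(4) by (simp add: matrix_mul_assoc)
  also have "v ** ?s = ?s ** v" using T0V[OF s g(3)] by simp
  also have "u ** s ** w ** (?s ** v) = u ** (s ** (w ** hinv w) ** hinv s) ** t ** s ** w ** v"
    by (simp add: matrix_mul_assoc)
  also have "\<dots> = (u ** t) ** s ** w ** v" by (simp add: hinv w T0H g)
  also have "u ** t = t ** u" using T0V[OF t g(1)] by simp
  finally have "g ** ?s = t ** g" unfolding g(4) by (simp add: matrix_mul_assoc)
  with s show ?thesis by metis
qed

text \<open>For g in the cell and t g = g s, the element s commutes with v, so t commutes with g v
  g^-1. Multiplied by \<open>det g\<close> this is a polynomial identity in g, with the adjugate in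
  place of the inverse, and density extends it from the cell to \<open>H\<close>.\<close>

lemma V_fixed_part: "V \<subseteq> fixed_part"
proof
  fix v assume v: "v \<in> V"
  have "t ** ad h v = ad h v ** t" if h: "h \<in> H" and t: "t \<in> T0" for h t
  proof -
    have cellH: "g \<in> H" if "g \<in> cell" for g
      using that H_mult VH T0H w unfolding cell_def by auto
    have scale: "g ** v ** adjugate g = mat_scale (det g) (ad g v)" if "g \<in> H" for g
      unfolding ad_def using adjugate_eq_scale[of g "hinv g"] hinv[OF that] by (simp add: mat_scale_mult)
    have "t ** (h ** v ** adjugate h) = (h ** v ** adjugate h) ** t"
    proof (rule poly_dense_matrix_eq[OF dense[folded cell_def] _ _ _ h])
      show "poly_matrix (\<lambda>h. t ** (h ** v ** adjugate h))" "poly_matrix (\<lambda>h. (h ** v ** adjugate h) ** t)"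
        by (intro poly_matrix_mult poly_matrix_simple)+
      fix g assume g: "g \<in> cell"
      obtain s where s: "s \<in> T0" "t ** g = g ** s" using cell_normalizes[OF g t] by blast
      have gH: "g \<in> H" by (rule cellH[OF g])
      have sg: "s ** hinv g = hinv g ** t"
      proof -
        have "hinv g ** (t ** g) ** hinv g = hinv g ** (g ** s) ** hinv g" using s by simp
        then have "hinv g ** t ** (g ** hinv g) = (hinv g ** g) ** s ** hinv g"
          by (simp add: matrix_mul_assoc)
        then show ?thesis by (simp add: hinv[OF gH])
      qed
      have "t ** ad g v = g ** (s ** v) ** hinv g"
        unfolding ad_def using s(2) by (simp add: matrix_mul_assoc)
      also have "\<dots> = g ** v ** (s ** hinv g)" unfolding T0V[OF s(1) v] by (simp add: matrix_mul_assoc)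
      also have "\<dots> = ad g v ** t" unfolding sg ad_def by (simp add: matrix_mul_assoc)
      finally show "t ** (g ** v ** adjugate g) = (g ** v ** adjugate g) ** t"
        unfolding scale[OF gH] by (simp add: mat_scale_mult)
    qed
    then have "mat_scale (det h) (t ** ad h v) = mat_scale (det h) (ad h v ** t)"
      unfolding scale[OF h] by (simp add: mat_scale_mult)
    then show ?thesis using det_nz[OF h] by simp
  qed
  then show "v \<in> fixed_part" unfolding fixed_part_def by blast
qed

lemma fixed_part_stable: "stable fixed_part"
  unfolding mat_space.invariant_subspace_def
proof (intro conjI ballI)
  have add: "(a + b) ** c = a ** c + b ** c" for a b c :: "'k ^ 'n ^ 'n"
    by (simp add: matrix_matrix_mult_def vec_eq_iff distrib_right sum.distrib)
  show "mat_space.subspace fixed_part"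
    unfolding mat_space.subspace_def fixed_part_def
    by (auto simp: ad_linear mat_scale_mult matrix_add_ldistrib add)
  fix f assume "f \<in> ad ` H"
  then show "f ` fixed_part \<subseteq> fixed_part"
    unfolding fixed_part_def by (auto simp: ad_ad H_mult)
qed

lemma ad_T0_fixed: "t \<in> T0 \<Longrightarrow> y \<in> fixed_part \<Longrightarrow> ad t y = y"
proof -
  assume t: "t \<in> T0" and y: "y \<in> fixed_part"
  have "t ** ad (mat 1) y = ad (mat 1) y ** t" using y t oneH unfolding fixed_part_def by blast
  then show "ad t y = y" using ad_eq_iff[OF T0H[OF t]] by simp
qed

lemma ad_V_linear_commuting:
  "f \<in> ad ` V \<Longrightarrow> mat_space.lin f" "f \<in> ad ` V \<Longrightarrow> g \<in> ad ` V \<Longrightarrow> f (g y) = g (f y)"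
  using lin_ad Vcom by (auto simp: ad_ad VH)

lemma stable_imp_V_invariant: "stable L \<Longrightarrow> mat_space.invariant_subspace (ad ` V) L"
  unfolding mat_space.invariant_subspace_def using VH by auto

lemma V_eigenvector:
  assumes L: "stable L" and M: "mat_space.invariant_subspace (ad ` V) M" and LM: "L \<subset> M"
  shows "\<exists>x \<mu>. x \<in> M \<and> x \<notin> L \<and> (\<forall>f\<in>ad ` V. f x - mat_scale (\<mu> f) x \<in> L)"
proof (rule mat_space.common_eigenvector_mod[of "ad ` V" L M])
  show "mat_space.lin f" if "f \<in> ad ` V" for f by (rule ad_V_linear_commuting(1)[OF that])
  show "f (g y) = g (f y)" if "f \<in> ad ` V" "g \<in> ad ` V" for f g y by (rule ad_V_linear_commuting(2)[OF that])
qed (use stable_imp_V_invariant[OF L] M LM in blast)+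

lemma V_eigenfunctional:
  assumes L: "stable L" and M: "stable M" and LM: "L \<subseteq> M" and x: "x \<in> M" "x \<notin> L"
    and \<mu>: "\<And>f. f \<in> ad ` V \<Longrightarrow> f x - mat_scale (\<mu> f) x \<in> L"
  shows "\<exists>\<phi>. Vector_Spaces.linear mat_scale (*) \<phi> \<and> (\<forall>y\<in>L. \<phi> y = 0) \<and> (\<exists>y\<in>M. \<phi> y \<noteq> 0) \<and>
    (\<forall>f\<in>ad ` V. \<forall>y\<in>M. \<phi> (f y) = \<mu> f * \<phi> y)"
proof (rule mat_space.eigenfunctional_of_eigenvector[of "ad ` V" L M x \<mu>])
  show "mat_space.lin f" if "f \<in> ad ` V" for f by (rule ad_V_linear_commuting(1)[OF that])
  show "f (g y) = g (f y)" if "f \<in> ad ` V" "g \<in> ad ` V" for f g y by (rule ad_V_linear_commuting(2)[OF that])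
  show "f x - mat_scale (\<mu> f) x \<in> L" if "f \<in> ad ` V" for f by (rule \<mu>[OF that])
qed (use stable_imp_V_invariant[OF L] stable_imp_V_invariant[OF M] LM x in blast)+

text \<open>For \<open>V\<close>-eigenvectors \<open>x\<close>, \<open>x'\<close> modulo \<open>L\<close> with eigenfunctionals \<open>\<phi>\<close>, \<open>\<phi>'\<close> of the same weights, the
  function \<open>g \<mapsto> \<phi>' (g x) \<phi> (g\<^sup>-\<^sup>1 x')\<close> is constant on the dense double coset, as all weights cancel
  and \<open>T0\<close> acts trivially. Taking \<open>x' \<in> ker \<phi>\<close>, it vanishes at \<open>1\<close>, hence everywhere, which
  contradicts irreducibility.\<close>

lemma eigenfunctional_kernel:
  assumes L: "stable L" and M: "stable M" and LM: "L \<subseteq> M" and MF: "M \<subseteq> fixed_part"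
    and max: "\<And>K. stable K \<Longrightarrow> L \<subseteq> K \<Longrightarrow> K \<subseteq> M \<Longrightarrow> K = L \<or> K = M"
    and x: "x \<in> M" "x \<notin> L" "\<And>f. f \<in> ad ` V \<Longrightarrow> f x - mat_scale (\<mu> f) x \<in> L"
    and \<phi>: "Vector_Spaces.linear mat_scale (*) \<phi>" "\<And>y. y \<in> L \<Longrightarrow> \<phi> y = 0"
    "\<exists>y\<in>M. \<phi> y \<noteq> 0" "\<And>f y. f \<in> ad ` V \<Longrightarrow> y \<in> M \<Longrightarrow> \<phi> (f y) = \<mu> f * \<phi> y"
    and z: "z \<in> M" "\<phi> z = 0"
  shows "z \<in> L"
proof (rule ccontr)
  assume zL: "z \<notin> L"
  interpret \<phi>: Vector_Spaces.linear mat_scale "(*)" \<phi> by (rule \<phi>(1))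
  note Lsub = stableD(2)[OF L] and Msub = stableD(2)[OF M]
  define K where "K = {y \<in> M. \<phi> y = 0}"
  have K: "mat_space.invariant_subspace (ad ` V) K"
    unfolding mat_space.invariant_subspace_def
  proof (intro conjI ballI)
    show "mat_space.subspace K"
      using Msub unfolding mat_space.subspace_def K_def by (auto simp: \<phi>.add \<phi>.scale)
    show "f ` K \<subseteq> K" if "f \<in> ad ` V" for f
      using that \<phi>(4) stableD(1)[OF M] VH unfolding K_def by auto
  qed
  have "L \<subset> K" using LM \<phi>(2) z zL unfolding K_def by blast
  with V_eigenvector[OF L K] obtain x' \<mu>' where x': "x' \<in> K" "x' \<notin> L" "\<And>f. f \<in> ad ` V \<Longrightarrow> f x' - mat_scale (\<mu>' f) x' \<in> L"
    by blast
  have x'M: "x' \<in> M" and \<phi>x': "\<phi> x' = 0" using x'(1) by (auto simp: K_def)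
  obtain \<phi>' where \<phi>': "Vector_Spaces.linear mat_scale (*) \<phi>'" "\<And>y. y \<in> L \<Longrightarrow> \<phi>' y = 0"
    "\<exists>y\<in>M. \<phi>' y \<noteq> 0" "\<And>f y. f \<in> ad ` V \<Longrightarrow> y \<in> M \<Longrightarrow> \<phi>' (f y) = \<mu>' f * \<phi>' y"
    using V_eigenfunctional[of L M x' \<mu>', OF L M LM x'M x'(2,3)] by blast
  interpret \<phi>': Vector_Spaces.linear mat_scale "(*)" \<phi>' by (rule \<phi>'(1))
  have weight_inv: "\<nu> (ad v) * \<nu> (ad (hinv v)) = 1"
    if ex: "\<exists>y\<in>M. \<psi> y \<noteq> 0" and eq: "\<And>f y. f \<in> ad ` V \<Longrightarrow> y \<in> M \<Longrightarrow> \<psi> (f y) = \<nu> f * \<psi> y" and v: "v \<in> V" for \<nu> and \<psi> :: "'k ^ 'n ^ 'n \<Rightarrow> 'k" and v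
  proof -
    obtain y where y: "y \<in> M" "\<psi> y \<noteq> 0" using ex by blast
    have "\<psi> (ad v (ad (hinv v) y)) = \<nu> (ad v) * (\<nu> (ad (hinv v)) * \<psi> y)"
      using eq[OF imageI[OF v] stableD(1)[OF M VH[OF Vinv[OF v]] y(1)]]
        eq[OF imageI[OF Vinv[OF v]] y(1)] by simp
    then have "\<psi> y = (\<nu> (ad v) * \<nu> (ad (hinv v))) * \<psi> y"
      unfolding ad_hinv(2)[OF VH[OF v]] mult.assoc .
    then show ?thesis using y(2) by simp
  qed
  define f where "f g = \<phi>' (ad g x) * \<phi> (ad (hinv g) x')" for g
  \<comment> \<open>An eigenfunctional absorbs an outermost factor from \<open>V\<close>; this
    absorbs an innermost one. \<open>ad v y\<close> differs from a multiple of y by an element of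
    the stable space \<open>L\<close>, on which \<open>\<psi>\<close> vanishes.\<close>
  have transport: "\<psi> (ad g (ad v y)) = \<nu> (ad v) * \<psi> (ad g y)"
    if "Vector_Spaces.linear mat_scale (*) \<psi>" "\<And>y. y \<in> L \<Longrightarrow> \<psi> y = 0"
      "\<And>f. f \<in> ad ` V \<Longrightarrow> f y - mat_scale (\<nu> f) y \<in> L" "v \<in> V" "g \<in> H" for \<psi> \<nu> g v y
  proof -
    interpret \<psi>: Vector_Spaces.linear mat_scale "(*)" \<psi> by (rule that(1))
    have "\<psi> (ad g (ad v y - mat_scale (\<nu> (ad v)) y)) = 0"
      by (rule that(2), rule stableD(1)[OF L that(5)], rule that(3)) (use that in blast)
    then show ?thesis by (simp add: ad_linear \<psi>.diff \<psi>.scale)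
  qed
  have f_cell: "f g = f w" if g: "g \<in> cell" for g
  proof -
    obtain u t v where utv: "u \<in> V" "t \<in> T0" "v \<in> V" "g = u ** t ** w ** v" using g unfolding cell_def by blast
    note mem = VH[OF utv(1)] T0H[OF utv(2)] w VH[OF utv(3)]
    note imem = hinv(3)[OF mem(1)] hinv(3)[OF mem(2)] hinv(3)[OF w] hinv(3)[OF mem(4)]
    have fixM: "ad s y = y" if "s \<in> T0" "y \<in> M" for s y
      by (rule ad_T0_fixed) (use that MF in auto)
    have gx: "ad g x = ad u (ad t (ad w (ad v x)))"
      unfolding utv(4) using mem by (simp add: ad_ad H_mult matrix_mul_assoc)
    have gx': "ad (hinv g) x' = ad (hinv v) (ad (hinv w) (ad (hinv t) (ad (hinv u) x')))"
      unfolding utv(4) using mem imem by (simp add: ad_ad H_mult hinv_mult matrix_mul_assoc)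
    have wvx: "ad w (ad v x) \<in> M" using stableD(1)[OF M] mem x(1) by blast
    have ux': "ad (hinv u) x' \<in> M" using stableD(1)[OF M] imem x'M by blast
    have wux': "ad (hinv w) (ad (hinv u) x') \<in> M" using stableD(1)[OF M] imem ux' by blast
    have 1: "\<phi>' (ad g x) = \<mu>' (ad u) * (\<mu> (ad v) * \<phi>' (ad w x))"
      unfolding gx fixM[OF utv(2) wvx] \<phi>'(4)[OF imageI[OF utv(1)] wvx]
      by (simp add: transport[where \<psi> = \<phi>' and \<nu> = \<mu> and y = x, OF \<phi>'(1,2) x(3) utv(3) w])
    have 2: "\<phi> (ad (hinv g) x') = \<mu> (ad (hinv v)) * (\<mu>' (ad (hinv u)) * \<phi> (ad (hinv w) x'))"
      unfolding gx' fixM[OF T0inv[OF utv(2)] ux'] \<phi>(4)[OF imageI[OF Vinv[OF utv(3)]] wux']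
      by (simp add: transport[where \<psi> = \<phi> and \<nu> = \<mu>' and y = x', OF \<phi>(1,2) x'(3) Vinv[OF utv(1)] imem(3)])
    have "f g = (\<mu>' (ad u) * \<mu>' (ad (hinv u))) * (\<mu> (ad v) * \<mu> (ad (hinv v))) * f w"
      unfolding f_def 1 2 by (simp only: mult.assoc mult.left_commute mult.commute)
    then show ?thesis
      using weight_inv[OF \<phi>(3,4) utv(3)] weight_inv[OF \<phi>'(3,4) utv(1)] by simp
  qed
  \<comment> \<open>On \<open>H\<close>, p and q are \<open>det g\<close> times the two factors of
    \<open>f\<close>. So constancy of \<open>f\<close> becomes the polynomial identity p q = f(w)
    det^2, which density extends from the cell.\<close>
  define p where "p g = \<phi>' (g ** x ** adjugate g)" for g
  define q where "q g = \<phi> (adjugate g ** x' ** g)" for g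
  have p: "p \<in> polynomial_maps"
    unfolding p_def by (intro poly_matrix_functional \<phi>'(1) poly_matrix_mult poly_matrix_simple)
  have q: "q \<in> polynomial_maps"
    unfolding q_def by (intro poly_matrix_functional \<phi>(1) poly_matrix_mult poly_matrix_simple)
  have p_eq: "p g = det g * \<phi>' (ad g x)" and q_eq: "q g = det g * \<phi> (ad (hinv g) x')" if "g \<in> H" for g
    using adjugate_eq_scale[of g "hinv g"] hinv[OF that] G.inv_inv[of g] that
    by (simp_all add: p_def q_def ad_def mat_scale_mult \<phi>.scale \<phi>'.scale G_simps)
  have detp: "(\<lambda>g :: 'k ^ 'n ^ 'n. det g) \<in> polynomial_maps"
    by (rule det_polynomial) (rule polynomial_maps.entry)
  have fH: "f g = f w" if g: "g \<in> H" for g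
  proof -
    have "p g * q g - f w * (det g * det g) = 0"
    proof (rule poly_denseD[OF dense[folded cell_def] _ _ g])
      show "(\<lambda>g. p g * q g - f w * (det g * det g)) \<in> polynomial_maps"
        by (intro polynomial_maps_diff polynomial_maps_scale polynomial_maps.mult p q detp)
      fix g assume g: "g \<in> cell"
      then have gH: "g \<in> H" unfolding cell_def using H_mult VH T0H w by auto
      have "p g * q g = f g * (det g * det g)"
        unfolding p_eq[OF gH] q_eq[OF gH] f_def by (simp only: mult.assoc mult.left_commute mult.commute)
      then show "p g * q g - f w * (det g * det g) = 0" using f_cell[OF g] by simp
    qed
    moreover have "p g * q g = f g * (det g * det g)"
      unfolding p_eq[OF g] q_eq[OF g] f_def by (simp only: mult.assoc mult.left_commute mult.commute)
    ultimately show ?thesis using det_nz[OF g] by simp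
  qed
  have "hinv (mat 1) = mat 1" using G.inv_one by (simp add: G_simps)
  then have "f (mat 1) = 0" by (simp add: f_def \<phi>x')
  then have f0: "f g = 0" if "g \<in> H" for g using fH[OF that] fH[OF oneH] by simp
  have "p g * q g = 0" if "g \<in> H" for g
    using f0[OF that] unfolding p_eq[OF that] q_eq[OF that] f_def by auto
  from poly_irreducibleD[OF irr p q this]
  have alt: "(\<forall>g\<in>H. \<phi>' (ad g x) = 0) \<or> (\<forall>g\<in>H. \<phi> (ad (hinv g) x') = 0)"
    using det_nz by (auto simp: p_eq q_eq)
  \<comment> \<open>The vectors of \<open>M\<close> whose whole orbit is killed by
    \<open>\<psi>\<close> form a stable subspace containing \<open>L\<close>, and \<open>max\<close>
    leaves \<open>L\<close> and \<open>M\<close> as the possibilities.\<close>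
  have orbit: "\<not> (\<forall>g\<in>H. \<psi> (ad g y) = 0)"
    if \<psi>: "Vector_Spaces.linear mat_scale (*) \<psi>" "\<And>y. y \<in> L \<Longrightarrow> \<psi> y = 0" "\<exists>y\<in>M. \<psi> y \<noteq> 0"
      and y: "y \<in> M" "y \<notin> L" for \<psi> y
  proof
    assume zero: "\<forall>g\<in>H. \<psi> (ad g y) = 0"
    interpret \<psi>: Vector_Spaces.linear mat_scale "(*)" \<psi> by (rule \<psi>(1))
    let ?K = "{y \<in> M. \<forall>g\<in>H. \<psi> (ad g y) = 0}"
    have "stable ?K"
      unfolding mat_space.invariant_subspace_def
    proof (intro conjI ballI)
      show "mat_space.subspace ?K"
        using Msub unfolding mat_space.subspace_def by (auto simp: ad_linear \<psi>.add \<psi>.scale)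
      show "h ` ?K \<subseteq> ?K" if "h \<in> ad ` H" for h
        using that stableD(1)[OF M] H_mult by (auto simp: ad_ad)
    qed
    moreover have "L \<subseteq> ?K" using LM \<psi>(2) stableD(1)[OF L] by blast
    moreover have "y \<in> ?K" using y zero by blast
    ultimately have "?K = M" using max[of ?K] y(2) by blast
    then have "\<psi> (ad (mat 1) u) = 0" if "u \<in> M" for u using that oneH by blast
    then show False using \<psi>(3) by simp
  qed
  from alt show False
  proof
    assume "\<forall>g\<in>H. \<phi>' (ad g x) = 0"
    then show False using orbit[OF \<phi>'(1,2,3) x(1,2)] by blast
  next
    assume a: "\<forall>g\<in>H. \<phi> (ad (hinv g) x') = 0"
    have "\<phi> (ad g x') = 0" if g: "g \<in> H" for g
      using a hinv(3)[OF g] G.inv_inv[of g] g by (metis G_simps(1))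
    then show False using orbit[OF \<phi>(1,2,3) x'M x'(2)] by blast
  qed
qed

text \<open>A \<open>V\<close>-eigenfunctional on M/L has kernel exactly \<open>L\<close> by
  \<open>eigenfunctional_kernel\<close>, so M/L is a line and \<open>h\<close> acts on it by the
  scalar read off at a vector y0 where the functional is nonzero.\<close>

lemma simple_quotient_one_dimensional:
  assumes L: "stable L" and M: "stable M" and LM: "L \<subset> M" and MF: "M \<subseteq> fixed_part"
    and max: "\<And>K. stable K \<Longrightarrow> L \<subseteq> K \<Longrightarrow> K \<subseteq> M \<Longrightarrow> K = L \<or> K = M" and h: "h \<in> H"
  shows "\<exists>c. \<forall>y\<in>M. ad h y - mat_scale c y \<in> L"
proof -
  note Lsub = stableD(2)[OF L] and Msub = stableD(2)[OF M]
  have LM': "L \<subseteq> M" using LM by blast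
  obtain x \<mu> where x: "x \<in> M" "x \<notin> L" "\<And>f. f \<in> ad ` V \<Longrightarrow> f x - mat_scale (\<mu> f) x \<in> L"
    using V_eigenvector[OF L stable_imp_V_invariant[OF M] LM] by blast
  obtain \<phi> where \<phi>: "Vector_Spaces.linear mat_scale (*) \<phi>" "\<And>y. y \<in> L \<Longrightarrow> \<phi> y = 0"
    "\<exists>y\<in>M. \<phi> y \<noteq> 0" "\<And>f y. f \<in> ad ` V \<Longrightarrow> y \<in> M \<Longrightarrow> \<phi> (f y) = \<mu> f * \<phi> y"
    using V_eigenfunctional[of L M x \<mu>, OF L M LM' x] by blast
  interpret \<phi>: Vector_Spaces.linear mat_scale "(*)" \<phi> by (rule \<phi>(1))
  have ker: "z \<in> L" if "z \<in> M" "\<phi> z = 0" for z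
    by (rule eigenfunctional_kernel[OF L M LM' MF max x \<phi> that])
  obtain y0 where y0: "y0 \<in> M" "\<phi> y0 \<noteq> 0" using \<phi>(3) by blast
  define c where "c = \<phi> (ad h y0) / \<phi> y0"
  have "ad h y - mat_scale c y \<in> L" if y: "y \<in> M" for y
  proof -
    let ?a = "\<phi> y / \<phi> y0"
    have "\<phi> (y - mat_scale ?a y0) = 0" using y0 by (simp add: \<phi>.diff \<phi>.scale)
    then have l: "y - mat_scale ?a y0 \<in> L"
      by (intro ker mat_space.subspace_diff[OF Msub] mat_space.subspace_scale[OF Msub] y y0)
    have "\<phi> (ad h y0 - mat_scale c y0) = 0" using y0 by (simp add: \<phi>.diff \<phi>.scale c_def)
    then have l0: "ad h y0 - mat_scale c y0 \<in> L"
      by (intro ker mat_space.subspace_diff[OF Msub] mat_space.subspace_scale[OF Msub] stableD(1)[OF M h] y0)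
    have "ad h y - mat_scale c y = mat_scale ?a (ad h y0 - mat_scale c y0)
      + (ad h (y - mat_scale ?a y0) - mat_scale c (y - mat_scale ?a y0))"
      by (simp add: ad_linear mat_space.scale_right_diff_distrib mult.commute)
    also have "\<dots> \<in> L"
      by (intro mat_space.subspace_add[OF Lsub] mat_space.subspace_diff[OF Lsub] mat_space.subspace_scale[OF Lsub]
          stableD(1)[OF L h] l l0)
    finally show ?thesis .
  qed
  then show ?thesis by blast
qed

lemma derived_le_stabilizer:
  assumes Q: "subgroup Q G" and comm: "\<And>g h. g \<in> K \<Longrightarrow> h \<in> K \<Longrightarrow> g ** h ** hinv g ** hinv h \<in> Q"
  shows "derived G K \<subseteq> Q"
  unfolding derived_def
  by (rule G.generate_subgroup_incl[OF _ Q]) (use comm in \<open>auto simp: G_simps\<close>)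

text \<open>Take a maximal proper stable subspace L1, and r for L1 by induction on the dimension.
  \<open>H\<close> acts on L/L1 by scalars, so its commutators act trivially there. Elements g of
  the derived term r + 1 thus fix L1, and g - 1 maps \<open>L\<close> into L1; such operators
  commute, so the term r + 2 acts trivially on \<open>L\<close>.\<close>

lemma derived_acts_trivially:
  assumes "stable L" "L \<subseteq> fixed_part"
  shows "\<exists>r. \<forall>g\<in>(derived G ^^ r) H. \<forall>y\<in>L. ad g y = y"
  using assms
proof (induction "mat_space.dim L" arbitrary: L rule: less_induct)
  case less
  have subgroup_H: "subgroup H G" using G.subgroup_self by (simp add: G_simps)
  let ?D = "\<lambda>r. (derived G ^^ r) H"
  have D: "subgroup (?D r) G" for r by (rule G.exp_of_derived_is_subgroup[OF subgroup_H])
  have DH: "?D r \<subseteq> H" for r using subgroup.subset[OF D] by (simp add: G_simps)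
  have D_Suc: "?D (Suc r) \<subseteq> ?D r" for r using G.derived_incl[OF subset_refl D] by simp
  show ?case
  proof (cases "L = {0}")
    case True
    then show ?thesis by (auto simp: ad_linear)
  next
    case False
    note Lsub = stableD(2)[OF less.prems(1)]
    have "{0} \<subset> L" using False mat_space.subspace_0[OF Lsub] by blast
    moreover have "stable {0}"
      unfolding mat_space.invariant_subspace_def by (auto simp: ad_linear)
    ultimately obtain L1 where L1: "stable L1 \<and> L1 \<subset> L" "\<And>K. stable K \<and> K \<subset> L \<Longrightarrow> L1 \<subseteq> K \<Longrightarrow> K = L1"
      using mat_space.ex_maximal_subspace[of "\<lambda>K. stable K \<and> K \<subset> L" "{0}"] stableD(2) by metis
    note L1sub = stableD(2)[OF conjunct1[OF L1(1)]]
    have st: "stable L1" and L1L: "L1 \<subset> L" using L1(1) by auto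
    have max: "K = L1 \<or> K = L" if "stable K" "L1 \<subseteq> K" "K \<subseteq> L" for K using L1(2)[of K] that by blast
    have "mat_space.dim L1 < mat_space.dim L"
      using mat_space.dim_psubset L1L L1sub Lsub by (metis mat_space.span_eq_iff)
    from less.hyps[OF this st] L1L less.prems(2)
    obtain r where r: "\<And>g y. g \<in> ?D r \<Longrightarrow> y \<in> L1 \<Longrightarrow> ad g y = y" by blast
    define Q where "Q = {g \<in> H. \<forall>y\<in>L. ad g y - y \<in> L1}"
    have Q: "subgroup Q G"
    proof (rule G.subgroupI)
      show "Q \<subseteq> carrier G" by (auto simp: Q_def G_simps)
      have "mat 1 \<in> Q" using oneH mat_space.subspace_0[OF L1sub] by (simp add: Q_def)
      then show "Q \<noteq> {}" by blast
      fix a assume a: "a \<in> Q"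
      then have aH: "a \<in> H" by (simp add: Q_def)
      have "ad (hinv a) y - y \<in> L1" if y: "y \<in> L" for y
      proof -
        have z: "ad (hinv a) y \<in> L" by (rule stableD(1)[OF less.prems(1) hinv(3)[OF aH] y])
        then have "ad a (ad (hinv a) y) - ad (hinv a) y \<in> L1" using a unfolding Q_def by blast
        then have "- (y - ad (hinv a) y) \<in> L1"
          using mat_space.subspace_neg[OF L1sub] by (simp only: ad_hinv[OF aH])
        then show ?thesis by simp
      qed
      then show "inv\<^bsub>G\<^esub> a \<in> Q" using hinv(3)[OF aH] by (simp add: Q_def)
      fix b assume b: "b \<in> Q"
      then have bH: "b \<in> H" by (simp add: Q_def)
      have "ad (a ** b) y - y \<in> L1" if y: "y \<in> L" for y
      proof -
        have z: "ad b y \<in> L" by (rule stableD(1)[OF less.prems(1) bH y])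
        have "(ad a (ad b y) - ad b y) + (ad b y - y) \<in> L1"
          using a b z y mat_space.subspace_add[OF L1sub] unfolding Q_def by blast
        then show ?thesis by (simp add: ad_ad[OF aH bH])
      qed
      then show "a \<otimes>\<^bsub>G\<^esub> b \<in> Q" using H_mult[OF aH bH] by (simp add: Q_def G_simps)
    qed
    \<comment> \<open>With z = ad (g^-1 h^-1) y, the commutator sends y = ad (h g) z to ad (g h) z.
      So it suffices to compare g h and h g on \<open>L\<close>, once modulo \<open>L1\<close> and
      once exactly.\<close>
    have factor: "ad (g ** h ** hinv g ** hinv h) y = ad (g ** h) (ad (hinv g ** hinv h) y)
        \<and> y = ad (h ** g) (ad (hinv g ** hinv h) y) \<and> ad (hinv g ** hinv h) y \<in> L"
      if gh: "g \<in> H" "h \<in> H" and y: "y \<in> L" for g h y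
    proof -
      have i: "hinv g \<in> H" "hinv h \<in> H" using hinv(3) gh by auto
      have "(h ** g) ** (hinv g ** hinv h) = h ** (g ** hinv g) ** hinv h" by (simp add: matrix_mul_assoc)
      then have "(h ** g) ** (hinv g ** hinv h) = mat 1" by (simp add: hinv gh)
      then have "ad (h ** g) (ad (hinv g ** hinv h) y) = y"
        using ad_ad[OF H_mult[OF gh(2,1)] H_mult[OF i]] by simp
      moreover have "ad (g ** h ** hinv g ** hinv h) y = ad (g ** h) (ad (hinv g ** hinv h) y)"
        using ad_ad[OF H_mult[OF gh] H_mult[OF i]] by (simp add: matrix_mul_assoc)
      ultimately show ?thesis using stableD(1)[OF less.prems(1) H_mult[OF i] y] by simp
    qed
    have "derived G H \<subseteq> Q"
    proof (rule derived_le_stabilizer[OF Q])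
      fix g h assume gh: "g \<in> H" "h \<in> H"
      obtain c d where c: "\<And>y. y \<in> L \<Longrightarrow> ad g y - mat_scale c y \<in> L1" and d: "\<And>y. y \<in> L \<Longrightarrow> ad h y - mat_scale d y \<in> L1"
        using simple_quotient_one_dimensional[OF st less.prems(1) L1L less.prems(2) max] gh by metis
      have "ad (g ** h ** hinv g ** hinv h) y - y \<in> L1" if y: "y \<in> L" for y
      proof -
        let ?z = "ad (hinv g ** hinv h) y"
        note fac = factor[OF gh y]
        have z: "?z \<in> L" using fac by blast
        have "ad (g ** h) ?z - ad (h ** g) ?z
          = (ad g (ad h ?z - mat_scale d ?z) + mat_scale d (ad g ?z - mat_scale c ?z))
          - (ad h (ad g ?z - mat_scale c ?z) + mat_scale c (ad h ?z - mat_scale d ?z))"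
          by (simp add: ad_ad[OF gh, symmetric] ad_ad[OF gh(2,1), symmetric] ad_linear
              mat_space.scale_right_diff_distrib mult.commute)
        also have "\<dots> \<in> L1"
          by (intro mat_space.subspace_add[OF L1sub] mat_space.subspace_diff[OF L1sub]
              mat_space.subspace_scale[OF L1sub] stableD(1)[OF st] gh c d z)
        finally show ?thesis using fac by simp
      qed
      moreover have "g ** h ** hinv g ** hinv h \<in> H" using gh H_mult hinv(3) by simp
      ultimately show "g ** h ** hinv g ** hinv h \<in> Q" by (simp add: Q_def)
    qed
    moreover have "?D (Suc r) \<subseteq> derived G H" using G.mono_derived[OF DH[of r]] by simp
    ultimately have DQ: "?D (Suc r) \<subseteq> Q" by blast
    define E where "E = {g \<in> H. \<forall>y\<in>L. ad g y = y}"
    have E: "subgroup E G"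
    proof (rule G.subgroupI)
      show "E \<subseteq> carrier G" by (auto simp: E_def G_simps)
      show "E \<noteq> {}" using oneH by (auto simp: E_def)
      fix a assume a: "a \<in> E"
      then have aH: "a \<in> H" and aL: "ad a y = y" if "y \<in> L" for y using that by (auto simp: E_def)
      have "ad (hinv a) y = y" if "y \<in> L" for y
        using ad_hinv(1)[OF aH, of y y] aL[OF that] that by simp
      then show "inv\<^bsub>G\<^esub> a \<in> E" using a hinv(3)[of a] by (auto simp: E_def)
      fix b assume "b \<in> E"
      then show "a \<otimes>\<^bsub>G\<^esub> b \<in> E" using a H_mult[of a b] by (auto simp: E_def G_simps ad_ad[symmetric])
    qed
    have "derived G (?D (Suc r)) \<subseteq> E"
    proof (rule derived_le_stabilizer[OF E])
      fix g h assume gh: "g \<in> ?D (Suc r)" "h \<in> ?D (Suc r)"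
      then have ghH: "g \<in> H" "h \<in> H" using DH by blast+
      have tr: "ad g y = y" "ad h y = y" if "y \<in> L1" for y using r gh D_Suc[of r] that by blast+
      have "ad (g ** h ** hinv g ** hinv h) y = y" if y: "y \<in> L" for y
      proof -
        let ?z = "ad (hinv g ** hinv h) y"
        note fac = factor[OF ghH y]
        have z: "?z \<in> L" using fac by blast
        have "ad g ?z - ?z \<in> L1" "ad h ?z - ?z \<in> L1" using gh DQ z unfolding Q_def by blast+
        from tr(2)[OF this(1)] tr(1)[OF this(2)]
        have "ad h (ad g ?z) = ad h ?z + (ad g ?z - ?z)" "ad g (ad h ?z) = ad g ?z + (ad h ?z - ?z)"
          by (simp_all add: ad_linear algebra_simps)
        then have "ad g (ad h ?z) = ad h (ad g ?z)" by simp
        then show ?thesis using fac by (simp add: ad_ad ghH)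
      qed
      moreover have "g ** h ** hinv g ** hinv h \<in> H" using ghH H_mult hinv(3) by simp
      ultimately show "g ** h ** hinv g ** hinv h \<in> E" by (simp add: E_def)
    qed
    then have "?D (Suc (Suc r)) \<subseteq> E" by simp
    then show ?thesis unfolding E_def by blast
  qed
qed

lemma V_centralized_by_derived: "\<exists>r. V \<subseteq> centr G (carrier G) ((derived G ^^ r) (carrier G))"
proof -
  obtain r where r: "\<And>g y. g \<in> (derived G ^^ r) H \<Longrightarrow> y \<in> fixed_part \<Longrightarrow> ad g y = y"
    using derived_acts_trivially[OF fixed_part_stable subset_refl] by blast
  have sub: "(derived G ^^ r) H \<subseteq> H"
    using G.exp_of_derived_in_carrier[of H r] by (simp add: G_simps)
  have "v ** g = g ** v" if "v \<in> V" "g \<in> (derived G ^^ r) H" for v g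
    using r[of g v] V_fixed_part that sub ad_eq_iff[of g v] by (metis subsetD)
  then have "V \<subseteq> centr G (carrier G) ((derived G ^^ r) (carrier G))"
    using VH by (auto simp: centr_def G_simps)
  then show ?thesis by blast
qed

end

theorem theorem1p2:
  fixes G H B N :: "('k::alg_closed_field ^ 'n ^ 'n) set"
    and S :: "('k ^ 'n ^ 'n) set set"
  assumes "reductive_group G"
    and "subgroup H (GL\<lparr>carrier := G\<rparr>)"
    and "zariski_dense G H"
    and "\<And>A. A \<in> H \<Longrightarrow> unipotent A \<Longrightarrow> A = mat 1"
    and "BN_pair (GL\<lparr>carrier := H\<rparr>) B N S"
    and "BN_split (GL\<lparr>carrier := H\<rparr>) B N"
    and "BN_spherical (GL\<lparr>carrier := H\<rparr>) B N"
    and "no_rank_one_factors (weyl_group (GL\<lparr>carrier := H\<rparr>) B N) S"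
  shows "B = H"
proof -
  let ?G = "GL\<lparr>carrier := H\<rparr>"
  have G: "subgroup G GL" and conn: "connectedin zariski G"
    using assms(1) by (auto simp: reductive_group_def linear_algebraic_group_def)
  have HG: "H \<subseteq> G" using subgroup.subset[OF assms(2)] by simp
  have H: "subgroup H GL" by (rule group.incl_subgroup[OF group_GL G assms(2)])
  have dense: "poly_dense H G" by (rule zariski_dense_imp_poly_dense[OF assms(3) HG])
  have irr: "poly_irreducible H" by (rule connected_imp_poly_irreducible[OF G conn dense HG])
  have locale_H: "unipotent_free_linear_group H ?G"
    by (rule unipotent_free_linear_group.intro) (use H assms(4) in auto)
  interpret unipotent_free_linear_group H ?G by (rule locale_H)
  interpret zariski_dense_group ?G "\<lambda>A. poly_dense A H"
  proof
    fix A K assume "subgroup A ?G" "\<And>a b. a \<in> A \<Longrightarrow> b \<in> A \<Longrightarrow> a \<otimes>\<^bsub>?G\<^esub> b = b \<otimes>\<^bsub>?G\<^esub> a" "subgroup K ?G"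
      "\<And>k a. k \<in> K \<Longrightarrow> a \<in> A \<Longrightarrow> k \<otimes>\<^bsub>?G\<^esub> a \<otimes>\<^bsub>?G\<^esub> inv\<^bsub>?G\<^esub> k \<in> A"
    then show "finite_idx ?G K (centr ?G K A)"
      by (intro abelian_normalizer G.centr_subgroup subgroup.subset) auto
  next
    fix Y assume "Y \<subseteq> carrier ?G"
    then show "\<exists>F. finite F \<and> F \<subseteq> Y \<and> centr ?G (carrier ?G) F \<subseteq> centr ?G (carrier ?G) Y"
      by (rule finite_centralizer_basis)
  next
    show "poly_dense (carrier ?G) H" by (simp add: poly_dense_def)
  next
    fix A J and C :: "('k ^ 'n ^ 'n) \<times> ('k ^ 'n ^ 'n) \<times> ('k ^ 'n ^ 'n) \<Rightarrow> ('k ^ 'n ^ 'n) set"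
    assume "poly_dense A H" "finite J" "A \<subseteq> (\<Union>j\<in>J. C j)"
    then show "\<exists>j\<in>J. poly_dense (C j) H"
      using poly_dense_finite_union[OF irr] subgroup.one_closed[OF H] by blast
  next
    fix a b A assume a: "a \<in> carrier ?G" and b: "b \<in> carrier ?G" and "A \<subseteq> carrier ?G"
      and d: "poly_dense ((\<lambda>x. a \<otimes>\<^bsub>?G\<^esub> x \<otimes>\<^bsub>?G\<^esub> b) ` A) H"
    have aH: "a \<in> H" and bH: "b \<in> H" using a b by (simp_all add: G_simps)
    have "poly_dense ((\<lambda>x. a ** x ** b) ` A) H" using d by (simp only: G_simps)
    from poly_dense_translate[OF this hinv(1)[OF aH] hinv(2)[OF bH]] show "poly_dense A H"
      by (simp add: H_mult aH bH)
  next
    fix A x y g assume A: "poly_dense A H" and eq: "\<And>g. g \<in> A \<Longrightarrow> g \<otimes>\<^bsub>?G\<^esub> x = y \<otimes>\<^bsub>?G\<^esub> g"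
      and g: "g \<in> carrier ?G"
    have eq': "g ** x = y ** g" if "g \<in> A" for g using eq[OF that] by (simp only: G_simps)
    have gH: "g \<in> H" using g by (simp only: G_simps)
    have "poly_matrix (\<lambda>g. g ** x)" "poly_matrix (\<lambda>g. y ** g)"
      by (intro poly_matrix_mult poly_matrix_simple)+
    from poly_dense_matrix_eq[OF A this eq' gH] have "g ** x = y ** g" .
    then show "g \<otimes>\<^bsub>?G\<^esub> x = y \<otimes>\<^bsub>?G\<^esub> g" by (simp only: G_simps)
  next
    fix V T0 w
    assume V: "subgroup V ?G" "\<And>u v. u \<in> V \<Longrightarrow> v \<in> V \<Longrightarrow> u \<otimes>\<^bsub>?G\<^esub> v = v \<otimes>\<^bsub>?G\<^esub> u"
      and T0: "subgroup T0 ?G" "\<And>t v. t \<in> T0 \<Longrightarrow> v \<in> V \<Longrightarrow> t \<otimes>\<^bsub>?G\<^esub> v = v \<otimes>\<^bsub>?G\<^esub> t"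
      and w: "w \<in> carrier ?G" "\<And>t. t \<in> T0 \<Longrightarrow> inv\<^bsub>?G\<^esub> w \<otimes>\<^bsub>?G\<^esub> t \<otimes>\<^bsub>?G\<^esub> w \<in> T0"
      and d: "poly_dense {v \<otimes>\<^bsub>?G\<^esub> t \<otimes>\<^bsub>?G\<^esub> w \<otimes>\<^bsub>?G\<^esub> v' | v t v'. v \<in> V \<and> t \<in> T0 \<and> v' \<in> V} H"
    interpret dense_double_coset H ?G V T0 w
    proof (rule dense_double_coset.intro[OF locale_H dense_double_coset_axioms.intro[OF irr V(1) _ T0(1)]])
      show "u ** v = v ** u" if "u \<in> V" "v \<in> V" for u v using V(2)[OF that] by (simp only: G_simps)
      show "t ** v = v ** t" if "t \<in> T0" "v \<in> V" for t v using T0(2)[OF that] by (simp only: G_simps)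
      show "w \<in> H" using w(1) by (simp only: G_simps)
      show "inv\<^bsub>?G\<^esub> w ** t ** w \<in> T0" if "t \<in> T0" for t using w(2)[OF that] by (simp only: G_simps)
      show "poly_dense {v ** t ** w ** v' | v t v'. v \<in> V \<and> t \<in> T0 \<and> v' \<in> V} H"
        using d by (simp only: G_simps)
    qed
    show "\<exists>r. V \<subseteq> centr ?G (carrier ?G) ((derived ?G ^^ r) (carrier ?G))"
      by (rule V_centralized_by_derived)
  qed
  show ?thesis using split_spherical_BN_pair_trivial[OF assms(5-7)] by simp
qed

end
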